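(* Let $\lambda\in(0,1)$, $k\in\{0,1,2,\ldots\}$, $T>0$, $\Delta x>0$, and let $u_0\in L^2(\mathbb{R})$. Let $f:\mathbb{R}\to\mathbb{R}$ be Lipschitz continuous with $f(0)=0$, and let $F:\mathbb{R}\times\mathbb{R}\to\mathbb{R}$ be a numerical flux for $f$. Then any solution $\tilde u$ of the semidiscrete DG method (of degree $k$, on the grid of size $\Delta x$, with initial datum $u_0$) which belongs to $C^1([0,T];H^{\lambda/2}(\mathbb{R}))$ satisfies $$\|\tilde u(\cdot,T)\|_{L^2(\mathbb{R})}^2+c_\lambda\int_0^T|\tilde u(\cdot,t)|_{H^{\lambda/2}(\mathbb{R})}^2\,dt\le\|u_0\|_{L^2(\mathbb{R})}^2 .$$
   Context: All functions are real-valued. Fractional Laplacian: $g=g_\lambda=-(-\partial_x^2)^{\lambda/2}$ is defined by $\widehat{g[\varphi]}(\xi)=-|\xi|^\lambda\hat\varphi(\xi)$ (Fourier transform $\hat\varphi(\xi)=\int e^{-ix\xi}\varphi(x)\,dx$) or, equivalently, $g[\varphi](x)=c_\lambda\int_{|z|>0}\frac{\varphi(x+z)-\varphi(x)}{|z|^{1+\lambda}}dz$, where $c_\lambda>0$ is the constant making the two definitions agree. Sobolev space: $H^{\lambda/2}(\mathbb{R})$ has norm $\|u\|_{H^{\lambda/2}}^2=\|u\|_{L^2}^2+|u|_{H^{\lambda/2}}^2$ with $|u|_{H^{\lambda/2}(\mathbb{R})}^2=\int_{\mathbb{R}}\int_{\mathbb{R}}\frac{[u(z)-u(x)]^2}{|z-x|^{1+\lambda}}dz\,dx$.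 The operator $g$ maps $H^{\lambda/2}(\mathbb{R})$ into its dual $H^{-\lambda/2}(\mathbb{R})$, and integrals $\int g[u]v$ with $u,v\in H^{\lambda/2}(\mathbb{R})$ are understood as the duality pairing $\langle g[u],v\rangle$. Numerical flux: $F$ is Lipschitz continuous on $\mathbb{R}\times\mathbb{R}$, $F(a,a)=f(a)$ for all $a$, $F$ is non-decreasing in its first variable and non-increasing in its second variable. Grid and basis: $x_i=i\Delta x$, $I_i=(x_i,x_{i+1})$, $i\in\mathbb{Z}$. For $p=0,\ldots,k$, $\varphi_{p,i}(x)=P_p\big(\tfrac{2(x-x_i)}{\Delta x}-1\big)$ on $I_i$ and $0$ outside $I_i$, where $P_p$ is the standard Legendre polynomial of degree $p$; thus $\int_{I_i}\varphi_{p,i}\varphi_{q,i}=\frac{\Delta x}{2q+1}$ if $p=q$ and $0$ otherwise, and the one-sided limits at the end-points are $\varphi_{p,i}(x_{i+1}^-)=1$, $\varphi_{p,i}(x_i^+)=(-1)^p$. Semidiscrete DG method: find $\tilde u(x,t)=\sum_{i\in\mathbb{Z}}\sum_{p=0}^kU_{p,i}(t)\varphi_{p,i}(x)$ such that for all $q=0,\ldots,k$, $i\in\mathbb{Z}$ and $t\in[0,T]$, $$\tfrac{\Delta x}{2q+1}\tfrac{d}{dt}U_{q,i}=\int_{I_i}f(\tilde u)\tfrac{d}{dx}\varphi_{q,i}\,dx+(-1)^qF(\tilde u_i)-F(\tilde u_{i+1})+\int_{I_i}g[\tilde u]\varphi_{q,i}\,dx,$$ $$U_{q,i}(0)=\tfrac{2q+1}{\Delta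 x}\int_{I_i}u_0(x)\varphi_{q,i}(x)\,dx,$$ where $F(\tilde u_i):=F(\tilde u(x_i^-,t),\tilde u(x_i^+,t))$ with $\tilde u(x_i^\pm,t)$ the right/left limits at $x_i$. *)

theory Defs
  imports
    "HOL-Analysis.Analysis"
    "HOL-Computational_Algebra.Polynomial"
begin

text \<open>
  Elements of Lebesgue and Sobolev spaces are represented by Borel functions on the real line
  (every almost-everywhere class has a Borel representative), so all integrals are taken with
  respect to \<open>lborel\<close>.
\<close>

section \<open>Function spaces\<close>

definition L2_space :: "(real \<Rightarrow> real) set" where
  "L2_space = {u. u \<in> borel_measurable borel \<and> integrable lborel (\<lambda>x. (u x)\<^sup>2)}"

definition L2_norm :: "(real \<Rightarrow> real) \<Rightarrow> real" where
  "L2_norm u = sqrt (LINT x|lborel. (u x)\<^sup>2)"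

text \<open>
  The parameter \<open>l\<close> is the order of the fractional Laplacian: \<open>sobolev_space l\<close> is the Sobolev
  space of order \<open>l / 2\<close>. The value of the integrand on the diagonal, a null set, is \<open>0\<close>.
\<close>

definition gagliardo_integrand :: "real \<Rightarrow> (real \<Rightarrow> real) \<Rightarrow> real \<times> real \<Rightarrow> real" where
  "gagliardo_integrand l u = (\<lambda>(x, z). (u z - u x)\<^sup>2 / \<bar>z - x\<bar> powr (1 + l))"

definition sobolev_space :: "real \<Rightarrow> (real \<Rightarrow> real) set" where
  "sobolev_space l =
     {u \<in> L2_space. integrable (lborel \<Otimes>\<^sub>M lborel) (gagliardo_integrand l u)}"

definition sobolev_seminorm :: "real \<Rightarrow> (real \<Rightarrow> real) \<Rightarrow> real" where
  "sobolev_seminorm l u = sqrt (LINT p|(lborel \<Otimes>\<^sub>M lborel). gagliardo_integrand l u p)"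

definition sobolev_norm :: "real \<Rightarrow> (real \<Rightarrow> real) \<Rightarrow> real" where
  "sobolev_norm l u = sqrt ((L2_norm u)\<^sup>2 + (sobolev_seminorm l u)\<^sup>2)"

text \<open>
  Continuously differentiable curves from \<open>{0..T}\<close> into the Sobolev space; differentiability (with
  derivative \<open>v\<close>) and continuity of \<open>v\<close> are meant in the Sobolev norm.
\<close>

definition C1_sobolev :: "real \<Rightarrow> real \<Rightarrow> (real \<Rightarrow> real \<Rightarrow> real) \<Rightarrow> bool" where
  "C1_sobolev l T u \<longleftrightarrow>
     (\<forall>t\<in>{0..T}. u t \<in> sobolev_space l) \<and>
     (\<exists>v. \<forall>t\<in>{0..T}. v t \<in> sobolev_space l \<and>
        ((\<lambda>s. sobolev_norm l (\<lambda>x. (u s x - u t x) / (s - t) - v t x)) \<longlongrightarrow> 0)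
          (at t within {0..T}) \<and>
        ((\<lambda>s. sobolev_norm l (\<lambda>x. v s x - v t x)) \<longlongrightarrow> 0) (at t within {0..T}))"

section \<open>The fractional Laplacian\<close>

definition test_function :: "(real \<Rightarrow> real) \<Rightarrow> bool" where
  "test_function \<phi> \<longleftrightarrow>
     (\<forall>n x. (deriv ^^ n) \<phi> differentiable (at x)) \<and> (\<exists>R. \<forall>x. \<bar>x\<bar> > R \<longrightarrow> \<phi> x = 0)"

definition fourier :: "(real \<Rightarrow> real) \<Rightarrow> real \<Rightarrow> complex" where
  "fourier \<phi> \<xi> = (LINT x|lborel. exp (- \<i> * of_real (x * \<xi>)) * of_real (\<phi> x))"

definition singular_integral :: "real \<Rightarrow> (real \<Rightarrow> real) \<Rightarrow> real \<Rightarrow> real" where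
  "singular_integral l \<phi> x =
     (LINT z:{z. \<bar>z\<bar> > 0}|lborel. (\<phi> (x + z) - \<phi> x) / \<bar>z\<bar> powr (1 + l))"

text \<open>
  The constant for which the singular integral has Fourier symbol \<open>- \<bar>\<xi>\<bar> powr l\<close>. For
  \<open>0 < l < 1\<close> it exists and is unique: it is the reciprocal of the integral of
  \<open>(1 - cos z) / \<bar>z\<bar> powr (1 + l)\<close>.
\<close>

definition frac_const :: "real \<Rightarrow> real" where
  "frac_const l = (THE c. c > 0 \<and>
     (\<forall>\<phi>. test_function \<phi> \<longrightarrow>
        (\<forall>\<xi>. fourier (\<lambda>x. c * singular_integral l \<phi> x) \<xi> =
              - of_real (\<bar>\<xi>\<bar> powr l) * fourier \<phi> \<xi>)))"

definition frac_laplacian :: "real \<Rightarrow> (real \<Rightarrow> real) \<Rightarrow> real \<Rightarrow> real" where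
  "frac_laplacian l \<phi> x = frac_const l * singular_integral l \<phi> x"

text \<open>
  On the Sobolev space the fractional Laplacian is the bounded linear operator into the dual space
  that extends the operator above from test functions. Here \<open>G u v\<close> is the value of the functional
  \<open>G u\<close> at \<open>v\<close>, and the square-integrable function \<open>frac_laplacian l \<phi>\<close> is identified, as usual,
  with the functional it induces through the \<open>L\<^sup>2\<close> inner product. Since test functions are dense,
  such an extension is unique (as far as its values on the Sobolev space are concerned).
\<close>

definition extends_frac_laplacian ::
  "real \<Rightarrow> ((real \<Rightarrow> real) \<Rightarrow> (real \<Rightarrow> real) \<Rightarrow> real) \<Rightarrow> bool" where
  "extends_frac_laplacian l G \<longleftrightarrow>
     (\<forall>u\<in>sobolev_space l. \<forall>v\<in>sobolev_space l. \<forall>w\<in>sobolev_space l. \<forall>a b.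
        G (\<lambda>x. a * u x + b * v x) w = a * G u w + b * G v w \<and>
        G w (\<lambda>x. a * u x + b * v x) = a * G w u + b * G w v) \<and>
     (\<exists>C. \<forall>u\<in>sobolev_space l. \<forall>v\<in>sobolev_space l.
        \<bar>G u v\<bar> \<le> C * sobolev_norm l u * sobolev_norm l v) \<and>
     (\<forall>\<phi>. test_function \<phi> \<longrightarrow>
        (\<forall>v\<in>sobolev_space l. G \<phi> v = (LINT x|lborel. frac_laplacian l \<phi> x * v x)))"

text \<open>The duality pairing of the fractional Laplacian of \<open>u\<close> with \<open>v\<close>.\<close>

definition frac_laplacian_pairing :: "real \<Rightarrow> (real \<Rightarrow> real) \<Rightarrow> (real \<Rightarrow> real) \<Rightarrow> real" where
  "frac_laplacian_pairing l u v = (THE r. \<exists>G. extends_frac_laplacian l G \<and> G u v = r)"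

section \<open>The semidiscrete discontinuous Galerkin method\<close>

definition numerical_flux :: "(real \<Rightarrow> real) \<Rightarrow> (real \<Rightarrow> real \<Rightarrow> real) \<Rightarrow> bool" where
  "numerical_flux f F \<longleftrightarrow>
     (\<exists>L. L-lipschitz_on UNIV (\<lambda>(a, b). F a b)) \<and>
     (\<forall>a. F a a = f a) \<and>
     (\<forall>b. mono (\<lambda>a. F a b)) \<and>
     (\<forall>a. antimono (\<lambda>b. F a b))"

text \<open>Legendre polynomials, by Rodrigues' formula; \<open>[:-1, 0, 1:]\<close> is the polynomial \<open>x\<^sup>2 - 1\<close>.\<close>

definition legendre :: "nat \<Rightarrow> real poly" where
  "legendre p = smult (1 / (2 ^ p * fact p)) ((pderiv ^^ p) ([:-1, 0, 1:] ^ p))"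

definition grid_point :: "real \<Rightarrow> int \<Rightarrow> real" where
  "grid_point dx i = of_int i * dx"

definition cell :: "real \<Rightarrow> int \<Rightarrow> real set" where
  "cell dx i = {grid_point dx i <..< grid_point dx (i + 1)}"

definition dg_basis :: "real \<Rightarrow> nat \<Rightarrow> int \<Rightarrow> real \<Rightarrow> real" where
  "dg_basis dx p i x =
     (if x \<in> cell dx i then poly (legendre p) (2 * (x - grid_point dx i) / dx - 1) else 0)"

text \<open>The sum over the cells has at most one non-zero term at every point.\<close>

definition dg_function :: "nat \<Rightarrow> real \<Rightarrow> (nat \<Rightarrow> int \<Rightarrow> real) \<Rightarrow> real \<Rightarrow> real" where
  "dg_function k dx c x = (\<Sum>\<^sub>\<infinity>i\<in>UNIV. \<Sum>p\<le>k. c p i * dg_basis dx p i x)"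

definition interface_flux :: "(real \<Rightarrow> real \<Rightarrow> real) \<Rightarrow> real \<Rightarrow> (real \<Rightarrow> real) \<Rightarrow> int \<Rightarrow> real" where
  "interface_flux F dx w i =
     F (Lim (at_left (grid_point dx i)) w) (Lim (at_right (grid_point dx i)) w)"

text \<open>
  The integral of the fractional Laplacian of the solution against a basis function over a cell is
  the pairing with that basis function, which vanishes outside the cell.
\<close>

definition dg_rhs ::
  "real \<Rightarrow> (real \<Rightarrow> real) \<Rightarrow> (real \<Rightarrow> real \<Rightarrow> real) \<Rightarrow> real \<Rightarrow> (real \<Rightarrow> real) \<Rightarrow> nat \<Rightarrow> int \<Rightarrow> real" where
  "dg_rhs l f F dx w q i =
     (LINT x:cell dx i|lborel. f (w x) * deriv (dg_basis dx q i) x)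
     + (-1) ^ q * interface_flux F dx w i - interface_flux F dx w (i + 1)
     + frac_laplacian_pairing l w (dg_basis dx q i)"

definition dg_solution ::
  "real \<Rightarrow> nat \<Rightarrow> real \<Rightarrow> real \<Rightarrow> (real \<Rightarrow> real) \<Rightarrow> (real \<Rightarrow> real \<Rightarrow> real) \<Rightarrow> (real \<Rightarrow> real) \<Rightarrow>
    (real \<Rightarrow> real \<Rightarrow> real) \<Rightarrow> bool" where
  "dg_solution l k T dx f F u0 u \<longleftrightarrow>
     (\<exists>U :: nat \<Rightarrow> int \<Rightarrow> real \<Rightarrow> real.
        (\<forall>t\<in>{0..T}. u t = dg_function k dx (\<lambda>p i. U p i t)) \<and>
        (\<forall>q\<le>k. \<forall>i. \<forall>t\<in>{0..T}.
           ((\<lambda>s. dx / (2 * real q + 1) * U q i s) has_real_derivative dg_rhs l f F dx (u t) q i)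
             (at t within {0..T})) \<and>
        (\<forall>q\<le>k. \<forall>i.
           U q i 0 = (2 * real q + 1) / dx * (LINT x:cell dx i|lborel. u0 x * dg_basis dx q i x)))"

end

theory Submission
  imports Defs
begin

text \<open>
  The pairing with the fractional Laplacian is \<open>- frac_const l / 2\<close> times the inner product of
  the difference quotients \<open>(u z - u x) / \<bar>z - x\<bar> powr ((1 + l) / 2)\<close>: both are bounded bilinear
  extensions of the singular integral, and for \<open>l < 1\<close> a piecewise polynomial is a limit of test
  functions in the Sobolev norm, as a layer of width \<open>\<epsilon>\<close> around a jump costs only
  \<open>\<epsilon> powr (1 - l)\<close>. This identity is formal in the constant \<open>frac_const l\<close>, whose value plays
  no role. By the same computation the Sobolev norm of a piecewise polynomial on the grid is bounded by
  its \<open>L\<^sup>2\<close> norm, so that its truncations to finitely many cells converge in the Sobolev norm.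
  One may therefore test the scheme with the solution itself: the jumps of a monotone flux dissipate
  energy, the boundary terms of the truncation vanish, and integrating in time gives the estimate, because
  the initial datum is an orthogonal projection of \<open>u0\<close>.
\<close>

section \<open>Square-integrable functions on a measure space\<close>

text \<open>\<open>frac_laplacian_pairing\<close> is a definite description over all extensions of
  the singular integral, so the form has to be an admissible extension and also the only possible
  value at the functions in play; \<open>determined\<close> collects the first arguments for which
  this holds. The scheme offers one equation per basis function, while the solution may occupy
  infinitely many cells: it becomes a legitimate test function only as a limit of finite sums. The
  nonlocal term forces that limit to be taken in the Sobolev norm, although the coefficients are
  merely square summable; hence the inverse estimate, whose constant depends on the grid. The factor
  1/2 in the form comes from symmetrising the double integral and cancels against the 2 in the
  derivative of the squared norm, which leaves exactly \<open>frac_const l\<close> in the claim. All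
  norms are L^2 norms, on the line for a function and on the plane for its weighted difference
  quotients, so the Hilbert space facts are stated over an arbitrary measure and serve both.\<close>

definition square_integrable :: "'a measure \<Rightarrow> ('a \<Rightarrow> real) \<Rightarrow> bool" where
  "square_integrable M f \<longleftrightarrow> f \<in> borel_measurable M \<and> integrable M (\<lambda>x. (f x)\<^sup>2)"

text \<open>A Bochner integral, hence 0 when the product is not integrable; additivity therefore
  asks for square integrability, while symmetry and scaling hold outright.\<close>

definition l2_inner :: "'a measure \<Rightarrow> ('a \<Rightarrow> real) \<Rightarrow> ('a \<Rightarrow> real) \<Rightarrow> real" where
  "l2_inner M f g = (LINT x|M. f x * g x)"

definition l2_norm :: "'a measure \<Rightarrow> ('a \<Rightarrow> real) \<Rightarrow> real" where
  "l2_norm M f = sqrt (l2_inner M f f)"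

lemma l2_inner_self_nonneg: "0 \<le> l2_inner M f f"
  unfolding l2_inner_def by (intro integral_nonneg_AE) auto

lemma l2_norm_nonneg [simp]: "0 \<le> l2_norm M f"
  unfolding l2_norm_def by (simp add: l2_inner_self_nonneg)

lemma l2_norm_sq: "(l2_norm M f)\<^sup>2 = l2_inner M f f"
  unfolding l2_norm_def by (simp add: l2_inner_self_nonneg)

lemma square_integrable_mult:
  assumes "square_integrable M f" "square_integrable M g"
  shows "integrable M (\<lambda>x. f x * g x)"
proof (rule Bochner_Integration.integrable_bound)
  show "integrable M (\<lambda>x. (f x)\<^sup>2 + (g x)\<^sup>2)"
    using assms unfolding square_integrable_def by auto
  show "(\<lambda>x. f x * g x) \<in> borel_measurable M"
    using assms unfolding square_integrable_def by auto
  have "norm (f x * g x) \<le> norm ((f x)\<^sup>2 + (g x)\<^sup>2)" for x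
  proof -
    have "2 * (\<bar>f x\<bar> * \<bar>g x\<bar>) \<le> \<bar>f x\<bar>\<^sup>2 + \<bar>g x\<bar>\<^sup>2"
      using sum_squares_bound[of "\<bar>f x\<bar>" "\<bar>g x\<bar>"] by simp
    moreover have "0 \<le> \<bar>f x\<bar> * \<bar>g x\<bar>" by simp
    ultimately have "\<bar>f x\<bar> * \<bar>g x\<bar> \<le> (f x)\<^sup>2 + (g x)\<^sup>2"
      unfolding power2_abs by linarith
    then show ?thesis by (simp add: abs_mult)
  qed
  then show "AE x in M. norm (f x * g x) \<le> norm ((f x)\<^sup>2 + (g x)\<^sup>2)" by simp
qed

lemma square_integrable_add:
  assumes "square_integrable M f" "square_integrable M g"
  shows "square_integrable M (\<lambda>x. f x + g x)"
proof -
  have "integrable M (\<lambda>x. (f x)\<^sup>2 + (g x)\<^sup>2 + 2 * (f x * g x))"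
    using assms square_integrable_mult[OF assms] unfolding square_integrable_def by auto
  moreover have "(\<lambda>x. (f x)\<^sup>2 + (g x)\<^sup>2 + 2 * (f x * g x)) = (\<lambda>x. (f x + g x)\<^sup>2)"
    by (auto simp: power2_sum)
  ultimately show ?thesis using assms unfolding square_integrable_def by auto
qed

lemma square_integrable_scale:
  assumes "square_integrable M f"
  shows "square_integrable M (\<lambda>x. a * f x)"
  using assms unfolding square_integrable_def by (auto simp: power_mult_distrib)

lemma square_integrable_zero [simp]: "square_integrable M (\<lambda>x. 0)"
  unfolding square_integrable_def by simp

lemma square_integrable_diff:
  assumes "square_integrable M f" "square_integrable M g"
  shows "square_integrable M (\<lambda>x. f x - g x)"
  using square_integrable_add[OF assms(1) square_integrable_scale[OF assms(2), of "-1"]] by simp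

lemma square_integrable_sum:
  assumes "\<And>i. i \<in> A \<Longrightarrow> square_integrable M (f i)"
  shows "square_integrable M (\<lambda>x. \<Sum>i\<in>A. f i x)"
  using assms by (induction A rule: infinite_finite_induct) (auto intro: square_integrable_add)

lemma l2_inner_commute: "l2_inner M f g = l2_inner M g f"
  unfolding l2_inner_def by (simp add: mult.commute)

lemma l2_inner_add_left:
  assumes "square_integrable M f" "square_integrable M g" "square_integrable M h"
  shows "l2_inner M (\<lambda>x. f x + g x) h = l2_inner M f h + l2_inner M g h"
  unfolding l2_inner_def
  using square_integrable_mult[OF assms(1,3)] square_integrable_mult[OF assms(2,3)]
  by (simp add: distrib_right)

lemma l2_inner_diff_left:
  assumes "square_integrable M f" "square_integrable M g" "square_integrable M h"
  shows "l2_inner M (\<lambda>x. f x - g x) h = l2_inner M f h - l2_inner M g h"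
  unfolding l2_inner_def
  using square_integrable_mult[OF assms(1,3)] square_integrable_mult[OF assms(2,3)]
  by (simp add: left_diff_distrib)

lemma l2_inner_scale_left: "l2_inner M (\<lambda>x. a * f x) h = a * l2_inner M f h"
  unfolding l2_inner_def by (simp add: mult.assoc)

lemma l2_inner_add_right:
  assumes "square_integrable M f" "square_integrable M g" "square_integrable M h"
  shows "l2_inner M h (\<lambda>x. f x + g x) = l2_inner M h f + l2_inner M h g"
  using l2_inner_add_left[OF assms] by (simp add: l2_inner_commute)

lemma l2_inner_diff_right:
  assumes "square_integrable M f" "square_integrable M g" "square_integrable M h"
  shows "l2_inner M h (\<lambda>x. f x - g x) = l2_inner M h f - l2_inner M h g"
  using l2_inner_diff_left[OF assms] by (simp add: l2_inner_commute)

lemma l2_inner_scale_right: "l2_inner M h (\<lambda>x. a * f x) = a * l2_inner M h f"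
  using l2_inner_scale_left[of M a f h] by (simp add: l2_inner_commute)

lemma l2_inner_sum_right:
  assumes "\<And>i. i \<in> A \<Longrightarrow> square_integrable M (f i)" "square_integrable M h"
  shows "l2_inner M h (\<lambda>x. \<Sum>i\<in>A. f i x) = (\<Sum>i\<in>A. l2_inner M h (f i))"
  unfolding l2_inner_def sum_distrib_left
  by (rule Bochner_Integration.integral_sum) (use assms square_integrable_mult in blast)

text \<open>The quadratic form (s, t) -> |s f + t g|^2 is nonnegative. Its value at (c, -b) gives
  the discriminant inequality, and a vanishing \<open>c\<close> forces \<open>b\<close> to vanish
  because the form would otherwise be affine and unbounded below in \<open>t\<close>.\<close>

lemma l2_Cauchy_Schwarz:
  assumes "square_integrable M f" "square_integrable M g"
  shows "\<bar>l2_inner M f g\<bar> \<le> l2_norm M f * l2_norm M g"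
proof -
  define a where "a = l2_inner M f f"
  define b where "b = l2_inner M f g"
  define c where "c = l2_inner M g g"
  have q: "0 \<le> a * s\<^sup>2 + 2 * b * s * t + c * t\<^sup>2" for s t
  proof -
    have sf: "square_integrable M (\<lambda>x. s * f x)" and sg: "square_integrable M (\<lambda>x. t * g x)"
      using assms square_integrable_scale by blast+
    have "0 \<le> l2_inner M (\<lambda>x. s * f x + t * g x) (\<lambda>x. s * f x + t * g x)"
      by (rule l2_inner_self_nonneg)
    also have "\<dots> = a * s\<^sup>2 + 2 * b * s * t + c * t\<^sup>2"
      by (subst l2_inner_add_left[OF sf sg square_integrable_add[OF sf sg]],
          subst (1 2) l2_inner_add_right[OF sf sg])
         (auto simp: sf sg l2_inner_scale_left l2_inner_scale_right a_def b_def c_def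
           power2_eq_square algebra_simps l2_inner_commute[of M g f])
    finally show ?thesis .
  qed
  have a0: "0 \<le> a" and c0: "0 \<le> c" unfolding a_def c_def by (rule l2_inner_self_nonneg)+
  have "b\<^sup>2 \<le> a * c"
  proof (cases "c = 0")
    case True
    have "b = 0"
    proof (rule ccontr)
      assume "b \<noteq> 0"
      \<comment> \<open>With \<open>c = 0\<close> this choice makes the form equal to -1.\<close>
      then show False using q[of 1 "- (a + 1) / (2 * b)"] True a0 by (simp add: field_simps)
    qed
    then show ?thesis using True by simp
  next
    case False
    have "0 \<le> a * c\<^sup>2 + 2 * b * c * (-b) + c * b\<^sup>2" using q[of c "-b"] by simp
    also have "\<dots> = c * (a * c - b\<^sup>2)" by (simp add: power2_eq_square algebra_simps)
    finally show ?thesis using False c0 by (simp add: zero_le_mult_iff)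
  qed
  then have "\<bar>b\<bar> \<le> sqrt (a * c)" by (simp add: real_le_rsqrt)
  then show ?thesis unfolding l2_norm_def a_def b_def c_def by (simp add: real_sqrt_mult)
qed

lemma l2_norm_scale: "l2_norm M (\<lambda>x. a * f x) = \<bar>a\<bar> * l2_norm M f"
  unfolding l2_norm_def by (simp add: l2_inner_scale_left l2_inner_scale_right real_sqrt_mult
      flip: mult.assoc power2_eq_square)

lemma l2_norm_triangle:
  assumes "square_integrable M f" "square_integrable M g"
  shows "l2_norm M (\<lambda>x. f x + g x) \<le> l2_norm M f + l2_norm M g"
proof (rule power2_le_imp_le)
  have "(l2_norm M (\<lambda>x. f x + g x))\<^sup>2 = (l2_norm M f)\<^sup>2 + 2 * l2_inner M f g + (l2_norm M g)\<^sup>2"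
    unfolding l2_norm_sq
    by (subst l2_inner_add_left[OF assms square_integrable_add[OF assms]],
        subst (1 2) l2_inner_add_right[OF assms])
       (use assms in \<open>auto simp: l2_inner_commute[of M g f]\<close>)
  also have "\<dots> \<le> (l2_norm M f + l2_norm M g)\<^sup>2"
    using l2_Cauchy_Schwarz[OF assms] by (simp add: power2_sum)
  finally show "(l2_norm M (\<lambda>x. f x + g x))\<^sup>2 \<le> (l2_norm M f + l2_norm M g)\<^sup>2" .
qed simp

text \<open>Stated for an arbitrary filter, since it is applied both to truncations indexed by
  \<open>n\<close> and to times approaching \<open>t\<close> within an interval. The norm of
  \<open>g s\<close> is bounded by its distance to the limit plus the norm of the limit.\<close>

lemma l2_inner_tendsto:
  assumes ev: "\<forall>\<^sub>F s in Fl. square_integrable M (f s) \<and> square_integrable M (g s)"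
    and "square_integrable M f0" "square_integrable M g0"
    and f: "((\<lambda>s. l2_norm M (\<lambda>x. f s x - f0 x)) \<longlongrightarrow> 0) Fl"
    and g: "((\<lambda>s. l2_norm M (\<lambda>x. g s x - g0 x)) \<longlongrightarrow> 0) Fl"
  shows "((\<lambda>s. l2_inner M (f s) (g s)) \<longlongrightarrow> l2_inner M f0 g0) Fl"
proof -
  have "((\<lambda>s. l2_inner M (f s) (g s) - l2_inner M f0 g0) \<longlongrightarrow> 0) Fl"
  proof (rule Lim_null_comparison)
    show "((\<lambda>s. l2_norm M (\<lambda>x. f s x - f0 x) * (l2_norm M (\<lambda>x. g s x - g0 x) + l2_norm M g0)
        + l2_norm M f0 * l2_norm M (\<lambda>x. g s x - g0 x)) \<longlongrightarrow> 0) Fl"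
      by (rule tendsto_eq_intros f g refl | simp)+
    show "\<forall>\<^sub>F s in Fl. norm (l2_inner M (f s) (g s) - l2_inner M f0 g0)
      \<le> l2_norm M (\<lambda>x. f s x - f0 x) * (l2_norm M (\<lambda>x. g s x - g0 x) + l2_norm M g0)
        + l2_norm M f0 * l2_norm M (\<lambda>x. g s x - g0 x)"
      using ev
    proof eventually_elim
      case (elim s)
      have df: "square_integrable M (\<lambda>x. f s x - f0 x)"
        and dg: "square_integrable M (\<lambda>x. g s x - g0 x)"
        using elim assms(2,3) square_integrable_diff by blast+
      have 1: "l2_inner M (f s) (g s) - l2_inner M f0 g0
        = l2_inner M (\<lambda>x. f s x - f0 x) (g s) + l2_inner M f0 (\<lambda>x. g s x - g0 x)"
        using elim assms(2,3) by (simp add: l2_inner_diff_left l2_inner_diff_right)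
      have 2: "l2_norm M (g s) \<le> l2_norm M (\<lambda>x. g s x - g0 x) + l2_norm M g0"
        using l2_norm_triangle[OF dg assms(3)] by simp
      show ?case unfolding 1
        using l2_Cauchy_Schwarz[OF df, of "g s"] l2_Cauchy_Schwarz[OF assms(2) dg] elim
          mult_left_mono[OF 2, of "l2_norm M (\<lambda>x. f s x - f0 x)"]
        by simp
    qed
  qed
  then show ?thesis using Lim_null by blast
qed

lemma square_integrableI_nn:
  assumes "f \<in> borel_measurable M" "(\<integral>\<^sup>+x. ennreal ((f x)\<^sup>2) \<partial>M) < \<infinity>"
  shows "square_integrable M f"
  unfolding square_integrable_def using assms by (auto intro!: integrableI_nonneg)

lemma nn_integral_square:
  assumes "square_integrable M f"
  shows "(\<integral>\<^sup>+x. ennreal ((f x)\<^sup>2) \<partial>M) = ennreal ((l2_norm M f)\<^sup>2)"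
  using assms unfolding square_integrable_def l2_norm_sq l2_inner_def
  by (subst nn_integral_eq_integral) (auto simp: power2_eq_square)

text \<open>Turns an estimate of an extended nonnegative integral into membership and a real bound
  at once. \<open>ennreal\<close> collapses negative reals to 0, hence \<open>0 \<le> c\<close> for
  reading the bound back.\<close>

lemma l2_norm_sq_le:
  assumes "f \<in> borel_measurable M" "(\<integral>\<^sup>+x. ennreal ((f x)\<^sup>2) \<partial>M) \<le> ennreal c" "0 \<le> c"
  shows "square_integrable M f" "(l2_norm M f)\<^sup>2 \<le> c"
proof -
  show "square_integrable M f"
    by (rule square_integrableI_nn)
      (use assms(1) le_less_trans[OF assms(2) ennreal_less_top] in simp_all)
  from nn_integral_square[OF this] assms show "(l2_norm M f)\<^sup>2 \<le> c"
    by simp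
qed

section \<open>The Gagliardo form\<close>

text \<open>The divisor is the square root of the kernel, so that \<open>u\<close> is mapped
  linearly to a function on the plane whose L^2 norm is the seminorm. On the diagonal the quotient
  is 0 / 0, that is 0.\<close>

definition diff_quotient :: "real \<Rightarrow> (real \<Rightarrow> real) \<Rightarrow> real \<times> real \<Rightarrow> real" where
  "diff_quotient l u = (\<lambda>(x, z). (u z - u x) / \<bar>z - x\<bar> powr ((1 + l) / 2))"

lemma powr_half_sq: "(x powr (a / 2))\<^sup>2 = x powr (a :: real)"
  by (simp add: power2_eq_square flip: powr_add)

lemma diff_quotient_mult:
  "diff_quotient l u (x, z) * diff_quotient l v (x, z) =
    (u z - u x) * (v z - v x) / \<bar>z - x\<bar> powr (1 + l)"
  unfolding diff_quotient_def by (simp add: powr_half_sq[unfolded power2_eq_square])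

lemma diff_quotient_sq: "(diff_quotient l u p)\<^sup>2 = gagliardo_integrand l u p"
  by (cases p) (simp add: power2_eq_square diff_quotient_mult gagliardo_integrand_def)

lemma borel_measurable_diff_quotient [measurable]:
  assumes [measurable]: "u \<in> borel_measurable borel"
  shows "diff_quotient l u \<in> borel_measurable (lborel \<Otimes>\<^sub>M lborel)"
  unfolding diff_quotient_def by measurable

lemma borel_measurable_gagliardo_integrand [measurable]:
  assumes [measurable]: "u \<in> borel_measurable borel"
  shows "gagliardo_integrand l u \<in> borel_measurable (lborel \<Otimes>\<^sub>M lborel)"
  unfolding gagliardo_integrand_def by measurable

lemma diff_quotient_add:
  "diff_quotient l (\<lambda>x. u x + v x) = (\<lambda>p. diff_quotient l u p + diff_quotient l v p)"
  unfolding diff_quotient_def by (auto simp: fun_eq_iff diff_divide_distrib add_divide_distrib)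

lemma diff_quotient_diff:
  "diff_quotient l (\<lambda>x. u x - v x) = (\<lambda>p. diff_quotient l u p - diff_quotient l v p)"
  unfolding diff_quotient_def by (auto simp: fun_eq_iff diff_divide_distrib)

lemma diff_quotient_scale: "diff_quotient l (\<lambda>x. a * u x) = (\<lambda>p. a * diff_quotient l u p)"
  unfolding diff_quotient_def by (auto simp: fun_eq_iff algebra_simps)

lemma diff_quotient_sum:
  "diff_quotient l (\<lambda>x. \<Sum>i\<in>A. u i x) = (\<lambda>p. \<Sum>i\<in>A. diff_quotient l (u i) p)"
  unfolding diff_quotient_def by (auto simp: fun_eq_iff sum_subtractf simp flip: sum_divide_distrib)

lemma L2_space_iff: "u \<in> L2_space \<longleftrightarrow> square_integrable lborel u"
  unfolding L2_space_def square_integrable_def by simp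

lemma L2_norm_eq: "L2_norm u = l2_norm lborel u"
  unfolding L2_norm_def l2_norm_def l2_inner_def by (simp add: power2_eq_square)

lemma sobolev_space_iff:
  "u \<in> sobolev_space l \<longleftrightarrow>
    square_integrable lborel u \<and> square_integrable (lborel \<Otimes>\<^sub>M lborel) (diff_quotient l u)"
  unfolding sobolev_space_def L2_space_iff
  by (auto simp: square_integrable_def diff_quotient_sq)

lemma sobolev_seminorm_eq:
  "sobolev_seminorm l u = l2_norm (lborel \<Otimes>\<^sub>M lborel) (diff_quotient l u)"
  unfolding sobolev_seminorm_def l2_norm_def l2_inner_def
  by (simp add: diff_quotient_sq flip: power2_eq_square)

lemma sobolev_seminorm_nonneg [simp]: "0 \<le> sobolev_seminorm l u"
  unfolding sobolev_seminorm_eq by simp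

lemma sobolev_norm_nonneg [simp]: "0 \<le> sobolev_norm l u"
  unfolding sobolev_norm_def by simp

lemma l2_norm_le_sobolev_norm: "l2_norm lborel u \<le> sobolev_norm l u"
  unfolding sobolev_norm_def L2_norm_eq by (rule real_le_rsqrt) simp

lemma sobolev_seminorm_le_sobolev_norm: "sobolev_seminorm l u \<le> sobolev_norm l u"
  unfolding sobolev_norm_def by (rule real_le_rsqrt) simp

lemma sobolev_space_add:
  "u \<in> sobolev_space l \<Longrightarrow> v \<in> sobolev_space l \<Longrightarrow> (\<lambda>x. u x + v x) \<in> sobolev_space l"
  unfolding sobolev_space_iff by (auto simp: diff_quotient_add intro: square_integrable_add)

lemma sobolev_space_diff:
  "u \<in> sobolev_space l \<Longrightarrow> v \<in> sobolev_space l \<Longrightarrow> (\<lambda>x. u x - v x) \<in> sobolev_space l"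
  unfolding sobolev_space_iff by (auto simp: diff_quotient_diff intro: square_integrable_diff)

lemma sobolev_space_scale:
  "u \<in> sobolev_space l \<Longrightarrow> (\<lambda>x. a * u x) \<in> sobolev_space l"
  unfolding sobolev_space_iff by (auto simp: diff_quotient_scale intro: square_integrable_scale)

lemma sobolev_space_zero: "(\<lambda>x. 0) \<in> sobolev_space l"
proof -
  have "diff_quotient l (\<lambda>x. 0) = (\<lambda>p. 0)" by (auto simp: diff_quotient_def)
  then show ?thesis unfolding sobolev_space_iff by simp
qed

lemma sobolev_space_sum:
  "(\<And>i. i \<in> A \<Longrightarrow> u i \<in> sobolev_space l) \<Longrightarrow> (\<lambda>x. \<Sum>i\<in>A. u i x) \<in> sobolev_space l"
  by (induction A rule: infinite_finite_induct)
     (auto intro: sobolev_space_add simp: sobolev_space_zero)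

text \<open>The weak form of the operator: exchanging the two points of the double integral and
  averaging yields the minus sign and the factor 1/2. It is manifestly symmetric, which the pairing
  through \<open>singular_integral\<close> is not.\<close>

definition gagliardo_form :: "real \<Rightarrow> (real \<Rightarrow> real) \<Rightarrow> (real \<Rightarrow> real) \<Rightarrow> real" where
  "gagliardo_form l u v =
     - (frac_const l / 2) * l2_inner (lborel \<Otimes>\<^sub>M lborel) (diff_quotient l u) (diff_quotient l v)"

lemma gagliardo_form_self: "gagliardo_form l u u = - (frac_const l / 2) * (sobolev_seminorm l u)\<^sup>2"
  unfolding gagliardo_form_def sobolev_seminorm_eq l2_norm_sq ..

lemma gagliardo_form_commute: "gagliardo_form l u v = gagliardo_form l v u"
  unfolding gagliardo_form_def by (simp add: l2_inner_commute)

lemma gagliardo_form_scale_right: "gagliardo_form l u (\<lambda>x. a * v x) = a * gagliardo_form l u v"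
  unfolding gagliardo_form_def by (simp add: diff_quotient_scale l2_inner_scale_right)

lemma gagliardo_form_add_right:
  assumes "u \<in> sobolev_space l" "v \<in> sobolev_space l" "w \<in> sobolev_space l"
  shows "gagliardo_form l w (\<lambda>x. u x + v x) = gagliardo_form l w u + gagliardo_form l w v"
  using assms unfolding gagliardo_form_def sobolev_space_iff
  by (simp add: diff_quotient_add l2_inner_add_right algebra_simps)

lemma gagliardo_form_lincomb_right:
  assumes "u \<in> sobolev_space l" "v \<in> sobolev_space l" "w \<in> sobolev_space l"
  shows "gagliardo_form l w (\<lambda>x. a * u x + b * v x)
    = a * gagliardo_form l w u + b * gagliardo_form l w v"
  by (simp add: gagliardo_form_add_right gagliardo_form_scale_right sobolev_space_scale assms)

lemma gagliardo_form_sum_right: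
  assumes "\<And>i. i \<in> A \<Longrightarrow> u i \<in> sobolev_space l" "w \<in> sobolev_space l"
  shows "gagliardo_form l w (\<lambda>x. \<Sum>i\<in>A. u i x) = (\<Sum>i\<in>A. gagliardo_form l w (u i))"
  using assms unfolding gagliardo_form_def sobolev_space_iff
  by (simp add: diff_quotient_sum l2_inner_sum_right sum_distrib_left)

lemma gagliardo_form_bound:
  assumes "u \<in> sobolev_space l" "v \<in> sobolev_space l"
  shows "\<bar>gagliardo_form l u v\<bar> \<le> \<bar>frac_const l / 2\<bar> * sobolev_norm l u * sobolev_norm l v"
proof -
  have "\<bar>l2_inner (lborel \<Otimes>\<^sub>M lborel) (diff_quotient l u) (diff_quotient l v)\<bar>
      \<le> sobolev_seminorm l u * sobolev_seminorm l v"
    using l2_Cauchy_Schwarz assms unfolding sobolev_space_iff sobolev_seminorm_eq by blast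
  also have "\<dots> \<le> sobolev_norm l u * sobolev_norm l v"
    by (intro mult_mono sobolev_seminorm_le_sobolev_norm) auto
  finally show ?thesis
    unfolding gagliardo_form_def abs_mult abs_minus_cancel mult.assoc
    by (rule mult_left_mono) simp
qed

section \<open>Shear of the plane and bounds for the Gagliardo integral\<close>

lemma shear_measure_preserving:
  "distr (lborel \<Otimes>\<^sub>M lborel) (lborel \<Otimes>\<^sub>M lborel) (\<lambda>(x, z). (x, x + z :: real))
    = lborel \<Otimes>\<^sub>M lborel"
proof (rule measure_eqI)
  fix A assume "A \<in> sets (distr (lborel \<Otimes>\<^sub>M lborel) (lborel \<Otimes>\<^sub>M lborel)
    (\<lambda>(x, z). (x, x + z :: real)))"
  then have A [measurable]: "A \<in> sets (lborel \<Otimes>\<^sub>M lborel)" by simp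
  have "emeasure (distr (lborel \<Otimes>\<^sub>M lborel) (lborel \<Otimes>\<^sub>M lborel) (\<lambda>(x, z). (x, x + z))) A
      = (\<integral>\<^sup>+p. indicator A p \<partial>distr (lborel \<Otimes>\<^sub>M lborel) (lborel \<Otimes>\<^sub>M lborel) (\<lambda>(x, z). (x, x + z)))"
    by (subst nn_integral_indicator) (use A in simp_all)
  also have "\<dots> = (\<integral>\<^sup>+p. indicator A (fst p, fst p + snd p) \<partial>(lborel \<Otimes>\<^sub>M lborel))"
    by (subst nn_integral_distr) (auto simp: case_prod_beta)
  also have "\<dots> = (\<integral>\<^sup>+x. \<integral>\<^sup>+z. indicator A (x, x + z) \<partial>lborel \<partial>lborel)"
    by (subst lborel.nn_integral_fst[symmetric]) auto
  \<comment> \<open>For fixed \<open>x\<close> the shear is a translation of the second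
    coordinate.\<close>
  also have "\<dots> = (\<integral>\<^sup>+x. \<integral>\<^sup>+z. indicator A (x, z) \<partial>lborel \<partial>lborel)"
  proof (rule nn_integral_cong)
    fix x :: real
    show "(\<integral>\<^sup>+z. indicator A (x, x + z) \<partial>lborel) = (\<integral>\<^sup>+z. indicator A (x, z) \<partial>lborel)"
      using nn_integral_real_affine[of "\<lambda>z. indicator A (x, z)" 1 x] by simp
  qed
  also have "\<dots> = (\<integral>\<^sup>+p. indicator A p \<partial>(lborel \<Otimes>\<^sub>M lborel))"
    by (subst lborel.nn_integral_fst) auto
  finally show "emeasure (distr (lborel \<Otimes>\<^sub>M lborel) (lborel \<Otimes>\<^sub>M lborel) (\<lambda>(x, z). (x, x + z))) A
      = emeasure (lborel \<Otimes>\<^sub>M lborel) A"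
    using nn_integral_indicator[OF A] by metis
qed simp

text \<open>With the increment \<open>z\<close> as outer variable the kernel is constant in the
  inner integral, so everything reduces to the L^2 size of a translation difference.\<close>

lemma nn_integral_shear:
  assumes [measurable]: "f \<in> borel_measurable (lborel \<Otimes>\<^sub>M lborel)"
  shows "(\<integral>\<^sup>+p. f p \<partial>(lborel \<Otimes>\<^sub>M lborel)) = (\<integral>\<^sup>+z. \<integral>\<^sup>+x. f (x, x + z :: real) \<partial>lborel \<partial>lborel)"
proof -
  have "(\<integral>\<^sup>+p. f p \<partial>(lborel \<Otimes>\<^sub>M lborel))
      = (\<integral>\<^sup>+p. f p \<partial>distr (lborel \<Otimes>\<^sub>M lborel) (lborel \<Otimes>\<^sub>M lborel) (\<lambda>(x, z). (x, x + z)))"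
    by (simp add: shear_measure_preserving)
  also have "\<dots> = (\<integral>\<^sup>+p. f (fst p, fst p + snd p) \<partial>(lborel \<Otimes>\<^sub>M lborel))"
    by (subst nn_integral_distr) (auto simp: case_prod_beta)
  also have "\<dots> = (\<integral>\<^sup>+z. \<integral>\<^sup>+x. f (x, x + z) \<partial>lborel \<partial>lborel)"
    by (subst lborel_pair.nn_integral_snd[symmetric]) auto
  finally show ?thesis .
qed

text \<open>Split at |z| = h: near the origin the integrand is |z|^(-l), integrable because l < 1,
  and far away it is h |z|^(-1-l), integrable because 0 < l. The constant is 2 (1/(1-l) + 1/l) = 2 /
  (l (1-l)).\<close>

lemma nn_integral_min_kernel:
  assumes l: "0 < l" "l < 1" and h: "0 < h"
  shows "(\<integral>\<^sup>+z. ennreal (min \<bar>z\<bar> h / \<bar>z\<bar> powr (1 + l)) \<partial>lborel)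
    \<le> ennreal (2 * h powr (1 - l) / (l * (1 - l)))"
proof -
  \<comment> \<open>\<open>g1\<close> and \<open>g2\<close> live on the nonnegative half-line; the
    other half is covered by reflection.\<close>
  define g1 where "g1 = (\<lambda>z::real. if z \<in> {0..h} then z powr (-l) else 0)"
  define g2 where "g2 = (\<lambda>z::real. h * (if z \<in> {h..} then z powr (-1-l) else 0))"
  have [measurable]: "g1 \<in> borel_measurable borel" "g2 \<in> borel_measurable borel"
    unfolding g1_def g2_def by measurable
  have nonneg: "0 \<le> g1 z" "0 \<le> g2 z" for z using h unfolding g1_def g2_def by auto
  have "((\<lambda>z. z powr (-l)) has_integral h powr (-l + 1) / (-l + 1)) {0..h}"
    by (rule has_integral_powr_from_0) (use l h in auto)
  then have "(g1 has_integral h powr (1 - l) / (1 - l)) UNIV"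
    unfolding g1_def by (subst has_integral_restrict_UNIV) simp
  then have n1: "(\<integral>\<^sup>+z. ennreal (g1 z) \<partial>lborel) = ennreal (h powr (1 - l) / (1 - l))"
    by (intro nn_integral_has_integral_lborel) (auto simp: nonneg)
  have "((\<lambda>z. z powr (-1-l)) has_integral - (h powr (-1-l + 1)) / (-1-l + 1)) {h..}"
    by (rule has_integral_powr_to_inf) (use l h in auto)
  then have "((\<lambda>z. z powr (-1-l)) has_integral h powr (-l) / l) {h..}" by simp
  then have "((\<lambda>z. if z \<in> {h..} then z powr (-1-l) else 0) has_integral h powr (-l) / l) UNIV"
    by (subst has_integral_restrict_UNIV)
  then have "(g2 has_integral h * (h powr (-l) / l)) UNIV"
    unfolding g2_def by (rule has_integral_mult_right)
  then have n2: "(\<integral>\<^sup>+z. ennreal (g2 z) \<partial>lborel) = ennreal (h * (h powr (-l) / l))"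
    by (intro nn_integral_has_integral_lborel) (auto simp: nonneg)
  have m1: "(\<integral>\<^sup>+z. ennreal (g1 (-z)) \<partial>lborel) = (\<integral>\<^sup>+z. ennreal (g1 z) \<partial>lborel)"
    using nn_integral_real_affine[of "\<lambda>z. ennreal (g1 z)" "-1" 0] by simp
  have m2: "(\<integral>\<^sup>+z. ennreal (g2 (-z)) \<partial>lborel) = (\<integral>\<^sup>+z. ennreal (g2 z) \<partial>lborel)"
    using nn_integral_real_affine[of "\<lambda>z. ennreal (g2 z)" "-1" 0] by simp
  have "min \<bar>z\<bar> h / \<bar>z\<bar> powr (1 + l) \<le> g1 z + g2 z + (g1 (-z) + g2 (-z))" for z
  proof -
    have pos: "min y h / y powr (1 + l) \<le> g1 y + g2 y" if "0 < y" for y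
    proof (cases "y \<le> h")
      case True
      have "min y h / y powr (1 + l) = y powr (-l)"
        using True that by (simp add: powr_add powr_minus field_simps)
      then show ?thesis using True that nonneg(2)[of y] by (simp add: g1_def)
    next
      case False
      have "min y h / y powr (1 + l) = h * y powr (-1-l)"
        using False that by (simp add: powr_add powr_minus powr_diff field_simps)
      then show ?thesis using False that nonneg(1)[of y] by (simp add: g2_def)
    qed
    consider "z = 0" | "z > 0" | "z < 0" by linarith
    then show ?thesis
    proof cases
      case 1 then show ?thesis using nonneg[of z] nonneg[of "-z"] by simp
    next
      case 2 then show ?thesis using pos[of z] nonneg[of "-z"] by simp
    next
      case 3 then show ?thesis using pos[of "-z"] nonneg[of z] by simp
    qed
  qed
  then have "(\<integral>\<^sup>+z. ennreal (min \<bar>z\<bar> h / \<bar>z\<bar> powr (1 + l)) \<partial>lborel)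
      \<le> (\<integral>\<^sup>+z. (ennreal (g1 z) + ennreal (g2 z)) + (ennreal (g1 (-z)) + ennreal (g2 (-z))) \<partial>lborel)"
    by (intro nn_integral_mono) (simp add: nonneg flip: ennreal_plus)
  also have "\<dots> = ennreal (2 * h powr (1 - l) / (l * (1 - l)))"
  proof -
    have "2 * (h powr (1 - l) / (1 - l) + h * (h powr (-l) / l))
        = 2 * h powr (1 - l) / (l * (1 - l))"
      using l h by (simp add: powr_diff powr_minus field_simps)
    then show ?thesis
      using l h by (simp add: nn_integral_add n1 n2 m1 m2 flip: ennreal_plus)
  qed
  finally show ?thesis .
qed

text \<open>If \<open>x\<close> and \<open>x + z\<close> both lie in the interval, the Lipschitz
  bound applies, and |z| < b - a. If exactly one does, the difference is at most \<open>M\<close>,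
  and this happens only inside two intervals of length min |z| (b - a).\<close>

lemma nn_integral_translation_diff_le:
  assumes ab: "a < b" and supp: "\<And>x. x \<notin> {a<..<b} \<Longrightarrow> w x = 0"
    and M: "\<And>x. \<bar>w x\<bar> \<le> M"
    and L: "\<And>x z. x \<in> {a<..<b} \<Longrightarrow> z \<in> {a<..<b} \<Longrightarrow> \<bar>w z - w x\<bar> \<le> L * \<bar>z - x\<bar>"
  shows "(\<integral>\<^sup>+x. ennreal ((w (x + z) - w x)\<^sup>2) \<partial>lborel)
    \<le> ennreal ((L\<^sup>2 * (b - a)\<^sup>2 + 2 * M\<^sup>2) * min \<bar>z\<bar> (b - a :: real))"
proof -
  define m where "m = min \<bar>z\<bar> (b - a)"
  define c where "c = (if \<bar>z\<bar> < b - a then L\<^sup>2 * z\<^sup>2 else 0)"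
  \<comment> \<open>\<open>{p..p+m}\<close> contains the points of the interval that leave it under
    translation by \<open>z\<close>, \<open>{q..q+m}\<close> the points outside that enter it; the
    sign of \<open>z\<close> decides at which end.\<close>
  define p where "p = (if z \<ge> 0 then b - m else a)"
  define q where "q = (if z \<ge> 0 then a - z else b - z - m)"
  have m0: "0 \<le> m" and c0: "0 \<le> c" unfolding m_def c_def using ab by auto
  have "(w (x + z) - w x)\<^sup>2
      \<le> c * indicator {a..b} x + M\<^sup>2 * indicator {p..p+m} x + M\<^sup>2 * indicator {q..q+m} x" for x
  proof -
    have one: "(w y)\<^sup>2 \<le> M\<^sup>2" for y
      using power_mono[OF M[of y], of 2] by simp
    have nn: "0 \<le> c * indicator {a..b} x" "0 \<le> M\<^sup>2 * indicator {p..p+m} x"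
        "0 \<le> M\<^sup>2 * indicator {q..q+m} x"
      by (rule mult_nonneg_nonneg; simp add: c0)+
    consider "x \<in> {a<..<b}" "x + z \<in> {a<..<b}" | "x \<in> {a<..<b}" "x + z \<notin> {a<..<b}"
      | "x \<notin> {a<..<b}" "x + z \<in> {a<..<b}" | "x \<notin> {a<..<b}" "x + z \<notin> {a<..<b}" by blast
    then show ?thesis
    proof cases
      case 1
      have "\<bar>w (x + z) - w x\<bar>\<^sup>2 \<le> (L * \<bar>z\<bar>)\<^sup>2"
        using L[OF 1] by (intro power_mono) simp_all
      moreover have "\<bar>z\<bar> < b - a" using 1 by auto
      ultimately have "(w (x + z) - w x)\<^sup>2 \<le> c"
        unfolding c_def by (simp add: power_mult_distrib)
      moreover have "c * indicator {a..b} x = c" using 1 by simp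
      ultimately show ?thesis using nn by linarith
    next
      case 2
      have "x \<in> {p..p+m}" using 2 ab unfolding p_def m_def by auto
      then have "M\<^sup>2 * indicator {p..p+m} x = M\<^sup>2" by simp
      moreover have "(w (x + z) - w x)\<^sup>2 \<le> M\<^sup>2" using supp[OF 2(2)] one[of x] by simp
      ultimately show ?thesis using nn by linarith
    next
      case 3
      have "x \<in> {q..q+m}" using 3 ab unfolding q_def m_def by auto
      then have "M\<^sup>2 * indicator {q..q+m} x = M\<^sup>2" by simp
      moreover have "(w (x + z) - w x)\<^sup>2 \<le> M\<^sup>2" using supp[OF 3(1)] one[of "x+z"] by simp
      ultimately show ?thesis using nn by linarith
    next
      case 4
      then show ?thesis using supp c0 by simp
    qed
  qed
  then have "(\<integral>\<^sup>+x. ennreal ((w (x + z) - w x)\<^sup>2) \<partial>lborel)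
     \<le> (\<integral>\<^sup>+x. ennreal c * indicator {a..b} x + ennreal (M\<^sup>2) * indicator {p..p+m} x
         + ennreal (M\<^sup>2) * indicator {q..q+m} x \<partial>lborel)"
    by (intro nn_integral_mono)
       (auto simp: c0 ennreal_mult ennreal_indicator[symmetric] simp del: ennreal_indicator
         simp flip: ennreal_plus ennreal_mult intro!: ennreal_leI)
  also have "\<dots> = ennreal c * (b - a) + ennreal (M\<^sup>2) * m + ennreal (M\<^sup>2) * m"
    using ab m0 by (simp add: nn_integral_add nn_integral_cmult_indicator)
  also have "\<dots> = ennreal (c * (b - a) + M\<^sup>2 * m + M\<^sup>2 * m)"
    using ab m0 c0 by (simp flip: ennreal_mult ennreal_plus)
  also have "\<dots> \<le> ennreal ((L\<^sup>2 * (b - a)\<^sup>2 + 2 * M\<^sup>2) * m)"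
  proof (rule ennreal_leI)
    have "c * (b - a) \<le> L\<^sup>2 * (b - a)\<^sup>2 * m"
    proof (cases "\<bar>z\<bar> < b - a")
      case True
      have "z\<^sup>2 * (b - a) \<le> (b - a)\<^sup>2 * \<bar>z\<bar>"
      proof -
        have "\<bar>z\<bar> * (\<bar>z\<bar> * (b - a)) \<le> (b - a) * (\<bar>z\<bar> * (b - a))"
          using True ab by (intro mult_right_mono) auto
        moreover have "z\<^sup>2 = \<bar>z\<bar> * \<bar>z\<bar>" by (simp add: power2_eq_square)
        ultimately show ?thesis by (simp add: power2_eq_square mult_ac)
      qed
      then have "L\<^sup>2 * (z\<^sup>2 * (b - a)) \<le> L\<^sup>2 * ((b - a)\<^sup>2 * \<bar>z\<bar>)" by (rule mult_left_mono) simp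
      then show ?thesis using True by (simp add: c_def m_def algebra_simps)
    next
      case False
      then show ?thesis using m0 by (simp add: c_def)
    qed
    then show "c * (b - a) + M\<^sup>2 * m + M\<^sup>2 * m \<le> (L\<^sup>2 * (b - a)\<^sup>2 + 2 * M\<^sup>2) * m"
      by (simp add: algebra_simps)
  qed
  finally show ?thesis unfolding m_def .
qed

lemma nn_integral_gagliardo_shear:
  assumes [measurable]: "w \<in> borel_measurable borel"
  shows "(\<integral>\<^sup>+p. ennreal (gagliardo_integrand l w p) \<partial>(lborel \<Otimes>\<^sub>M lborel))
    = (\<integral>\<^sup>+z. ennreal (1 / \<bar>z\<bar> powr (1 + l)) * (\<integral>\<^sup>+x. ennreal ((w (x + z) - w x)\<^sup>2) \<partial>lborel) \<partial>lborel)"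
proof -
  have "(\<integral>\<^sup>+p. ennreal (gagliardo_integrand l w p) \<partial>(lborel \<Otimes>\<^sub>M lborel))
      = (\<integral>\<^sup>+z. \<integral>\<^sup>+x. ennreal (gagliardo_integrand l w (x, x + z)) \<partial>lborel \<partial>lborel)"
    by (rule nn_integral_shear) measurable
  also have "\<dots> = (\<integral>\<^sup>+z. ennreal (1 / \<bar>z\<bar> powr (1 + l)) *
      (\<integral>\<^sup>+x. ennreal ((w (x + z) - w x)\<^sup>2) \<partial>lborel) \<partial>lborel)"
    by (rule nn_integral_cong)
       (simp add: gagliardo_integrand_def nn_integral_cmult[symmetric] flip: ennreal_mult)
  finally show ?thesis .
qed

text \<open>The factor \<open>(b - a) powr (1 - l)\<close> is what makes functions with jumps admissible when
  \<open>l < 1\<close>: the contribution of a shrinking interval vanishes even if the slope blows up like the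
  reciprocal of its length.\<close>

lemma nn_integral_gagliardo_le:
  assumes l: "0 < l" "l < 1" and ab: "a < b" and [measurable]: "w \<in> borel_measurable borel"
    and "\<And>x. x \<notin> {a<..<b} \<Longrightarrow> w x = 0" "\<And>x. \<bar>w x\<bar> \<le> M"
    and "\<And>x z. x \<in> {a<..<b} \<Longrightarrow> z \<in> {a<..<b} \<Longrightarrow> \<bar>w z - w x\<bar> \<le> L * \<bar>z - x\<bar>"
  shows "(\<integral>\<^sup>+p. ennreal (gagliardo_integrand l w p) \<partial>(lborel \<Otimes>\<^sub>M lborel))
    \<le> ennreal ((L\<^sup>2 * (b - a)\<^sup>2 + 2 * M\<^sup>2) * (2 * (b - a) powr (1 - l) / (l * (1 - l))))"
proof -
  define K where "K = L\<^sup>2 * (b - a)\<^sup>2 + 2 * M\<^sup>2"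
  have K: "0 \<le> K" unfolding K_def by simp
  have "(\<integral>\<^sup>+p. ennreal (gagliardo_integrand l w p) \<partial>(lborel \<Otimes>\<^sub>M lborel))
      \<le> (\<integral>\<^sup>+z. ennreal (1 / \<bar>z\<bar> powr (1 + l)) * ennreal (K * min \<bar>z\<bar> (b - a)) \<partial>lborel)"
    unfolding nn_integral_gagliardo_shear[OF assms(4)] K_def
    by (intro nn_integral_mono mult_left_mono nn_integral_translation_diff_le assms) auto
  also have "\<dots> = (\<integral>\<^sup>+z. ennreal K * ennreal (min \<bar>z\<bar> (b - a) / \<bar>z\<bar> powr (1 + l)) \<partial>lborel)"
    using K ab by (intro nn_integral_cong) (simp flip: ennreal_mult)
  also have "\<dots> = ennreal K * (\<integral>\<^sup>+z. ennreal (min \<bar>z\<bar> (b - a) / \<bar>z\<bar> powr (1 + l)) \<partial>lborel)"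
    by (intro nn_integral_cmult) measurable
  also have "\<dots> \<le> ennreal K * ennreal (2 * (b - a) powr (1 - l) / (l * (1 - l)))"
    using nn_integral_min_kernel[OF l, of "b - a"] ab by (intro mult_left_mono) auto
  also have "\<dots> = ennreal (K * (2 * (b - a) powr (1 - l) / (l * (1 - l))))"
    using K l by (intro ennreal_mult[symmetric]) auto
  finally show ?thesis unfolding K_def .
qed

lemma nn_integral_square_le:
  assumes ab: "a < b" and "\<And>x. x \<notin> {a<..<b} \<Longrightarrow> w x = 0" "\<And>x. \<bar>w x\<bar> \<le> M"
  shows "(\<integral>\<^sup>+x. ennreal ((w x)\<^sup>2) \<partial>lborel) \<le> ennreal (M\<^sup>2 * (b - a :: real))"
proof -
  have "(w x)\<^sup>2 \<le> M\<^sup>2 * indicator {a..b} x" for x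
    using assms(2)[of x] power_mono[OF assms(3)[of x], of 2]
    by (auto simp: indicator_def)
  then have "(\<integral>\<^sup>+x. ennreal ((w x)\<^sup>2) \<partial>lborel) \<le> (\<integral>\<^sup>+x. ennreal (M\<^sup>2) * indicator {a..b} x \<partial>lborel)"
    by (intro nn_integral_mono)
       (auto simp: ennreal_indicator[symmetric] simp del: ennreal_indicator
         simp flip: ennreal_mult intro!: ennreal_leI)
  also have "\<dots> = ennreal (M\<^sup>2 * (b - a))"
    using ab by (simp add: nn_integral_cmult_indicator ennreal_mult)
  finally show ?thesis .
qed

text \<open>The common criterion for membership: basis functions, test functions and the transition
  layers of the approximation are all bounded and Lipschitz on one interval and zero outside, with
  jumps allowed at the two ends.\<close>

lemma sobolev_piecewise:
  assumes l: "0 < l" "l < 1" and ab: "a < b" and w: "w \<in> borel_measurable borel"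
    and *: "\<And>x. x \<notin> {a<..<b} \<Longrightarrow> w x = 0" "\<And>x. \<bar>w x\<bar> \<le> M"
    and L: "\<And>x z. x \<in> {a<..<b} \<Longrightarrow> z \<in> {a<..<b} \<Longrightarrow> \<bar>w z - w x\<bar> \<le> L * \<bar>z - x\<bar>"
  shows "w \<in> sobolev_space l"
    and "sobolev_norm l w \<le> sqrt (M\<^sup>2 * (b - a)
          + (L\<^sup>2 * (b - a)\<^sup>2 + 2 * M\<^sup>2) * (2 * (b - a) powr (1 - l) / (l * (1 - l))))"
proof -
  have 1: "square_integrable lborel w" "(l2_norm lborel w)\<^sup>2 \<le> M\<^sup>2 * (b - a)"
    by (rule l2_norm_sq_le[where c = "M\<^sup>2 * (b - a)"];
        use w ab nn_integral_square_le[OF ab *] in auto)+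
  have g: "(\<integral>\<^sup>+p. ennreal ((diff_quotient l w p)\<^sup>2) \<partial>(lborel \<Otimes>\<^sub>M lborel))
    \<le> ennreal ((L\<^sup>2 * (b - a)\<^sup>2 + 2 * M\<^sup>2) * (2 * (b - a) powr (1 - l) / (l * (1 - l))))"
    unfolding diff_quotient_sq using nn_integral_gagliardo_le[OF l ab w * L] .
  have n: "0 \<le> (L\<^sup>2 * (b - a)\<^sup>2 + 2 * M\<^sup>2) * (2 * (b - a) powr (1 - l) / (l * (1 - l)))"
    using l by (intro mult_nonneg_nonneg divide_nonneg_pos) auto
  note 2 = l2_norm_sq_le[OF borel_measurable_diff_quotient[OF w] g n]
  show "w \<in> sobolev_space l" using 1 2 by (simp add: sobolev_space_iff)
  show "sobolev_norm l w \<le> sqrt (M\<^sup>2 * (b - a)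
          + (L\<^sup>2 * (b - a)\<^sup>2 + 2 * M\<^sup>2) * (2 * (b - a) powr (1 - l) / (l * (1 - l))))"
    unfolding sobolev_norm_def sobolev_seminorm_eq L2_norm_eq using 1 2
    by (intro real_sqrt_le_mono add_mono)
qed

text \<open>Absolute integrability of the unsymmetrised integrand licenses Fubini and the exchange
  of variables. The difference of \<open>\<phi>\<close> is at most C min |z| 1, which makes the
  kernel integrable without a principal value since l < 1. It vanishes unless \<open>x\<close> or
  \<open>x + z\<close> lies in [-R, R], and there |v| <= 1 + v^2 brings in the L^2 norm.\<close>

lemma integrable_frac_kernel:
  assumes l: "0 < l" "l < 1" and [measurable]: "\<phi> \<in> borel_measurable borel"
    and R: "\<And>x. \<bar>x\<bar> > R \<Longrightarrow> \<phi> x = 0" and R0: "0 \<le> R"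
    and M: "\<And>x. \<bar>\<phi> x\<bar> \<le> M" and L: "\<And>x z. \<bar>\<phi> z - \<phi> x\<bar> \<le> L * \<bar>z - x\<bar>"
    and v: "square_integrable lborel v"
  shows "integrable (lborel \<Otimes>\<^sub>M lborel) (\<lambda>(x, z). (\<phi> z - \<phi> x) * v x / \<bar>z - x\<bar> powr (1 + l))"
    (is "integrable _ ?g")
proof (rule integrableI_bounded)
  have [measurable]: "v \<in> borel_measurable borel"
    using v unfolding square_integrable_def by simp
  show "?g \<in> borel_measurable (lborel \<Otimes>\<^sub>M lborel)" by measurable
  \<comment> \<open>The Lipschitz constant serves for small increments, 2 M for large ones.\<close>
  define C where "C = max \<bar>L\<bar> (2 * M)"
  have C0: "0 \<le> C" unfolding C_def by auto
  define V where "V = (l2_norm lborel v)\<^sup>2"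
  have inner: "(\<integral>\<^sup>+x. ennreal (norm (?g (x, x + z))) \<partial>lborel)
      \<le> ennreal ((C * (4 * R + 2 * V)) * (min \<bar>z\<bar> 1 / \<bar>z\<bar> powr (1 + l)))" for z
  proof -
    define k where "k = C * (min \<bar>z\<bar> 1 / \<bar>z\<bar> powr (1 + l))"
    have k0: "0 \<le> k" unfolding k_def using C0 by auto
    have pt: "norm (?g (x, x + z))
        \<le> k * (indicator {-R..R} x + indicator {-R-z..R-z} x + 2 * (v x)\<^sup>2)" for x
    proof -
      have a: "\<bar>\<phi> (x + z) - \<phi> x\<bar> \<le> C * min \<bar>z\<bar> 1"
      proof -
        have "\<bar>\<phi> (x + z) - \<phi> x\<bar> \<le> \<bar>L\<bar> * \<bar>z\<bar>"
          using order_trans[OF L[of "x + z" x] mult_right_mono[of L "\<bar>L\<bar>"]] by simp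
        also have "\<dots> \<le> C * \<bar>z\<bar>" unfolding C_def by (intro mult_right_mono) auto
        finally have 1: "\<bar>\<phi> (x + z) - \<phi> x\<bar> \<le> C * \<bar>z\<bar>" .
        have "\<bar>\<phi> (x + z) - \<phi> x\<bar> \<le> C" using M[of "x + z"] M[of x] unfolding C_def by linarith
        then show ?thesis using 1 by (simp add: min_def)
      qed
      have b: "\<bar>v x\<bar> \<le> 1 + (v x)\<^sup>2"
        using sum_squares_bound[of "\<bar>v x\<bar>" 1] by simp
      define i where "i = (indicator {-R..R} x + indicator {-R-z..R-z} x :: real)"
      have i: "0 \<le> i" "i \<le> 2" unfolding i_def by (auto simp: indicator_def)
      have "\<bar>\<phi> (x + z) - \<phi> x\<bar> * \<bar>v x\<bar> \<le> C * min \<bar>z\<bar> 1 * (i + 2 * (v x)\<^sup>2)"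
      proof (cases "i = 0")
        case True
        then have "\<bar>x\<bar> > R" "\<bar>x + z\<bar> > R" unfolding i_def by (auto simp: indicator_def of_bool_def abs_if split: if_splits)
        then show ?thesis using R[of x] R[of "x + z"] C0 i by simp
      next
        case False
        then have i1: "1 \<le> i" unfolding i_def by (auto simp: indicator_def)
        have "\<bar>\<phi> (x + z) - \<phi> x\<bar> * \<bar>v x\<bar> \<le> C * min \<bar>z\<bar> 1 * (1 + (v x)\<^sup>2)"
          using a b C0 by (intro mult_mono) auto
        also have "\<dots> \<le> C * min \<bar>z\<bar> 1 * (i + 2 * (v x)\<^sup>2)"
          using i1 C0 zero_le_power2[of "v x"] by (intro mult_left_mono) (linarith, auto)
        finally show ?thesis .
      qed
      then have "\<bar>\<phi> (x + z) - \<phi> x\<bar> * \<bar>v x\<bar> / \<bar>z\<bar> powr (1 + l)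
          \<le> C * min \<bar>z\<bar> 1 * (i + 2 * (v x)\<^sup>2) / \<bar>z\<bar> powr (1 + l)"
        by (rule divide_right_mono) simp
      then show ?thesis unfolding k_def i_def by (simp add: abs_mult)
    qed
    have "(\<integral>\<^sup>+x. ennreal (norm (?g (x, x + z))) \<partial>lborel)
      \<le> (\<integral>\<^sup>+x. ennreal k * (indicator {-R..R} x + indicator {-R-z..R-z} x + ennreal 2 * ennreal ((v x)\<^sup>2)) \<partial>lborel)"
    proof (rule nn_integral_mono)
      fix x
      have "ennreal (norm (?g (x, x + z)))
        \<le> ennreal (k * (indicator {-R..R} x + indicator {-R-z..R-z} x + 2 * (v x)\<^sup>2))"
        by (rule ennreal_leI[OF pt])
      also have "\<dots> = ennreal k * (indicator {-R..R} x + indicator {-R-z..R-z} x + ennreal 2 * ennreal ((v x)\<^sup>2))"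
        by (simp add: k0 ennreal_mult ennreal_plus ennreal_indicator)
      finally show "ennreal (norm (?g (x, x + z)))
        \<le> ennreal k * (indicator {-R..R} x + indicator {-R-z..R-z} x + ennreal 2 * ennreal ((v x)\<^sup>2))" .
    qed
    also have "\<dots> = ennreal k * (ennreal (2 * R) + ennreal (2 * R) + ennreal 2 * ennreal V)"
      using R0 nn_integral_square[OF v]
      by (simp add: nn_integral_add nn_integral_cmult V_def)
    also have "\<dots> = ennreal (k * (2 * R + 2 * R + 2 * V))"
    proof -
      have "0 \<le> V" unfolding V_def by simp
      then have "0 \<le> 2 * R" "0 \<le> 2 * V" "0 \<le> 2 * R + 2 * R" "0 \<le> 2 * R + 2 * R + 2 * V" "0 \<le> (2::real)"
        using R0 by auto
      with \<open>0 \<le> V\<close> show ?thesis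
        by (simp only: k0 ennreal_mult[symmetric] ennreal_plus[symmetric])
    qed
    finally show ?thesis by (simp add: k_def add_divide_distrib algebra_simps)
  qed
  have K0: "0 \<le> C * (4 * R + 2 * V)" unfolding V_def using C0 R0 by auto
  have "(\<integral>\<^sup>+p. ennreal (norm (?g p)) \<partial>(lborel \<Otimes>\<^sub>M lborel))
      = (\<integral>\<^sup>+z. \<integral>\<^sup>+x. ennreal (norm (?g (x, x + z))) \<partial>lborel \<partial>lborel)"
    by (rule nn_integral_shear) measurable
  also have "\<dots> \<le> (\<integral>\<^sup>+z. ennreal (C * (4 * R + 2 * V)) * ennreal (min \<bar>z\<bar> 1 / \<bar>z\<bar> powr (1 + l)) \<partial>lborel)"
    using inner K0 by (intro nn_integral_mono) (simp flip: ennreal_mult)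
  also have "\<dots> = ennreal (C * (4 * R + 2 * V)) * (\<integral>\<^sup>+z. ennreal (min \<bar>z\<bar> 1 / \<bar>z\<bar> powr (1 + l)) \<partial>lborel)"
    by (intro nn_integral_cmult) measurable
  also have "\<dots> < \<infinity>"
    using nn_integral_min_kernel[OF l, of 1] by (auto simp: ennreal_mult_less_top intro: le_less_trans)
  finally show "(\<integral>\<^sup>+p. ennreal (norm (?g p)) \<partial>(lborel \<Otimes>\<^sub>M lborel)) < \<infinity>" .
qed

text \<open>The product of the differences of \<open>\<phi>\<close> and \<open>v\<close> is minus
  the sum of (phi(z) - phi(x)) v(x) and its mirror image under exchange of \<open>x\<close> and
  \<open>z\<close>. The shear identifies the integral of the first with that of
  \<open>singular_integral l \<phi>\<close> times \<open>v\<close>, and the swap shows that the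
  mirror image has the same integral.\<close>

lemma frac_laplacian_eq_gagliardo_form:
  assumes l: "0 < l" "l < 1" and [measurable]: "\<phi> \<in> borel_measurable borel"
    and R: "\<And>x. \<bar>x\<bar> > R \<Longrightarrow> \<phi> x = 0" and R0: "0 \<le> R"
    and M: "\<And>x. \<bar>\<phi> x\<bar> \<le> M" and L: "\<And>x z. \<bar>\<phi> z - \<phi> x\<bar> \<le> L * \<bar>z - x\<bar>"
    and v: "square_integrable lborel v"
  shows "(LINT x|lborel. frac_laplacian l \<phi> x * v x) = gagliardo_form l \<phi> v"
proof -
  define g where "g = (\<lambda>(x, z). (\<phi> z - \<phi> x) * v x / \<bar>z - x\<bar> powr (1 + l))"
  have [measurable]: "v \<in> borel_measurable borel"
    using v unfolding square_integrable_def by simp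
  have [measurable]: "g \<in> borel_measurable (lborel \<Otimes>\<^sub>M lborel)" unfolding g_def by measurable
  have gi: "integrable (lborel \<Otimes>\<^sub>M lborel) g"
    unfolding g_def by (rule integrable_frac_kernel[OF assms])
  have gs: "integrable (lborel \<Otimes>\<^sub>M lborel) (\<lambda>(x, z). g (x, x + z))"
  proof -
    have "integrable (distr (lborel \<Otimes>\<^sub>M lborel) (lborel \<Otimes>\<^sub>M lborel) (\<lambda>(x, z). (x, x + z))) g"
      using gi by (simp add: shear_measure_preserving)
    then show ?thesis by (subst (asm) integrable_distr_eq) (simp_all add: case_prod_beta')
  qed
  have "(LINT p|(lborel \<Otimes>\<^sub>M lborel). g p)
      = (LINT p|distr (lborel \<Otimes>\<^sub>M lborel) (lborel \<Otimes>\<^sub>M lborel) (\<lambda>(x, z). (x, x + z)). g p)"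
    by (simp add: shear_measure_preserving)
  also have "\<dots> = (LINT p|(lborel \<Otimes>\<^sub>M lborel). (case p of (x, z) \<Rightarrow> g (x, x + z)))"
    by (subst integral_distr) (simp_all add: case_prod_beta')
  also have "\<dots> = (LINT x|lborel. LINT z|lborel. g (x, x + z))"
    using lborel_pair.integral_fst'[OF gs] by simp
  also have "\<dots> = (LINT x|lborel. singular_integral l \<phi> x * v x)"
  proof (rule Bochner_Integration.integral_cong[OF refl])
    fix x
    have "(LINT z|lborel. g (x, x + z))
        = (LINT z|lborel. (indicator {z. \<bar>z\<bar> > 0} z * ((\<phi> (x + z) - \<phi> x) / \<bar>z\<bar> powr (1 + l))) * v x)"
      by (rule Bochner_Integration.integral_cong) (auto simp: g_def indicator_def)
    also have "\<dots> = singular_integral l \<phi> x * v x"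
      unfolding singular_integral_def set_lebesgue_integral_def real_scaleR_def
      by (rule integral_mult_left_zero)
    finally show "(LINT z|lborel. g (x, x + z)) = singular_integral l \<phi> x * v x" .
  qed
  finally have A: "(LINT p|(lborel \<Otimes>\<^sub>M lborel). g p) = (LINT x|lborel. singular_integral l \<phi> x * v x)" .
  have swi: "integrable (lborel \<Otimes>\<^sub>M lborel) (\<lambda>(x, z). g (z, x))"
    using gi by (rule lborel_pair.integrable_product_swap)
  have sw: "(LINT p|(lborel \<Otimes>\<^sub>M lborel). (case p of (x, z) \<Rightarrow> g (z, x))) = (LINT p|(lborel \<Otimes>\<^sub>M lborel). g p)"
    by (rule lborel_pair.integral_product_swap) measurable
  have "l2_inner (lborel \<Otimes>\<^sub>M lborel) (diff_quotient l \<phi>) (diff_quotient l v)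
      = (LINT p|(lborel \<Otimes>\<^sub>M lborel). - (g p + (case p of (x, z) \<Rightarrow> g (z, x))))"
    unfolding l2_inner_def
  proof (rule Bochner_Integration.integral_cong[OF refl])
    fix p :: "real \<times> real"
    obtain x z where p: "p = (x, z)" by (cases p)
    have "\<bar>x - z\<bar> = \<bar>z - x\<bar>" by simp
    then show "diff_quotient l \<phi> p * diff_quotient l v p = - (g p + (case p of (x, z) \<Rightarrow> g (z, x)))"
      unfolding p diff_quotient_mult by (simp add: g_def add_divide_distrib[symmetric]
          minus_divide_left algebra_simps)
  qed
  also have "\<dots> = - ((LINT p|(lborel \<Otimes>\<^sub>M lborel). g p)
      + (LINT p|(lborel \<Otimes>\<^sub>M lborel). (case p of (x, z) \<Rightarrow> g (z, x))))"
    unfolding Bochner_Integration.integral_minus by (subst Bochner_Integration.integral_add[OF gi swi]) simp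
  also have "\<dots> = - 2 * (LINT x|lborel. singular_integral l \<phi> x * v x)"
    unfolding sw A by simp
  finally have "gagliardo_form l \<phi> v = frac_const l * (LINT x|lborel. singular_integral l \<phi> x * v x)"
    unfolding gagliardo_form_def by simp
  also have "\<dots> = (LINT x|lborel. frac_laplacian l \<phi> x * v x)"
    unfolding frac_laplacian_def by (simp add: mult.assoc)
  finally show ?thesis ..
qed

section \<open>Smooth cutoff functions\<close>

definition smooth :: "(real \<Rightarrow> real) \<Rightarrow> bool" where
  "smooth \<phi> \<longleftrightarrow> (\<forall>n x. (deriv ^^ n) \<phi> differentiable (at x))"

text \<open>Closure of a family under \<open>deriv\<close> replaces formulas for higher derivatives:
  a smoothness proof only has to exhibit such an invariant family containing the function.\<close>

lemma smooth_coinduct: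
  assumes "\<phi> \<in> S" and "\<And>g x. g \<in> S \<Longrightarrow> g differentiable (at x)" and "\<And>g. g \<in> S \<Longrightarrow> deriv g \<in> S"
  shows "smooth \<phi>"
proof -
  have "(deriv ^^ n) \<phi> \<in> S" for n by (induction n) (use assms in auto)
  then show ?thesis unfolding smooth_def using assms(2) by blast
qed

lemma smooth_differentiable: "smooth \<phi> \<Longrightarrow> \<phi> differentiable (at x)"
  unfolding smooth_def by (metis funpow_0)

lemma smooth_deriv: "smooth \<phi> \<Longrightarrow> smooth (deriv \<phi>)"
  unfolding smooth_def by (metis comp_apply funpow_Suc_right)

lemma smooth_has_deriv: "smooth \<phi> \<Longrightarrow> (\<phi> has_real_derivative deriv \<phi> x) (at x)"
  using smooth_differentiable DERIV_deriv_iff_real_differentiable by blast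

lemma smooth_continuous_on: "smooth \<phi> \<Longrightarrow> continuous_on A \<phi>"
  using smooth_differentiable differentiable_imp_continuous_within
  by (meson continuous_at_imp_continuous_on)

lemma smooth_antiderivative:
  assumes "\<And>x. (F has_real_derivative f x) (at x)" "smooth f"
  shows "smooth F"
proof (rule smooth_coinduct[of _ "insert F (Collect smooth)"])
  have "deriv F = f" using assms(1) DERIV_imp_deriv by blast
  then show "deriv g \<in> insert F (Collect smooth)" if "g \<in> insert F (Collect smooth)" for g
    using that assms(2) smooth_deriv by auto
  show "g differentiable (at x)" if "g \<in> insert F (Collect smooth)" for g x
    using that assms(1) smooth_differentiable real_differentiable_def by auto
qed simp

text \<open>The invariant family for products. The Leibniz rule turns a product into a sum of two
  products of smooth functions, so closure under addition is built in.\<close>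

inductive_set smooth_products :: "(real \<Rightarrow> real) set" where
  prod: "smooth a \<Longrightarrow> smooth b \<Longrightarrow> (\<lambda>x. a x * b x) \<in> smooth_products"
| add: "f \<in> smooth_products \<Longrightarrow> g \<in> smooth_products \<Longrightarrow> (\<lambda>x. f x + g x) \<in> smooth_products"

lemma smooth_mult:
  assumes "smooth a" "smooth b"
  shows "smooth (\<lambda>x. a x * b x)"
proof (rule smooth_coinduct[OF smooth_products.prod[OF assms]])
  have *: "\<exists>g'\<in>smooth_products. \<forall>x. (g has_real_derivative g' x) (at x)"
    if "g \<in> smooth_products" for g
    using that
  proof induction
    case (prod a b)
    have "\<forall>x. ((\<lambda>x. a x * b x) has_real_derivative deriv a x * b x + a x * deriv b x) (at x)"
      using prod by (auto intro!: derivative_eq_intros smooth_has_deriv)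
    moreover have "(\<lambda>x. deriv a x * b x + a x * deriv b x) \<in> smooth_products"
      using prod by (intro smooth_products.intros smooth_deriv)
    ultimately show ?case by (intro bexI)
  next
    case (add f g)
    then obtain f' g' where "f' \<in> smooth_products" "g' \<in> smooth_products"
      "\<forall>x. (f has_real_derivative f' x) (at x)" "\<forall>x. (g has_real_derivative g' x) (at x)" by blast
    then show ?case
      by (intro bexI[of _ "\<lambda>x. f' x + g' x"]) (auto intro: DERIV_add smooth_products.intros)
  qed
  show "g differentiable (at x)" if "g \<in> smooth_products" for g x
    using *[OF that] real_differentiable_def by blast
  show "deriv g \<in> smooth_products" if g: "g \<in> smooth_products" for g
  proof -
    obtain g' where g': "g' \<in> smooth_products" "\<forall>x. (g has_real_derivative g' x) (at x)"
      using *[OF g] by blast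
    then have "deriv g = g'" using DERIV_imp_deriv by blast
    then show ?thesis using g' by simp
  qed
qed

lemma smooth_poly: "smooth (poly p)"
proof (rule smooth_coinduct[of _ "range poly"])
  show "deriv g \<in> range poly" if g: "g \<in> range poly" for g :: "real \<Rightarrow> real"
  proof -
    obtain q where "g = poly q" using g by (rule rangeE)
    moreover have "deriv (poly q) = poly (pderiv q)" using DERIV_imp_deriv poly_DERIV by blast
    ultimately show ?thesis by auto
  qed
qed (auto simp: poly_differentiable)

lemma smooth_const: "smooth (\<lambda>x. c)"
proof -
  have "poly [:c:] = (\<lambda>x. c)" by auto
  then show ?thesis using smooth_poly[of "[:c:]"] by simp
qed

lemma smooth_affine:
  assumes "smooth f"
  shows "smooth (\<lambda>x. f (a * x + b))"
\<comment> \<open>The scalar \<open>c\<close> in the family absorbs the factor \<open>a\<close> of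
  the chain rule.\<close>
proof (rule smooth_coinduct[of _ "{\<lambda>x. c * g (a * x + b) |c g. smooth g}"])
  show "(\<lambda>x. f (a * x + b)) \<in> {\<lambda>x. c * g (a * x + b) |c g. smooth g}"
    using assms by (intro CollectI exI[of _ 1] exI[of _ f]) auto
  have *: "((\<lambda>x. c * g (a * x + b)) has_real_derivative c * a * deriv g (a * x + b)) (at x)"
    if "smooth g" for c g x
  proof -
    have "((\<lambda>x. g (a * x + b)) has_real_derivative deriv g (a * x + b) * a) (at x)"
      by (rule DERIV_chain'[of "\<lambda>x. a * x + b"])
         (auto intro!: derivative_eq_intros smooth_has_deriv that)
    then show ?thesis by (auto intro!: derivative_eq_intros)
  qed
  show "g differentiable (at x)" if "g \<in> {\<lambda>x. c * g (a * x + b) |c g. smooth g}" for g x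
    using that * real_differentiable_def by blast
  show "deriv g \<in> {\<lambda>x. c * g (a * x + b) |c g. smooth g}"
    if g: "g \<in> {\<lambda>x. c * g (a * x + b) |c g. smooth g}" for g
  proof -
    obtain c g0 where g0: "g = (\<lambda>x. c * g0 (a * x + b))" "smooth g0" using g by blast
    have "deriv g = (\<lambda>x. c * a * deriv g0 (a * x + b))"
      using *[OF g0(2)] g0(1) DERIV_imp_deriv by blast
    then show ?thesis using smooth_deriv[OF g0(2)] by blast
  qed
qed

text \<open>The classical exp(-1/x), multiplied by a polynomial in 1/x so that the family is closed
  under differentiation.\<close>

definition flat :: "real poly \<Rightarrow> real \<Rightarrow> real" where
  "flat q x = (if x > 0 then poly q (1 / x) * exp (- (1 / x)) else 0)"

lemma poly_over_exp_tendsto_0: "((\<lambda>y. poly q y / exp y) \<longlongrightarrow> (0::real)) at_top"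
proof -
  have "((\<lambda>y. \<Sum>i\<le>degree q. coeff q i * (y ^ i / exp y)) \<longlongrightarrow> (\<Sum>i\<le>degree q. coeff q i * 0)) at_top"
    by (intro tendsto_sum tendsto_mult tendsto_const tendsto_power_div_exp_0)
  then show ?thesis by (simp add: poly_altdef sum_divide_distrib)
qed

lemma flat_tendsto_0: "(flat q \<longlongrightarrow> 0) (at_right 0)"
proof -
  have "((\<lambda>x. poly q (inverse x) / exp (inverse x)) \<longlongrightarrow> 0) (at_right (0::real))"
    by (rule filterlim_compose[OF poly_over_exp_tendsto_0 filterlim_inverse_at_top_right])
  moreover have "\<forall>\<^sub>F x in at_right 0. flat q x = poly q (inverse x) / exp (inverse x)"
    by (rule eventually_mono[OF eventually_at_right_less])
       (auto simp: flat_def exp_minus inverse_eq_divide)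
  ultimately show ?thesis by (simp add: tendsto_cong)
qed

text \<open>With y = 1/x and dy/dx = -y^2, the derivative of q(y) exp(-y) is y^2 (q(y) - q'(y))
  exp(-y); \<open>[:0, 0, 1:]\<close> is y^2.\<close>

lemma flat_deriv: "(flat q has_real_derivative flat ([:0, 0, 1:] * (q - pderiv q)) x) (at x)"
proof -
  consider "x > 0" | "x < 0" | "x = 0" by linarith
  then show ?thesis
  proof cases
    case 1
    have "((\<lambda>x. poly q (1 / x) * exp (- (1 / x))) has_real_derivative
        flat ([:0, 0, 1:] * (q - pderiv q)) x) (at x)"
    proof -
      have "((\<lambda>x. poly q (1 / x)) has_real_derivative poly (pderiv q) (1 / x) * (- 1 / x\<^sup>2)) (at x)"
        by (rule DERIV_chain'[of "\<lambda>x. 1 / x"])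
           (use 1 in \<open>auto intro!: derivative_eq_intros poly_DERIV simp: power2_eq_square\<close>)
      moreover have "((\<lambda>x. exp (- (1 / x))) has_real_derivative exp (- (1 / x)) * (1 / x\<^sup>2)) (at x)"
        using 1 by (auto intro!: derivative_eq_intros simp: power2_eq_square)
      ultimately have "((\<lambda>x. poly q (1 / x) * exp (- (1 / x))) has_real_derivative
          poly (pderiv q) (1 / x) * (- 1 / x\<^sup>2) * exp (- (1 / x))
          + exp (- (1 / x)) * (1 / x\<^sup>2) * poly q (1 / x)) (at x)"
        by (rule DERIV_mult)
      moreover have "poly (pderiv q) (1 / x) * (- 1 / x\<^sup>2) * exp (- (1 / x))
          + exp (- (1 / x)) * (1 / x\<^sup>2) * poly q (1 / x) = flat ([:0, 0, 1:] * (q - pderiv q)) x"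
        using 1 by (simp add: flat_def field_simps power2_eq_square)
      ultimately show ?thesis by simp
    qed
    then show ?thesis
      by (rule has_field_derivative_transform_within_open[of _ _ _ "{0<..}"])
         (use 1 in \<open>auto simp: flat_def\<close>)
  next
    case 2
    have "((\<lambda>x. 0) has_real_derivative 0) (at x)" by simp
    then have "(flat q has_real_derivative 0) (at x)"
      by (rule has_field_derivative_transform_within_open[of _ _ _ "{..<0}"])
         (use 2 in \<open>auto simp: flat_def\<close>)
    then show ?thesis using 2 by (simp add: flat_def)
  next
    case 3
    have "((\<lambda>y. (flat q y - flat q 0) / (y - 0)) \<longlongrightarrow> 0) (at 0)"
      unfolding filterlim_split_at_real
    proof (intro conjI filterlim_split_at)
      have "\<forall>\<^sub>F y in at_left 0. (flat q y - flat q 0) / (y - 0) = 0"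
        by (auto simp: eventually_at_left[of "-1"] flat_def intro!: exI[of _ "-1"])
      then show "((\<lambda>y. (flat q y - flat q 0) / (y - 0)) \<longlongrightarrow> 0) (at_left 0)"
        by (simp add: tendsto_eventually)
      \<comment> \<open>Dividing by \<open>y\<close> multiplies the polynomial by 1/y, so the
        difference quotient is again a \<open>flat\<close> function and tends to 0.\<close>
      have "\<forall>\<^sub>F y in at_right 0. (flat q y - flat q 0) / (y - 0) = flat ([:0, 1:] * q) y"
        using eventually_at_right_less by (rule eventually_mono) (simp add: flat_def)
      then show "((\<lambda>y. (flat q y - flat q 0) / (y - 0)) \<longlongrightarrow> 0) (at_right 0)"
        using flat_tendsto_0 by (simp add: tendsto_cong)
    qed
    then show ?thesis using 3 by (simp add: has_field_derivative_iff flat_def)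
  qed
qed

lemma smooth_flat: "smooth (flat q)"
proof (rule smooth_coinduct[of _ "range flat"])
  show "g differentiable (at x)" if "g \<in> range flat" for g x
    using that flat_deriv real_differentiable_def by blast
  show "deriv g \<in> range flat" if g: "g \<in> range flat" for g
  proof -
    obtain q where "g = flat q" using g by (rule rangeE)
    moreover have "deriv (flat q) = flat ([:0, 0, 1:] * (q - pderiv q))"
      using DERIV_imp_deriv flat_deriv by blast
    ultimately show ?thesis by simp
  qed
qed simp

section \<open>A smooth transition from 0 to 1\<close>

lemma ex_antiderivative:
  fixes f :: "real \<Rightarrow> real"
  assumes "continuous_on UNIV f"
  obtains F where "\<And>x. (F has_real_derivative f x) (at x)" "F 0 = 0"
proof -
  define F where "F = (\<lambda>u::real. LBINT y=(0::real)..u. f y)"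
  have "(F has_real_derivative f x) (at x)" for x
  proof -
    have "(F has_vector_derivative f x) (at x within {-\<bar>x\<bar> - 1..\<bar>x\<bar> + 1})"
      unfolding F_def
      by (rule interval_integral_FTC2) (auto intro: continuous_on_subset[OF assms])
    moreover have "at x within {-\<bar>x\<bar> - 1..\<bar>x\<bar> + 1} = at x"
      by (rule at_within_Icc_at) auto
    ultimately show ?thesis by (simp add: has_real_derivative_iff_has_vector_derivative)
  qed
  moreover have "F 0 = 0" unfolding F_def by simp
  ultimately show ?thesis using that by blast
qed

text \<open>The normalised antiderivative of the bump exp(-1/x) exp(-1/(1-x)) on (0, 1). The bump is
  at most 1, which gives the Lipschitz constant \<open>1 / H 1\<close>; that constant is what
  controls the rescaled copies used as cutoffs.\<close>

lemma ex_smooth_step: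
  obtains h L :: "_" where "smooth h" "\<And>x. x \<le> 0 \<Longrightarrow> h x = 0" "\<And>x. x \<ge> 1 \<Longrightarrow> h x = (1::real)"
    "\<And>x::real. 0 \<le> h x" "\<And>x. h x \<le> 1" "\<And>x y. \<bar>h x - h y\<bar> \<le> L * \<bar>x - y\<bar>" "0 \<le> (L::real)"
proof -
  define b where "b = (\<lambda>x. flat 1 x * flat 1 (- 1 * x + 1))"
  have b: "smooth b" unfolding b_def by (intro smooth_mult smooth_affine smooth_flat)
  have b0: "0 \<le> b x" for x unfolding b_def flat_def by auto
  have b1: "b x \<le> 1" for x
  proof -
    have "0 \<le> flat 1 y" "flat 1 y \<le> 1" for y unfolding flat_def by auto
    then show ?thesis unfolding b_def by (intro mult_le_one) auto
  qed
  have bpos: "0 < b x" if "0 < x" "x < 1" for x using that unfolding b_def flat_def by auto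
  have bz: "b x = 0" if "x \<le> 0 \<or> x \<ge> 1" for x using that unfolding b_def flat_def by auto
  obtain H where H: "\<And>x. (H has_real_derivative b x) (at x)" "H 0 = 0"
    using ex_antiderivative[OF smooth_continuous_on[OF b]] by blast
  have Hmvt: "\<exists>z. x < z \<and> z < y \<and> H y - H x = (y - x) * b z" if "x < y" for x y
    using MVT2[OF that, of H b] H(1) by blast
  have mono: "H x \<le> H y" if xy: "x \<le> y" for x y
  proof (cases "x = y")
    case False
    then obtain z where "H y - H x = (y - x) * b z" using Hmvt[of x y] xy by force
    moreover have "0 \<le> (y - x) * b z" using xy b0 by simp
    ultimately show ?thesis by linarith
  qed simp
  have H1: "H 1 > 0"
  proof -
    obtain z where "0 < z" "z < 1" "H 1 - H 0 = (1 - 0) * b z" using Hmvt[of 0 1] by auto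
    then show ?thesis using bpos[of z] H(2) by simp
  qed
  have Hl: "H x = 0" if x: "x \<le> 0" for x
  proof (cases "x = 0")
    case False
    then obtain z where "z < 0" "H 0 - H x = (0 - x) * b z" using Hmvt[of x 0] x by force
    then show ?thesis using bz[of z] H(2) by simp
  qed (simp add: H)
  have Hr: "H x = H 1" if x: "x \<ge> 1" for x
  proof (cases "x = 1")
    case False
    then obtain z where "z > 1" "H x - H 1 = (x - 1) * b z" using Hmvt[of 1 x] x by force
    then show ?thesis using bz[of z] by simp
  qed simp
  have lip: "\<bar>H x - H y\<bar> \<le> \<bar>x - y\<bar>" for x y
  proof -
    have *: "\<bar>H y - H x\<bar> \<le> \<bar>y - x\<bar>" if xy: "x < y" for x y
    proof -
      obtain z where "H y - H x = (y - x) * b z" using Hmvt[OF xy] by auto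
      then show ?thesis using b0[of z] b1[of z] xy by (simp add: abs_mult mult_left_le)
    qed
    consider "x < y" | "x = y" | "y < x" by linarith
    then show ?thesis using *[of x y] *[of y x] by cases (auto simp: abs_minus_commute)
  qed
  define h where "h = (\<lambda>x. H x / H 1)"
  show ?thesis
  proof (rule that[of h "1 / H 1"])
    show "smooth h"
    proof (rule smooth_antiderivative)
      show "(h has_real_derivative (1 / H 1) * b x) (at x)" for x
        unfolding h_def using H1 by (auto intro!: derivative_eq_intros H(1))
      show "smooth (\<lambda>x. (1 / H 1) * b x)" by (intro smooth_mult smooth_const b)
    qed
    show "h x = 0" if "x \<le> 0" for x using Hl[OF that] by (simp add: h_def)
    show "h x = 1" if "x \<ge> 1" for x using Hr[OF that] H1 by (simp add: h_def)
    show "0 \<le> h x" for x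
      using mono[of 0 x] mono[of x 0] H1 H(2) Hl[of x] by (cases "x \<le> 0") (auto simp: h_def)
    show "h x \<le> 1" for x
      using mono[of x 1] Hr[of x] H1 by (cases "x \<le> 1") (auto simp: h_def)
    show "\<bar>h x - h y\<bar> \<le> 1 / H 1 * \<bar>x - y\<bar>" for x y
      using lip[of x y] H1 by (simp add: h_def diff_divide_distrib[symmetric] abs_divide divide_right_mono)
    show "0 \<le> 1 / H 1" using H1 by simp
  qed
qed

text \<open>Function and derivative both vanish outside the support interval, so continuity on a
  compact interval bounds them everywhere; the bound of the derivative is the Lipschitz
  constant.\<close>

lemma test_function_bounds:
  assumes "test_function \<phi>"
  obtains R M L where "\<phi> \<in> borel_measurable borel" "0 \<le> R" "\<And>x. \<bar>x\<bar> > R \<Longrightarrow> \<phi> x = 0"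
    "\<And>x. \<bar>\<phi> x\<bar> \<le> M" "\<And>x z. \<bar>\<phi> z - \<phi> x\<bar> \<le> L * \<bar>z - x\<bar>"
proof -
  have s: "smooth \<phi>" using assms unfolding test_function_def smooth_def by blast
  obtain R0 where R0: "\<And>x. \<bar>x\<bar> > R0 \<Longrightarrow> \<phi> x = 0" using assms unfolding test_function_def by blast
  define R where "R = max R0 0"
  have R: "0 \<le> R" "\<And>x. \<bar>x\<bar> > R \<Longrightarrow> \<phi> x = 0" unfolding R_def using R0 by auto
  have bdd: "\<exists>M. \<forall>x. \<bar>g x\<bar> \<le> M" if g: "continuous_on {-R..R} g" "\<And>x. \<bar>x\<bar> > R \<Longrightarrow> g x = 0"
    for g :: "real \<Rightarrow> real"
  proof -
    have "bounded (g ` {-R..R})" by (intro compact_imp_bounded compact_continuous_image g compact_Icc)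
    then obtain M where M: "\<And>x. x \<in> {-R..R} \<Longrightarrow> \<bar>g x\<bar> \<le> M" unfolding bounded_iff
      by (metis imageI real_norm_def)
    have "\<bar>g x\<bar> \<le> max M 0" for x
    proof (cases "\<bar>x\<bar> > R")
      case False
      then have "x \<in> {-R..R}" by auto
      then show ?thesis using M[of x] by simp
    qed (simp add: g)
    then show ?thesis by blast
  qed
  obtain M where M: "\<And>x. \<bar>\<phi> x\<bar> \<le> M" using bdd[OF smooth_continuous_on[OF s] R(2)] by blast
  have d0: "deriv \<phi> x = 0" if "\<bar>x\<bar> > R" for x
  proof -
    have "((\<lambda>x. 0) has_real_derivative 0) (at x)" by simp
    then have "(\<phi> has_real_derivative 0) (at x)"
      by (rule has_field_derivative_transform_within_open[of _ _ _ "{x. R < \<bar>x\<bar>}"])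
         (use that R(2) in \<open>auto intro!: open_Collect_less continuous_intros\<close>)
    then show ?thesis by (rule DERIV_imp_deriv)
  qed
  obtain L where L: "\<And>x. \<bar>deriv \<phi> x\<bar> \<le> L"
    using bdd[OF smooth_continuous_on[OF smooth_deriv[OF s]] d0] by blast
  have "\<bar>\<phi> z - \<phi> x\<bar> \<le> L * \<bar>z - x\<bar>" for x z
    using field_differentiable_bound[of UNIV \<phi> "deriv \<phi>" L z x] smooth_has_deriv[OF s] L by auto
  moreover have "\<phi> \<in> borel_measurable borel"
    using smooth_continuous_on[OF s] by (rule borel_measurable_continuous_onI)
  ultimately show ?thesis using that R M by blast
qed

lemma test_function_sobolev:
  assumes l: "0 < l" "l < 1" and "test_function \<phi>"
  shows "\<phi> \<in> sobolev_space l"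
proof -
  obtain R M L where *: "\<phi> \<in> borel_measurable borel" "0 \<le> R" "\<And>x. \<bar>x\<bar> > R \<Longrightarrow> \<phi> x = 0"
    "\<And>x. \<bar>\<phi> x\<bar> \<le> M" "\<And>x z. \<bar>\<phi> z - \<phi> x\<bar> \<le> L * \<bar>z - x\<bar>"
    using test_function_bounds[OF assms(3)] by metis
  \<comment> \<open>Vanishing is known only for |x| > R, and \<open>R\<close> may be 0, so the open
    interval is enlarged by 1 on each side.\<close>
  have ab: "-R-1 < R+1" using *(2) by linarith
  show ?thesis
    by (rule sobolev_piecewise(1)[OF l ab *(1) _ *(4) *(5)]) (use *(3) in auto)
qed

section \<open>Approximation by test functions\<close>

lemma sobolev_norm_triangle:
  assumes "u \<in> sobolev_space l" "v \<in> sobolev_space l"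
  shows "sobolev_norm l (\<lambda>x. u x + v x) \<le> sobolev_norm l u + sobolev_norm l v"
proof -
  have "sobolev_norm l (\<lambda>x. u x + v x)
      \<le> sqrt ((L2_norm u + L2_norm v)\<^sup>2 + (sobolev_seminorm l u + sobolev_seminorm l v)\<^sup>2)"
    using assms unfolding sobolev_norm_def sobolev_seminorm_eq L2_norm_eq sobolev_space_iff
    by (intro real_sqrt_le_mono add_mono power_mono) (auto simp: diff_quotient_add l2_norm_triangle)
  also have "\<dots> \<le> sobolev_norm l u + sobolev_norm l v"
    unfolding sobolev_norm_def by (rule real_sqrt_sum_squares_triangle_ineq)
  finally show ?thesis .
qed

text \<open>The cutoff \<open>s\<close> has slope K/e on a layer of width \<open>e\<close>, so the
  product has slope at most L + M K/e. Times the width this stays bounded, and the remaining powers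
  of \<open>e\<close> drive the bound to 0.\<close>

lemma sobolev_layer_bound:
  assumes l: "0 < l" "l < 1" and e: "0 < e"
    and [measurable]: "p \<in> borel_measurable borel" "s \<in> borel_measurable borel"
    and M: "\<And>x. x \<in> {c<..<c+e} \<Longrightarrow> \<bar>p x\<bar> \<le> M" and M0: "0 \<le> M"
    and L: "\<And>x z. x \<in> {c<..<c+e} \<Longrightarrow> z \<in> {c<..<c+e} \<Longrightarrow> \<bar>p z - p x\<bar> \<le> L * \<bar>z - x\<bar>"
    and s: "\<And>x. \<bar>s x\<bar> \<le> 1" and K: "\<And>x z. \<bar>s z - s x\<bar> \<le> K / e * \<bar>z - x\<bar>"
  defines "r \<equiv> \<lambda>x. if x \<in> {c<..<c+e} then p x * s x else 0"
  shows "r \<in> sobolev_space l"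
    and "sobolev_norm l r \<le>
      sqrt (M\<^sup>2 * e + ((L * e + M * K)\<^sup>2 + 2 * M\<^sup>2) * (2 * e powr (1 - l) / (l * (1 - l))))"
proof -
  have r [measurable]: "r \<in> borel_measurable borel" unfolding r_def by measurable
  have z: "r x = 0" if "x \<notin> {c<..<c+e}" for x using that unfolding r_def by auto
  have b: "\<bar>r x\<bar> \<le> M" for x
    using mult_mono[OF M s, of x x] M0 unfolding r_def by (auto simp: abs_mult)
  have lip: "\<bar>r z - r x\<bar> \<le> (L + M * (K / e)) * \<bar>z - x\<bar>" if "x \<in> {c<..<c+e}" "z \<in> {c<..<c+e}" for x z
  proof -
    have "r z - r x = (p z - p x) * s z + p x * (s z - s x)"
      using that unfolding r_def by (simp add: algebra_simps)
    then have "\<bar>r z - r x\<bar> \<le> \<bar>p z - p x\<bar> * \<bar>s z\<bar> + \<bar>p x\<bar> * \<bar>s z - s x\<bar>"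
      by (metis abs_mult abs_triangle_ineq)
    also have "\<dots> \<le> (L * \<bar>z - x\<bar>) * 1 + M * (K / e * \<bar>z - x\<bar>)"
      using L[OF that] s[of z] M[OF that(1)] K[of z x] M0
      by (intro add_mono mult_mono) (auto intro: order_trans[OF abs_ge_zero])
    also have "\<dots> = (L + M * (K / e)) * \<bar>z - x\<bar>" by (simp add: algebra_simps)
    finally show ?thesis .
  qed
  have ce: "c < c + e" using e by simp
  note * = sobolev_piecewise[OF l ce r z b lip]
  show "r \<in> sobolev_space l" using * by auto
  have "(L + M * (K / e))\<^sup>2 * (c + e - c)\<^sup>2 = (L * e + M * K)\<^sup>2"
    using e by (simp add: field_simps flip: power_mult_distrib)
  then show "sobolev_norm l r \<le>
      sqrt (M\<^sup>2 * e + ((L * e + M * K)\<^sup>2 + 2 * M\<^sup>2) * (2 * e powr (1 - l) / (l * (1 - l))))"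
    using *(2) by (simp add: mult.assoc)
qed

lemma poly_bounds_on_interval:
  fixes p :: "real poly"
  obtains M L where "0 \<le> M" "\<And>x. x \<in> {a..b} \<Longrightarrow> \<bar>poly p x\<bar> \<le> M"
    "\<And>x z. x \<in> {a..b} \<Longrightarrow> z \<in> {a..b} \<Longrightarrow> \<bar>poly p z - poly p x\<bar> \<le> L * \<bar>z - x\<bar>"
proof -
  have bdd: "\<exists>M. \<forall>x\<in>{a..b}. \<bar>poly q x\<bar> \<le> M" for q :: "real poly"
  proof -
    have "bounded (poly q ` {a..b})"
      by (intro compact_imp_bounded compact_continuous_image compact_Icc continuous_intros)
    then show ?thesis unfolding bounded_iff by (metis imageI real_norm_def)
  qed
  obtain M where M: "\<forall>x\<in>{a..b}. \<bar>poly p x\<bar> \<le> M" using bdd by blast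
  obtain L where L: "\<forall>x\<in>{a..b}. \<bar>poly (pderiv p) x\<bar> \<le> L" using bdd by blast
  have "\<bar>poly p z - poly p x\<bar> \<le> L * \<bar>z - x\<bar>" if "x \<in> {a..b}" "z \<in> {a..b}" for x z
    using field_differentiable_bound[of "{a..b}" "poly p" "poly (pderiv p)" L z x] L that
    by (auto intro: poly_DERIV[THEN DERIV_subset])
  then show ?thesis using that[of "max M 0" L] M by (auto simp: le_max_iff_disj)
qed

lemma sobolev_indicator_poly:
  assumes l: "0 < l" "l < 1" and ab: "a < b"
  shows "(\<lambda>x. if x \<in> {a<..<b} then poly p x else 0) \<in> sobolev_space l"
proof -
  obtain M L where *: "0 \<le> M" "\<And>x. x \<in> {a..b} \<Longrightarrow> \<bar>poly p x\<bar> \<le> M"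
    "\<And>x z. x \<in> {a..b} \<Longrightarrow> z \<in> {a..b} \<Longrightarrow> \<bar>poly p z - poly p x\<bar> \<le> L * \<bar>z - x\<bar>"
    using poly_bounds_on_interval by metis
  have [measurable]: "poly p \<in> borel_measurable borel"
    by (intro borel_measurable_continuous_onI continuous_intros)
  show ?thesis
    by (rule sobolev_piecewise(1)[OF l ab, of _ M L])
       (use *(1) in \<open>auto intro: *(2,3)\<close>)
qed

text \<open>The approximant is the polynomial times two smooth cutoffs that rise from 0 to 1 just
  inside the end-points, so it vanishes outside the interval; the error lives in two layers of width
  \<open>e\<close>.\<close>

lemma indicator_poly_approx:
  fixes p :: "real poly"
  assumes l: "0 < l" "l < 1" and ab: "a < b" and \<delta>: "0 < \<delta>"
  obtains \<phi> where "test_function \<phi>"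
    "sobolev_norm l (\<lambda>x. (if x \<in> {a<..<b} then poly p x else 0) - \<phi> x) < \<delta>"
proof -
  obtain M L where M0: "0 \<le> M" and M: "\<And>x. x \<in> {a..b} \<Longrightarrow> \<bar>poly p x\<bar> \<le> M"
    and L: "\<And>x z. x \<in> {a..b} \<Longrightarrow> z \<in> {a..b} \<Longrightarrow> \<bar>poly p z - poly p x\<bar> \<le> L * \<bar>z - x\<bar>"
    using poly_bounds_on_interval by metis
  obtain h K where h: "smooth h" "\<And>x. x \<le> 0 \<Longrightarrow> h x = 0" "\<And>x. x \<ge> 1 \<Longrightarrow> h x = (1::real)"
    "\<And>x::real. 0 \<le> h x" "\<And>x. h x \<le> 1" "\<And>x y. \<bar>h x - h y\<bar> \<le> K * \<bar>x - y\<bar>" "0 \<le> (K::real)"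
    using ex_smooth_step by metis
  \<comment> \<open>The layer bound as a function of the width; it tends to 0 with the width because
    1 - l > 0.\<close>
  define B where "B = (\<lambda>e. sqrt (M\<^sup>2 * e + ((L * e + M * K)\<^sup>2 + 2 * M\<^sup>2) *
    (2 * e powr (1 - l) / (l * (1 - l)))))"
  have "\<forall>\<^sub>F e in at_right 0. (0::real) \<le> e"
    by (rule eventually_mono[OF eventually_at_right_less]) simp
  then have pw: "((\<lambda>e. e powr (1 - l)) \<longlongrightarrow> 0 powr (1 - l)) (at_right 0)"
    using l by (intro tendsto_powr' tendsto_intros) auto
  have "(B \<longlongrightarrow> sqrt (M\<^sup>2 * 0 + ((L * 0 + M * K)\<^sup>2 + 2 * M\<^sup>2) *
    (2 * 0 powr (1 - l) / (l * (1 - l))))) (at_right 0)"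
    unfolding B_def using l
    by (intro tendsto_intros pw) auto
  then have "(B \<longlongrightarrow> 0) (at_right 0)" by simp
  then have "\<forall>\<^sub>F e in at_right 0. B e < \<delta> / 2" by (rule order_tendstoD) (use \<delta> in simp)
  \<comment> \<open>Layers shorter than half the interval do not overlap: on each of them the other
    cutoff is 1.\<close>
  moreover have "\<forall>\<^sub>F e in at_right 0. e < (b - a) / 2"
    using order_tendstoD(2)[OF tendsto_ident_at, of 0 "(b - a) / 2"] ab by simp
  ultimately have "\<forall>\<^sub>F e in at_right 0. 0 < e \<and> e < (b - a) / 2 \<and> B e < \<delta> / 2"
    using eventually_at_right_less[of "0::real"] by eventually_elim auto
  then obtain e where e: "0 < e" "e < (b - a) / 2" "B e < \<delta> / 2"
    using eventually_happens'[OF trivial_limit_at_right_real] by blast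
  define f where "f = (\<lambda>x. h ((1 / e) * x + (- a / e)))"
  define g where "g = (\<lambda>x. h ((- 1 / e) * x + b / e))"
  define \<phi> where "\<phi> = (\<lambda>x. poly p x * (f x * g x))"
  have fg: "smooth f" "smooth g" unfolding f_def g_def by (intro smooth_affine h)+
  have s: "smooth \<phi>" unfolding \<phi>_def by (intro smooth_mult smooth_poly fg)
  have f: "f x = 0" if "x \<le> a" for x
    unfolding f_def by (rule h(2)) (use that e(1) in \<open>simp add: field_simps\<close>)
  have f1: "f x = 1" if "x \<ge> a + e" for x
    unfolding f_def by (rule h(3)) (use that e(1) in \<open>simp add: field_simps\<close>)
  have g: "g x = 0" if "x \<ge> b" for x
    unfolding g_def by (rule h(2)) (use that e(1) in \<open>simp add: field_simps\<close>)
  have g1: "g x = 1" if "x \<le> b - e" for x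
    unfolding g_def by (rule h(3)) (use that e(1) in \<open>simp add: field_simps\<close>)
  have test: "test_function \<phi>"
    unfolding test_function_def
  proof (intro conjI exI[of _ "max \<bar>a\<bar> \<bar>b\<bar>"] allI impI)
    show "(deriv ^^ n) \<phi> differentiable at x" for n x using s unfolding smooth_def by blast
    show "\<phi> x = 0" if "max \<bar>a\<bar> \<bar>b\<bar> < \<bar>x\<bar>" for x
    proof -
      have "x \<le> a \<or> x \<ge> b" using that by auto
      then show ?thesis unfolding \<phi>_def using f[of x] g[of x] by auto
    qed
  qed
  have [measurable]: "poly p \<in> borel_measurable borel" "f \<in> borel_measurable borel"
    "g \<in> borel_measurable borel"
    by (intro borel_measurable_continuous_onI smooth_continuous_on fg smooth_poly)+
  define r1 where "r1 = (\<lambda>x. if x \<in> {a<..<a+e} then poly p x * (1 - f x) else 0)"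
  \<comment> \<open>\<open>b-e+e\<close> is left unsimplified to match the form
    \<open>{c<..<c+e}\<close> of the layer bound.\<close>
  define r2 where "r2 = (\<lambda>x. if x \<in> {b-e<..<b-e+e} then poly p x * (1 - g x) else 0)"
  have pm: "poly p \<in> borel_measurable borel" by measurable
  have m1: "(\<lambda>x. 1 - f x) \<in> borel_measurable borel" by measurable
  have s1: "\<bar>1 - f x\<bar> \<le> 1" for x
    using h(4,5)[of "(1 / e) * x + (- a / e)"] unfolding f_def by (simp add: abs_le_iff)
  have K1: "\<bar>(1 - f z) - (1 - f x)\<bar> \<le> K / e * \<bar>z - x\<bar>" for x z
  proof -
    have "\<bar>((1 / e) * x + (- a / e)) - ((1 / e) * z + (- a / e))\<bar> = \<bar>z - x\<bar> / e"
      using e(1) by (simp add: diff_divide_distrib[symmetric] abs_divide abs_minus_commute)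
    then show ?thesis
      using h(6)[of "(1 / e) * x + (- a / e)" "(1 / e) * z + (- a / e)"] by (simp add: f_def)
  qed
  have M1: "\<bar>poly p x\<bar> \<le> M" if "x \<in> {a<..<a+e}" for x
    by (rule M) (use that e in auto)
  have L1: "\<bar>poly p z - poly p x\<bar> \<le> L * \<bar>z - x\<bar>" if "x \<in> {a<..<a+e}" "z \<in> {a<..<a+e}" for x z
    by (rule L) (use that e in auto)
  have r1: "r1 \<in> sobolev_space l" "sobolev_norm l r1 \<le> B e"
    unfolding r1_def B_def by (rule sobolev_layer_bound[OF l e(1) pm m1 M1 M0 L1 s1 K1]; assumption)+
  have m2: "(\<lambda>x. 1 - g x) \<in> borel_measurable borel" by measurable
  have s2: "\<bar>1 - g x\<bar> \<le> 1" for x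
    using h(4,5)[of "(- 1 / e) * x + b / e"] unfolding g_def by (simp add: abs_le_iff)
  have K2: "\<bar>(1 - g z) - (1 - g x)\<bar> \<le> K / e * \<bar>z - x\<bar>" for x z
  proof -
    have "\<bar>((- 1 / e) * x + b / e) - ((- 1 / e) * z + b / e)\<bar> = \<bar>z - x\<bar> / e"
      using e(1) by (simp add: diff_divide_distrib[symmetric] abs_divide)
    then show ?thesis
      using h(6)[of "(- 1 / e) * x + b / e" "(- 1 / e) * z + b / e"] by (simp add: g_def)
  qed
  have M2: "\<bar>poly p x\<bar> \<le> M" if "x \<in> {b-e<..<b-e+e}" for x
    by (rule M) (use that e in auto)
  have L2: "\<bar>poly p z - poly p x\<bar> \<le> L * \<bar>z - x\<bar>" if "x \<in> {b-e<..<b-e+e}" "z \<in> {b-e<..<b-e+e}" for x z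
    by (rule L) (use that e in auto)
  have r2: "r2 \<in> sobolev_space l" "sobolev_norm l r2 \<le> B e"
    unfolding r2_def B_def by (rule sobolev_layer_bound[OF l e(1) pm m2 M2 M0 L2 s2 K2]; assumption)+
  have "(if x \<in> {a<..<b} then poly p x else 0) - \<phi> x = r1 x + r2 x" for x
  proof -
    consider "x \<le> a" | "a < x" "x < a + e" | "a + e \<le> x" "x \<le> b - e" | "b - e < x" "x < b" | "b \<le> x"
      by linarith
    then show ?thesis
    proof cases
      case 1
      then show ?thesis using f[of x] e ab by (simp add: \<phi>_def r1_def r2_def)
    next
      case 2
      then show ?thesis using g1[of x] e ab by (simp add: \<phi>_def r1_def r2_def algebra_simps)
    next
      case 3
      then show ?thesis using f1[of x] g1[of x] e ab by (simp add: \<phi>_def r1_def r2_def)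
    next
      case 4
      then show ?thesis using f1[of x] e ab by (simp add: \<phi>_def r1_def r2_def algebra_simps)
    next
      case 5
      then show ?thesis using g[of x] e ab by (simp add: \<phi>_def r1_def r2_def)
    qed
  qed
  then have "sobolev_norm l (\<lambda>x. (if x \<in> {a<..<b} then poly p x else 0) - \<phi> x) \<le> B e + B e"
    using sobolev_norm_triangle[OF r1(1) r2(1)] r1(2) r2(2) by simp
  then show ?thesis using that[OF test] e(3) by linarith
qed

section \<open>The duality pairing\<close>

lemma extends_frac_laplacian_lincomb:
  assumes "extends_frac_laplacian l G"
    and "u \<in> sobolev_space l" "v \<in> sobolev_space l" "w \<in> sobolev_space l"
  shows "G (\<lambda>x. a * u x + b * v x) w = a * G u w + b * G v w"
  using assms(1)[unfolded extends_frac_laplacian_def, THEN conjunct1, rule_format, OF assms(2-), of a b]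
  by (rule conjunct1)

lemma extends_frac_laplacian_bound:
  assumes "extends_frac_laplacian l G"
  obtains C where "\<And>u v. u \<in> sobolev_space l \<Longrightarrow> v \<in> sobolev_space l \<Longrightarrow>
    \<bar>G u v\<bar> \<le> C * sobolev_norm l u * sobolev_norm l v"
  using assms[unfolded extends_frac_laplacian_def, THEN conjunct2, THEN conjunct1] by meson

lemma extends_frac_laplacian_test:
  assumes "extends_frac_laplacian l G" "test_function \<phi>" "v \<in> sobolev_space l"
  shows "G \<phi> v = (LINT x|lborel. frac_laplacian l \<phi> x * v x)"
  using assms(1)[unfolded extends_frac_laplacian_def, THEN conjunct2, THEN conjunct2] assms(2,3)
  by simp

text \<open>Supplies the witness for the definite description in
  \<open>frac_laplacian_pairing\<close>.\<close>

lemma gagliardo_form_extends: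
  assumes l: "0 < l" "l < 1"
  shows "extends_frac_laplacian l (gagliardo_form l)"
  unfolding extends_frac_laplacian_def
proof (intro conjI ballI allI impI)
  fix u v w a b
  assume "u \<in> sobolev_space l" "v \<in> sobolev_space l" "w \<in> sobolev_space l"
  note * = gagliardo_form_lincomb_right[OF this, of a b]
  show "gagliardo_form l w (\<lambda>x. a * u x + b * v x) = a * gagliardo_form l w u + b * gagliardo_form l w v"
    by (rule *)
  show "gagliardo_form l (\<lambda>x. a * u x + b * v x) w = a * gagliardo_form l u w + b * gagliardo_form l v w"
    using * by (simp only: gagliardo_form_commute[of l _ w])
next
  show "\<exists>C. \<forall>u\<in>sobolev_space l. \<forall>v\<in>sobolev_space l.
      \<bar>gagliardo_form l u v\<bar> \<le> C * sobolev_norm l u * sobolev_norm l v"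
    using gagliardo_form_bound by blast
next
  fix \<phi> v assume "test_function \<phi>" and v: "v \<in> sobolev_space l"
  then obtain R M L where *: "\<phi> \<in> borel_measurable borel" "0 \<le> R" "\<And>x. \<bar>x\<bar> > R \<Longrightarrow> \<phi> x = 0"
    "\<And>x. \<bar>\<phi> x\<bar> \<le> M" "\<And>x z. \<bar>\<phi> z - \<phi> x\<bar> \<le> L * \<bar>z - x\<bar>"
    using test_function_bounds by metis
  show "gagliardo_form l \<phi> v = (LINT x|lborel. frac_laplacian l \<phi> x * v x)"
    using frac_laplacian_eq_gagliardo_form[OF l *(1,3,2,4,5)] v by (simp add: sobolev_space_iff)
qed

text \<open>Uniqueness of the extension is recorded in the first argument alone, with the second
  ranging over the whole space. The set contains the test functions and is closed under linear
  combinations and Sobolev limits; piecewise polynomials are reached this way.\<close>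

definition determined :: "real \<Rightarrow> (real \<Rightarrow> real) set" where
  "determined l = {u \<in> sobolev_space l. \<forall>G. extends_frac_laplacian l G \<longrightarrow>
     (\<forall>v\<in>sobolev_space l. G u v = gagliardo_form l u v)}"

lemma determined_test_function:
  assumes "0 < l" "l < 1" "test_function \<phi>"
  shows "\<phi> \<in> determined l"
proof -
  have "G \<phi> v = gagliardo_form l \<phi> v"
    if "extends_frac_laplacian l G" "v \<in> sobolev_space l" for G v
    using extends_frac_laplacian_test[OF that(1) assms(3) that(2)]
      extends_frac_laplacian_test[OF gagliardo_form_extends[OF assms(1,2)] assms(3) that(2)]
    by simp
  then show ?thesis
    unfolding determined_def using test_function_sobolev[OF assms] by simp
qed

lemma determined_lincomb:
  assumes "u \<in> determined l" "v \<in> determined l"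
  shows "(\<lambda>x. a * u x + b * v x) \<in> determined l"
proof -
  have uv: "u \<in> sobolev_space l" "v \<in> sobolev_space l" using assms unfolding determined_def by auto
  have "G (\<lambda>x. a * u x + b * v x) w = gagliardo_form l (\<lambda>x. a * u x + b * v x) w"
    if G: "extends_frac_laplacian l G" and w: "w \<in> sobolev_space l" for G w
  proof -
    have "G (\<lambda>x. a * u x + b * v x) w = a * G u w + b * G v w"
      by (rule extends_frac_laplacian_lincomb[OF G uv w])
    also have "\<dots> = a * gagliardo_form l u w + b * gagliardo_form l v w"
      using assms G w unfolding determined_def by simp
    also have "\<dots> = gagliardo_form l (\<lambda>x. a * u x + b * v x) w"
      using gagliardo_form_lincomb_right[OF uv w, of a b]
      by (simp only: gagliardo_form_commute[of l _ w])
    finally show ?thesis .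
  qed
  moreover have "(\<lambda>x. a * u x + b * v x) \<in> sobolev_space l"
    using uv by (intro sobolev_space_add sobolev_space_scale)
  ultimately show ?thesis unfolding determined_def by blast
qed

lemma determined_zero:
  assumes "0 < l" "l < 1" shows "(\<lambda>x. 0) \<in> determined l"
proof -
  have "test_function (\<lambda>x. 0)"
    unfolding test_function_def using smooth_const[of 0] by (simp add: smooth_def)
  then show ?thesis by (rule determined_test_function[OF assms])
qed

lemma determined_sum:
  assumes "0 < l" "l < 1" "\<And>i. i \<in> A \<Longrightarrow> u i \<in> determined l"
  shows "(\<lambda>x. \<Sum>i\<in>A. c i * u i x) \<in> determined l"
  using assms(3)
proof (induction A rule: infinite_finite_induct)
  case (insert j A)
  then have "(\<lambda>x. c j * u j x + 1 * (\<Sum>i\<in>A. c i * u i x)) \<in> determined l"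
    by (intro determined_lincomb) auto
  then show ?case using insert by simp
qed (use determined_zero[OF assms(1,2)] in auto)

text \<open>An extension and the form are both bounded in the first argument and agree on the
  approximants, so their difference at \<open>u\<close> is smaller than every positive
  number.\<close>

lemma determined_closed:
  assumes u: "u \<in> sobolev_space l"
    and approx: "\<And>e. e > 0 \<Longrightarrow> \<exists>w\<in>determined l. sobolev_norm l (\<lambda>x. u x - w x) < e"
  shows "u \<in> determined l"
proof -
  have "G u v = gagliardo_form l u v"
    if G: "extends_frac_laplacian l G" and v: "v \<in> sobolev_space l" for G v
  proof (rule ccontr)
    assume ne: "G u v \<noteq> gagliardo_form l u v"
    obtain C where C: "\<And>u v. u \<in> sobolev_space l \<Longrightarrow> v \<in> sobolev_space l \<Longrightarrow>
        \<bar>G u v\<bar> \<le> C * sobolev_norm l u * sobolev_norm l v"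
      using extends_frac_laplacian_bound[OF G] by blast
    \<comment> \<open>The absolute value guards against a negative \<open>C\<close>, and the added 1
      keeps the divisor positive when \<open>v\<close> has norm 0.\<close>
    define D where "D = (\<bar>C\<bar> + \<bar>frac_const l / 2\<bar>) * sobolev_norm l v + 1"
    have D: "D > 0" unfolding D_def by (intro add_nonneg_pos mult_nonneg_nonneg) auto
    define d where "d = \<bar>G u v - gagliardo_form l u v\<bar>"
    have d: "d > 0" using ne unfolding d_def by simp
    obtain w where w: "w \<in> determined l" "sobolev_norm l (\<lambda>x. u x - w x) < d / D"
      using approx[of "d / D"] d D by auto
    have ws: "w \<in> sobolev_space l" and Gw: "G w v = gagliardo_form l w v"
      using w(1) G v unfolding determined_def by auto
    have uw: "(\<lambda>x. u x - w x) \<in> sobolev_space l" using u ws by (rule sobolev_space_diff)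
    define n where "n = sobolev_norm l (\<lambda>x. u x - w x)"
    have n0: "0 \<le> n" unfolding n_def by simp
    have "G (\<lambda>x. 1 * u x + (-1) * w x) v = 1 * G u v + (-1) * G w v"
      by (rule extends_frac_laplacian_lincomb[OF G u ws v])
    then have g1: "G (\<lambda>x. u x - w x) v = G u v - G w v" by simp
    have g2: "gagliardo_form l (\<lambda>x. u x - w x) v = gagliardo_form l u v - gagliardo_form l w v"
      using gagliardo_form_lincomb_right[OF u ws v, of 1 "-1"]
      by (simp add: gagliardo_form_commute[of l _ v])
    have "d = \<bar>G (\<lambda>x. u x - w x) v - gagliardo_form l (\<lambda>x. u x - w x) v\<bar>"
      unfolding g1 g2 Gw d_def by simp
    also have "\<dots> \<le> \<bar>G (\<lambda>x. u x - w x) v\<bar> + \<bar>gagliardo_form l (\<lambda>x. u x - w x) v\<bar>"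
      by (rule abs_triangle_ineq4)
    also have "\<dots> \<le> C * n * sobolev_norm l v + \<bar>frac_const l / 2\<bar> * n * sobolev_norm l v"
      unfolding n_def using C[OF uw v] gagliardo_form_bound[OF uw v] by (rule add_mono)
    also have "\<dots> \<le> \<bar>C\<bar> * n * sobolev_norm l v + \<bar>frac_const l / 2\<bar> * n * sobolev_norm l v"
      using n0 by (intro add_right_mono mult_right_mono) auto
    also have "\<dots> \<le> n * D" unfolding D_def using n0 by (simp add: algebra_simps)
    also have "\<dots> < d" using w(2) D unfolding n_def by (simp add: pos_less_divide_eq)
    finally show False by simp
  qed
  then show ?thesis using u unfolding determined_def by blast
qed

lemma frac_laplacian_pairing_eq:
  assumes l: "0 < l" "l < 1" and u: "u \<in> determined l" and v: "v \<in> sobolev_space l"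
  shows "frac_laplacian_pairing l u v = gagliardo_form l u v"
  unfolding frac_laplacian_pairing_def
proof (rule the_equality)
  show "\<exists>G. extends_frac_laplacian l G \<and> G u v = gagliardo_form l u v"
    using gagliardo_form_extends[OF l] by blast
  show "r = gagliardo_form l u v" if "\<exists>G. extends_frac_laplacian l G \<and> G u v = r" for r
    using that u v unfolding determined_def by blast
qed

lemma determined_indicator_poly:
  assumes l: "0 < l" "l < 1" and ab: "a < b"
  shows "(\<lambda>x. if x \<in> {a<..<b} then poly p x else 0) \<in> determined l"
proof (rule determined_closed)
  fix e :: real assume "e > 0"
  then obtain \<phi> where "test_function \<phi>"
    "sobolev_norm l (\<lambda>x. (if x \<in> {a<..<b} then poly p x else 0) - \<phi> x) < e"
    using indicator_poly_approx[OF l ab] by metis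
  then show "\<exists>w\<in>determined l. sobolev_norm l (\<lambda>x. (if x \<in> {a<..<b} then poly p x else 0) - w x) < e"
    using determined_test_function[OF l] by blast
qed (rule sobolev_indicator_poly[OF l ab])

section \<open>Legendre polynomials\<close>

text \<open>The value of the cofactor at the root is tracked along: each derivative lowers the power
  by one and multiplies that value by the current exponent. For \<open>j < n\<close> this shows
  vanishing at \<open>a\<close>, for \<open>j = n\<close> it computes the value there.\<close>

lemma pderiv_funpow_root_power:
  fixes Q :: "real poly"
  assumes "j \<le> n"
  shows "\<exists>R. (pderiv ^^ j) ([:-a, 1:] ^ n * Q) = [:-a, 1:] ^ (n - j) * R \<and>
    poly R a = fact n / fact (n - j) * poly Q a"
  using assms
proof (induction j)
  case 0
  then show ?case by auto
next
  case (Suc j)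
  then obtain R where R: "(pderiv ^^ j) ([:-a, 1:] ^ n * Q) = [:-a, 1:] ^ (n - j) * R"
    "poly R a = fact n / fact (n - j) * poly Q a" by auto
  define m where "m = n - Suc j"
  have nj: "n - j = Suc m" using Suc.prems unfolding m_def by simp
  have "(pderiv ^^ Suc j) ([:-a, 1:] ^ n * Q) = pderiv ([:-a, 1:] ^ Suc m * R)"
    using R(1) nj by simp
  also have "\<dots> = [:-a, 1:] ^ m * (smult (of_nat (Suc m)) R + [:-a, 1:] * pderiv R)"
    unfolding pderiv_mult pderiv_power_Suc
    by (simp add: pderiv_pCons algebra_simps)
  finally have "(pderiv ^^ Suc j) ([:-a, 1:] ^ n * Q)
      = [:-a, 1:] ^ m * (smult (of_nat (Suc m)) R + [:-a, 1:] * pderiv R)" .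
  moreover have "poly (smult (of_nat (Suc m)) R + [:-a, 1:] * pderiv R) a = fact n / fact m * poly Q a"
  proof -
    define k where "k = real (Suc m)"
    have "fact (n - j) = k * fact m" unfolding nj k_def by simp
    moreover have "k \<noteq> 0" unfolding k_def by simp
    ultimately have "k * poly R a = fact n / fact m * poly Q a" using R(2) by (simp add: field_simps)
    then show ?thesis by (simp add: k_def algebra_simps)
  qed
  ultimately show ?case unfolding m_def by blast
qed

definition rodrigues :: "nat \<Rightarrow> real poly" where "rodrigues n = [:-1, 0, 1:] ^ n"

text \<open>\<open>[:-(-1), 1:]\<close> is kept unsimplified so that the root lemma applies with a =
  -1.\<close>

lemma rodrigues_factor:
  "rodrigues n = [:-1, 1:] ^ n * [:1, 1:] ^ n" "rodrigues n = [:-(-1), 1:] ^ n * [:-1, 1:] ^ n"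
  unfolding rodrigues_def by (simp_all flip: power_mult_distrib)

lemma legendre_altdef: "legendre n = smult (1 / (2 ^ n * fact n)) ((pderiv ^^ n) (rodrigues n))"
  unfolding legendre_def rodrigues_def ..

lemma rodrigues_deriv_at_ends:
  assumes "j < n"
  shows "poly ((pderiv ^^ j) (rodrigues n)) 1 = 0" "poly ((pderiv ^^ j) (rodrigues n)) (-1) = 0"
proof -
  obtain R where "(pderiv ^^ j) (rodrigues n) = [:-1, 1:] ^ (n - j) * R"
    using pderiv_funpow_root_power[of j n 1 "[:1, 1:] ^ n"] assms rodrigues_factor(1) by auto
  then show "poly ((pderiv ^^ j) (rodrigues n)) 1 = 0" using assms by simp
  obtain R where "(pderiv ^^ j) (rodrigues n) = [:-(-1), 1:] ^ (n - j) * R"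
    using pderiv_funpow_root_power[of j n "-1" "[:-1, 1:] ^ n"] assms rodrigues_factor(2) by (metis less_imp_le)
  then show "poly ((pderiv ^^ j) (rodrigues n)) (-1) = 0" using assms by simp
qed

text \<open>All \<open>n\<close> derivatives fall on the vanishing factor, giving n! 2^n, which the
  normalisation cancels.\<close>

lemma legendre_at_1 [simp]: "poly (legendre n) 1 = 1"
proof -
  obtain R where "(pderiv ^^ n) (rodrigues n) = [:-1, 1:] ^ (n - n) * R"
    "poly R 1 = fact n / fact (n - n) * poly ([:1, 1:] ^ n) 1"
    using pderiv_funpow_root_power[of n n 1 "[:1, 1:] ^ n"] rodrigues_factor(1) by auto
  then show ?thesis unfolding legendre_altdef by (simp add: poly_power)
qed

lemma legendre_at_minus_1 [simp]: "poly (legendre n) (-1) = (-1) ^ n"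
proof -
  obtain R where "(pderiv ^^ n) (rodrigues n) = [:-(-1), 1:] ^ (n - n) * R"
    "poly R (-1) = fact n / fact (n - n) * poly ([:-1, 1:] ^ n) (-1)"
    using pderiv_funpow_root_power[of n n "-1" "[:-1, 1:] ^ n"] rodrigues_factor(2)
    by (metis order_refl)
  moreover have "(-2::real) ^ n = (-1) ^ n * 2 ^ n" by (simp flip: power_mult_distrib)
  ultimately show ?thesis unfolding legendre_altdef by (simp add: poly_power)
qed

definition poly_integral :: "real poly \<Rightarrow> real" where
  "poly_integral p = integral {-1..1} (poly p)"

lemma poly_integrable_on: "poly p integrable_on {a..b :: real}"
  by (intro integrable_continuous_interval continuous_intros)

lemma poly_integral_add: "poly_integral (p + q) = poly_integral p + poly_integral q"
  unfolding poly_integral_def poly_add by (rule integral_add) (rule poly_integrable_on)+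

lemma poly_integral_smult: "poly_integral (smult c p) = c * poly_integral p"
  unfolding poly_integral_def poly_smult by simp

lemma poly_integral_0 [simp]: "poly_integral 0 = 0"
  using poly_integral_smult[of 0 0] by simp

lemma poly_integral_pderiv: "poly_integral (pderiv p) = poly p 1 - poly p (-1)"
proof -
  have "(poly (pderiv p) has_integral poly p 1 - poly p (-1)) {-1..1}"
    by (rule fundamental_theorem_of_calculus)
       (auto simp flip: has_real_derivative_iff_has_vector_derivative
         intro: poly_DERIV[THEN DERIV_subset])
  then show ?thesis unfolding poly_integral_def by (rule integral_unique)
qed

text \<open>Moving derivatives to the second factor leaves no boundary terms, because the
  derivatives of (x^2 - 1)^n of order below \<open>n\<close> vanish at both ends. With
  \<open>j = n\<close> and a factor of degree below \<open>n\<close> this is orthogonality.\<close>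

lemma poly_integral_rodrigues_by_parts:
  assumes "j \<le> n"
  shows "poly_integral ((pderiv ^^ n) (rodrigues n) * Q)
    = (-1) ^ j * poly_integral ((pderiv ^^ (n - j)) (rodrigues n) * (pderiv ^^ j) Q)"
  using assms
proof (induction j)
  case (Suc j)
  define m where "m = n - Suc j"
  have m: "n - j = Suc m" "m < n" using Suc.prems unfolding m_def by simp_all
  define A where "A = (pderiv ^^ m) (rodrigues n)"
  define B where "B = (pderiv ^^ j) Q"
  have "poly_integral (pderiv (A * B)) = 0"
    unfolding poly_integral_pderiv using rodrigues_deriv_at_ends[OF m(2)] by (simp add: A_def)
  then have "poly_integral (pderiv A * B) = - poly_integral (A * pderiv B)"
    unfolding pderiv_mult poly_integral_add by (simp add: mult.commute)
  then show ?case using Suc m unfolding A_def B_def by (simp flip: m_def)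
qed simp

lemma pderiv_funpow_eq_0:
  assumes "degree (q :: real poly) < n" shows "(pderiv ^^ n) q = 0"
  using assms
proof (induction n arbitrary: q)
  case (Suc n)
  show ?case
  proof (cases "degree q = 0")
    case True
    then have "pderiv q = 0" by (simp add: pderiv_eq_0_iff)
    moreover have "(pderiv ^^ n) 0 = (0 :: real poly)" by (induction n) auto
    ultimately show ?thesis by (simp add: funpow_Suc_right del: funpow.simps)
  next
    case False
    then have "degree (pderiv q) < n" using Suc.prems by (simp add: degree_pderiv)
    then show ?thesis using Suc.IH by (simp add: funpow_Suc_right del: funpow.simps)
  qed
qed simp

lemma legendre_orthogonal_lower_degree:
  assumes "degree q < n"
  shows "poly_integral (legendre n * q) = 0"
  using poly_integral_rodrigues_by_parts[of n n q] pderiv_funpow_eq_0[OF assms]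
  unfolding legendre_altdef by (simp add: poly_integral_smult)

lemma degree_legendre: "degree (legendre n) \<le> n"
proof -
  have "degree ((pderiv ^^ j) p) \<le> degree p - j" for j and p :: "real poly"
    by (induction j) (auto simp: degree_pderiv)
  moreover have "degree (rodrigues n) \<le> 2 * n"
    unfolding rodrigues_def using degree_power_le[of "[:-1, 0, 1:] :: real poly" n] by simp
  ultimately have "degree ((pderiv ^^ n) (rodrigues n)) \<le> n"
    by (metis add_diff_cancel_right' diff_le_mono le_trans mult_2)
  then show ?thesis unfolding legendre_altdef by simp
qed

text \<open>The normalisation follows from integrating the derivative of \<open>x (P\<^sub>n)\<^sup>2\<close>, since
  \<open>x P\<^sub>n' - n P\<^sub>n\<close> has degree less than \<open>n\<close>.\<close>

lemma legendre_norm: "poly_integral (legendre n * legendre n) = 2 / (2 * real n + 1)"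
proof -
  define P where "P = legendre n"
  define q where "q = pCons 0 (pderiv P) - smult (of_nat n) P"
  have "degree q < n \<or> q = 0"
  proof (cases "n = 0")
    case True
    then have "degree P = 0" using degree_legendre[of n] unfolding P_def by simp
    then have "pderiv P = 0" by (simp add: pderiv_eq_0_iff)
    then show ?thesis using True unfolding q_def by simp
  next
    case False
    have "coeff q i = 0" if "i \<ge> n" for i
    proof (cases "i = n")
      \<comment> \<open>The top coefficients cancel: x P' and n P both carry \<open>n\<close> times
        the coefficient of degree \<open>n\<close>.\<close>
      case True
      then show ?thesis using False unfolding q_def by (cases n) (auto simp: coeff_pderiv)
    next
      case False
      then have "coeff P i = 0" using that degree_legendre[of n] unfolding P_def
        by (intro coeff_eq_0) auto
      then show ?thesis unfolding q_def by (cases i) (auto simp: coeff_pderiv)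
    qed
    then show ?thesis using False
      by (metis leading_coeff_0_iff linorder_not_le)
  qed
  then have q: "poly_integral (P * q) = 0"
    using legendre_orthogonal_lower_degree[of q n] unfolding P_def
    by auto
  have "P * pCons 0 (pderiv P) = P * q + smult (of_nat n) (P * P)"
    unfolding q_def by (simp add: algebra_simps)
  then have x: "poly_integral (P * pCons 0 (pderiv P)) = n * poly_integral (P * P)"
    by (simp add: poly_integral_add q poly_integral_smult)
  have pd: "pderiv (pCons 0 (P * P)) = P * P + smult 2 (P * pCons 0 (pderiv P))"
  proof -
    have "smult 2 X = X + X" for X :: "real poly" using smult_add_left[of 1 1 X] by simp
    then show ?thesis by (simp add: pderiv_pCons pderiv_mult algebra_simps)
  qed
  have "poly_integral (pderiv (pCons 0 (P * P)))
      = poly_integral (P * P) + 2 * (n * poly_integral (P * P))"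
    unfolding pd poly_integral_add poly_integral_smult x ..
  \<comment> \<open>The boundary values of x P^2 are 1 and -1.\<close>
  moreover have "poly_integral (pderiv (pCons 0 (P * P))) = 2"
    unfolding poly_integral_pderiv P_def by (simp flip: power_mult_distrib)
  ultimately show ?thesis unfolding P_def by (simp add: field_simps)
qed

lemma legendre_orthogonal:
  "poly_integral (legendre p * legendre q) = (if p = q then 2 / (2 * real p + 1) else 0)"
proof (cases p q rule: linorder_cases)
  case less
  then show ?thesis using legendre_orthogonal_lower_degree[of "legendre p" q] degree_legendre[of p]
    by (simp add: mult.commute)
next
  case greater
  then show ?thesis using legendre_orthogonal_lower_degree[of "legendre q" p] degree_legendre[of q]
    by simp
qed (simp add: legendre_norm)

section \<open>Discontinuous Galerkin functions\<close>

text \<open>Unlike \<open>dg_basis\<close> this is a polynomial on the whole line, so one-sided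
  limits at the ends of a cell become plain values and derivatives become
  \<open>pderiv\<close>.\<close>

definition cell_poly :: "real \<Rightarrow> nat \<Rightarrow> int \<Rightarrow> real poly" where
  "cell_poly dx p i = pcompose (legendre p) [:- 2 * grid_point dx i / dx - 1, 2 / dx:]"

text \<open>Truncation acts on coefficients, over the 2n cells -n, ..., n-1 that fill (-n dx, n dx)
  up to grid points. The truncated function and the remainder are thus both of the form
  \<open>dg_function\<close>, to which the inverse estimate applies.\<close>

definition truncate_coeffs :: "nat \<Rightarrow> (nat \<Rightarrow> int \<Rightarrow> real) \<Rightarrow> nat \<Rightarrow> int \<Rightarrow> real" where
  "truncate_coeffs n c p i = (if i \<in> {- int n..<int n} then c p i else 0)"

definition cell_function :: "nat \<Rightarrow> real \<Rightarrow> (nat \<Rightarrow> int \<Rightarrow> real) \<Rightarrow> int \<Rightarrow> real \<Rightarrow> real" where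
  "cell_function k dx c i x = (\<Sum>p\<le>k. c p i * dg_basis dx p i x)"

lemma dg_basis_eq:
  "dg_basis dx p i = (\<lambda>x. if x \<in> {grid_point dx i<..<grid_point dx (i + 1)} then poly (cell_poly dx p i) x else 0)"
  unfolding dg_basis_def cell_def cell_poly_def
  by (auto simp: fun_eq_iff poly_pcompose diff_divide_distrib algebra_simps)

context
  fixes dx :: real and k :: nat
  assumes dx: "0 < dx"
begin

lemma grid_point_Suc: "grid_point dx (i + 1) = grid_point dx i + dx"
  unfolding grid_point_def by (simp add: algebra_simps)

lemma grid_point_less: "grid_point dx i < grid_point dx (i + 1)"
  unfolding grid_point_Suc using dx by simp

lemma cell_disjoint:
  assumes "x \<in> cell dx i" "x \<in> cell dx j"
  shows "i = j"
proof -
  have "real_of_int i * dx < real_of_int (j + 1) * dx" "real_of_int j * dx < real_of_int (i + 1) * dx"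
    using assms unfolding cell_def grid_point_def by auto
  then have "real_of_int i < real_of_int (j + 1)" "real_of_int j < real_of_int (i + 1)"
    using dx mult_less_cancel_right_pos by blast+
  then show ?thesis by linarith
qed

lemma cell_function_outside: "x \<notin> cell dx i \<Longrightarrow> cell_function k dx c i x = 0"
  unfolding cell_function_def dg_basis_def by simp

text \<open>The infinite sum collapses to any finite index set containing the cells that matter: a
  single cell, no cell, the truncation window, or the cells of two points at once.\<close>

lemma dg_function_sum:
  assumes "finite A" "\<And>i. x \<in> cell dx i \<Longrightarrow> i \<notin> A \<Longrightarrow> cell_function k dx c i x = 0"
  shows "dg_function k dx c x = (\<Sum>i\<in>A. cell_function k dx c i x)"
proof -
  have "dg_function k dx c x = (\<Sum>\<^sub>\<infinity>i\<in>A. cell_function k dx c i x)"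
    unfolding dg_function_def
    by (rule infsum_cong_neutral) (use assms cell_function_outside in \<open>auto simp: cell_function_def\<close>)
  then show ?thesis using assms(1) by simp
qed

lemma finite_cells: "finite {i. x \<in> cell dx i}"
  using cell_disjoint by (metis (mono_tags) finite.emptyI finite_insert mem_Collect_eq
      finite_subset insertI1 subsetI ex_in_conv)

lemma dg_function_cell: "x \<in> cell dx i \<Longrightarrow> dg_function k dx c x = cell_function k dx c i x"
  using dg_function_sum[of "{i}" x c] cell_disjoint by auto

text \<open>The cells are open, so this is the value at the grid points.\<close>

lemma dg_function_outside: "(\<And>i. x \<notin> cell dx i) \<Longrightarrow> dg_function k dx c x = 0"
  using dg_function_sum[of "{}" x c] by auto

lemma dg_function_linear:
  "dg_function k dx (\<lambda>p i. a * c p i + b * d p i) x = a * dg_function k dx c x + b * dg_function k dx d x"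
proof (cases "\<exists>i. x \<in> cell dx i")
  case True
  then obtain i where "x \<in> cell dx i" by blast
  then show ?thesis
    by (simp add: dg_function_cell cell_function_def sum.distrib sum_distrib_left algebra_simps)
qed (simp add: dg_function_outside)

lemma dg_function_truncate:
  "dg_function k dx (truncate_coeffs n c) x = (\<Sum>i\<in>{- int n..<int n}. cell_function k dx c i x)"
proof -
  have "dg_function k dx (truncate_coeffs n c) x
      = (\<Sum>i\<in>{- int n..<int n}. cell_function k dx (truncate_coeffs n c) i x)"
    by (rule dg_function_sum) (auto simp: cell_function_def truncate_coeffs_def)
  also have "\<dots> = (\<Sum>i\<in>{- int n..<int n}. cell_function k dx c i x)"
    by (rule sum.cong) (auto simp: cell_function_def truncate_coeffs_def)
  finally show ?thesis .
qed

lemma dg_function_diff_truncate: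
  "dg_function k dx c x - dg_function k dx (truncate_coeffs n c) x
    = dg_function k dx (\<lambda>p i. c p i - truncate_coeffs n c p i) x"
  using dg_function_linear[of 1 c "-1" "truncate_coeffs n c" x] by simp

lemma dg_function_truncate_cell:
  assumes "x \<in> cell dx i"
  shows "dg_function k dx (truncate_coeffs n c) x
    = (if i \<in> {- int n..<int n} then dg_function k dx c x else 0)"
  unfolding dg_function_cell[OF assms] by (auto simp: cell_function_def truncate_coeffs_def)

lemma dg_function_truncate_tendsto:
  "(\<lambda>n. dg_function k dx (truncate_coeffs n c) x) \<longlonglongrightarrow> dg_function k dx c x"
proof (cases "\<exists>i. x \<in> cell dx i")
  case True
  then obtain i where i: "x \<in> cell dx i" by blast
  have "\<forall>\<^sub>F n in sequentially. dg_function k dx (truncate_coeffs n c) x = dg_function k dx c x"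
    unfolding dg_function_truncate_cell[OF i]
    by (rule eventually_mono[OF eventually_gt_at_top[of "nat \<bar>i\<bar>"]]) auto
  then show ?thesis by (rule tendsto_eventually)
qed (simp add: dg_function_outside)

lemma borel_measurable_dg_basis [measurable]: "dg_basis dx p i \<in> borel_measurable borel"
proof -
  have [measurable]: "poly (cell_poly dx p i) \<in> borel_measurable borel"
    by (intro borel_measurable_continuous_onI continuous_intros)
  show ?thesis unfolding dg_basis_eq by measurable
qed

lemma borel_measurable_cell_function [measurable]: "cell_function k dx c i \<in> borel_measurable borel"
  unfolding cell_function_def[abs_def] by measurable

text \<open>Measurability of the infinite sum comes from the truncations, which are finite sums and
  converge pointwise.\<close>

lemma borel_measurable_dg_function [measurable]: "dg_function k dx c \<in> borel_measurable borel"
proof (rule borel_measurable_LIMSEQ_real[OF dg_function_truncate_tendsto])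
  show "dg_function k dx (truncate_coeffs n c) \<in> borel_measurable borel" for n
    unfolding dg_function_truncate[abs_def] by measurable
qed

section \<open>Regularity and orthogonality of the basis\<close>

lemma
  assumes l: "0 < l" "l < 1"
  shows dg_basis_sobolev: "dg_basis dx p i \<in> sobolev_space l"
    and dg_basis_determined: "dg_basis dx p i \<in> determined l"
  unfolding dg_basis_eq
  using sobolev_indicator_poly[OF l grid_point_less] determined_indicator_poly[OF l grid_point_less]
  by auto

lemma dg_basis_square_integrable [simp]: "square_integrable lborel (dg_basis dx p i)"
  \<comment> \<open>The order 1/2 is an arbitrary admissible one; membership is used for its L^2
    part.\<close>
  using dg_basis_sobolev[of "1/2"] by (simp add: sobolev_space_iff)

lemma cell_function_square_integrable [simp]: "square_integrable lborel (cell_function k dx c i)"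
  unfolding cell_function_def[abs_def]
  by (intro square_integrable_sum square_integrable_scale dg_basis_square_integrable)

lemma dg_basis_inner:
  "l2_inner lborel (dg_basis dx p i) (dg_basis dx q j) =
    (if p = q \<and> i = j then dx / (2 * real p + 1) else 0)"
proof (cases "i = j")
  case False
  have "(\<lambda>x. dg_basis dx p i x * dg_basis dx q j x) = (\<lambda>x. 0)"
    using cell_disjoint[of _ i j] False unfolding dg_basis_def by (auto simp: fun_eq_iff)
  then show ?thesis using False unfolding l2_inner_def by simp
next
  case True
  define R where "R = legendre p * legendre q"
  have "l2_inner lborel (dg_basis dx p i) (dg_basis dx q j)
      = (LINT x|lborel. indicator (cell dx i) x * poly R (2 * (x - grid_point dx i) / dx - 1))"
    unfolding l2_inner_def True R_def dg_basis_def
    by (rule Bochner_Integration.integral_cong) (auto simp: indicator_def)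
  \<comment> \<open>The reference map y -> centre + (dx/2) y sends (-1, 1) to the cell and has
    Jacobian dx/2.\<close>
  also have "\<dots> = (dx / 2) * (LINT y|lborel. indicator (cell dx i) (grid_point dx i + dx / 2 + dx / 2 * y)
      * poly R (2 * (grid_point dx i + dx / 2 + dx / 2 * y - grid_point dx i) / dx - 1))"
    using dx by (subst lborel_integral_real_affine[where c = "dx / 2" and t = "grid_point dx i + dx / 2"]) auto
  also have "\<dots> = (dx / 2) * (LINT y|lborel. indicator {-1<..<1} y * poly R y)"
  proof -
    have "grid_point dx i + dx / 2 + dx / 2 * y \<in> cell dx i \<longleftrightarrow> y \<in> {-1<..<1}" for y
    proof -
      have 1: "grid_point dx i + dx / 2 + dx / 2 * y - grid_point dx i = dx / 2 * (1 + y)"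
        "grid_point dx i + dx - (grid_point dx i + dx / 2 + dx / 2 * y) = dx / 2 * (1 - y)"
        by (simp_all add: field_simps)
      have "grid_point dx i + dx / 2 + dx / 2 * y \<in> cell dx i
          \<longleftrightarrow> 0 < dx / 2 * (1 + y) \<and> 0 < dx / 2 * (1 - y)"
        unfolding 1[symmetric] cell_def grid_point_Suc
        by (simp only: greaterThanLessThan_iff diff_gt_0_iff_gt)
      then show ?thesis using dx by (simp only: zero_less_mult_iff) auto
    qed
    moreover have "2 * (grid_point dx i + dx / 2 + dx / 2 * y - grid_point dx i) / dx - 1 = y" for y
      using dx by (simp add: field_simps)
    ultimately show ?thesis by (simp add: indicator_def)
  qed
  also have "(LINT y|lborel. indicator {-1<..<1} y * poly R y)
      = (LINT y|lborel. indicator {-1..1} y * poly R y)"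
  proof (rule integral_cong_AE)
    have [measurable]: "poly R \<in> borel_measurable borel"
      by (intro borel_measurable_continuous_onI continuous_intros)
    show "(\<lambda>y. indicator {-1<..<1} y * poly R y) \<in> borel_measurable lborel"
      "(\<lambda>y. indicator {-1..1} y * poly R y) \<in> borel_measurable lborel" by measurable
    have "AE y in lborel. y \<noteq> -1 \<and> y \<noteq> (1::real)"
      using AE_lborel_singleton[of "-1::real"] AE_lborel_singleton[of "1::real"] by auto
    then show "AE y in lborel. indicator {-1<..<1} y * poly R y = indicator {-1..1} y * poly R y"
      by eventually_elim (auto simp: indicator_def)
  qed
  also have "\<dots> = poly_integral R"
  proof -
    have "set_integrable lborel {-1..1} (poly R)"
      by (rule borel_integrable_atLeastAtMost') (intro continuous_intros)
    from set_borel_integral_eq_integral(2)[OF this]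
    show ?thesis unfolding poly_integral_def set_lebesgue_integral_def by simp
  qed
  also have "dx / 2 * poly_integral R = (if p = q \<and> i = j then dx / (2 * real p + 1) else 0)"
    unfolding R_def legendre_orthogonal using True by simp
  finally show ?thesis .
qed

lemma cell_function_inner:
  assumes "q \<le> k"
  shows "l2_inner lborel (cell_function k dx c i) (dg_basis dx q j)
    = (if i = j then c q i * dx / (2 * real q + 1) else 0)"
proof -
  have "l2_inner lborel (cell_function k dx c i) (dg_basis dx q j)
      = (\<Sum>p\<le>k. c p i * l2_inner lborel (dg_basis dx q j) (dg_basis dx p i))"
    unfolding cell_function_def[abs_def]
    by (subst l2_inner_commute, subst l2_inner_sum_right)
       (auto simp: square_integrable_scale l2_inner_scale_right)
  also have "\<dots> = (\<Sum>p\<le>k. if p = q then (if i = j then c q i * dx / (2 * real q + 1) else 0) else 0)"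
    by (rule sum.cong) (auto simp: dg_basis_inner)
  also have "\<dots> = (if i = j then c q i * dx / (2 * real q + 1) else 0)"
    using assms by (subst sum.delta) auto
  finally show ?thesis .
qed

text \<open>The product with a basis function sees a single cell, so the coefficient can be read off
  whatever the other coefficients are.\<close>

lemma dg_function_inner:
  assumes "q \<le> k"
  shows "l2_inner lborel (dg_function k dx c) (dg_basis dx q i) = c q i * dx / (2 * real q + 1)"
proof -
  have "dg_function k dx c x * dg_basis dx q i x = cell_function k dx c i x * dg_basis dx q i x" for x
    by (cases "x \<in> cell dx i") (auto simp: dg_function_cell dg_basis_def)
  then have "l2_inner lborel (dg_function k dx c) (dg_basis dx q i)
      = l2_inner lborel (cell_function k dx c i) (dg_basis dx q i)"
    unfolding l2_inner_def by (intro Bochner_Integration.integral_cong refl)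
  then show ?thesis using cell_function_inner[OF assms] by simp
qed

lemma cell_function_norm_sq:
  "(l2_norm lborel (cell_function k dx c i))\<^sup>2 = (\<Sum>p\<le>k. (c p i)\<^sup>2 * dx / (2 * real p + 1))"
proof -
  have "l2_inner lborel (cell_function k dx c i) (cell_function k dx c i)
      = (\<Sum>p\<le>k. c p i * l2_inner lborel (cell_function k dx c i) (dg_basis dx p i))"
    by (subst (2) cell_function_def[abs_def], subst l2_inner_sum_right)
       (auto simp: square_integrable_scale l2_inner_scale_right)
  also have "\<dots> = (\<Sum>p\<le>k. (c p i)\<^sup>2 * dx / (2 * real p + 1))"
    by (rule sum.cong) (auto simp: cell_function_inner power2_eq_square)
  finally show ?thesis by (simp add: l2_norm_sq)
qed

text \<open>Parseval's identity with values in [0, \<infinity>]: at each point at most one cell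
  contributes, and sum and integral commute for nonnegative terms.\<close>

lemma nn_integral_dg_function_sq:
  "(\<integral>\<^sup>+x. ennreal ((dg_function k dx c x)\<^sup>2) \<partial>lborel)
    = (\<integral>\<^sup>+i. ennreal (\<Sum>p\<le>k. (c p i)\<^sup>2 * dx / (2 * real p + 1)) \<partial>count_space UNIV)"
proof -
  have "ennreal ((dg_function k dx c x)\<^sup>2)
      = (\<integral>\<^sup>+i. ennreal ((cell_function k dx c i x)\<^sup>2) \<partial>count_space UNIV)" for x
  proof (cases "\<exists>i. x \<in> cell dx i")
    case True
    then obtain i where i: "x \<in> cell dx i" by blast
    have "(\<integral>\<^sup>+i. ennreal ((cell_function k dx c i x)\<^sup>2) \<partial>count_space UNIV)
        = (\<Sum>i\<in>{i}. ennreal ((cell_function k dx c i x)\<^sup>2))"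
      by (rule nn_integral_count_space')
         (use i cell_disjoint cell_function_outside in \<open>auto, metis\<close>)
    then show ?thesis using i by (simp add: dg_function_cell)
  next
    case False
    then show ?thesis by (simp add: dg_function_outside cell_function_outside)
  qed
  then have "(\<integral>\<^sup>+x. ennreal ((dg_function k dx c x)\<^sup>2) \<partial>lborel)
    = (\<integral>\<^sup>+x. \<integral>\<^sup>+i. ennreal ((cell_function k dx c i x)\<^sup>2) \<partial>count_space UNIV \<partial>lborel)" by simp
  also have "\<dots> = (\<integral>\<^sup>+i. \<integral>\<^sup>+x. ennreal ((cell_function k dx c i x)\<^sup>2) \<partial>lborel \<partial>count_space UNIV)"
    by (rule nn_integral_count_space_nn_integral) auto
  also have "\<dots> = (\<integral>\<^sup>+i. ennreal (\<Sum>p\<le>k. (c p i)\<^sup>2 * dx / (2 * real p + 1)) \<partial>count_space UNIV)"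
    by (simp add: nn_integral_square cell_function_norm_sq)
  finally show ?thesis .
qed

text \<open>All cells have the same length, so one constant serves every \<open>i\<close>; the
  factor 2 / dx in the Lipschitz constant comes from the reference map.\<close>

lemma dg_basis_gagliardo_bound:
  assumes l: "0 < l" "l < 1"
  shows "\<exists>C\<ge>0. \<forall>p\<le>k. \<forall>i. (\<integral>\<^sup>+z. ennreal (gagliardo_integrand l (dg_basis dx p i) z)
    \<partial>(lborel \<Otimes>\<^sub>M lborel)) \<le> ennreal C"
proof -
  have "\<exists>C\<ge>0. \<forall>i. (\<integral>\<^sup>+z. ennreal (gagliardo_integrand l (dg_basis dx p i) z)
    \<partial>(lborel \<Otimes>\<^sub>M lborel)) \<le> ennreal C" for p
  proof -
    obtain M L where *: "0 \<le> M" "\<And>x. x \<in> {-1..1} \<Longrightarrow> \<bar>poly (legendre p) x\<bar> \<le> M"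
      "\<And>x z. x \<in> {-1..1} \<Longrightarrow> z \<in> {-1..1} \<Longrightarrow> \<bar>poly (legendre p) z - poly (legendre p) x\<bar> \<le> L * \<bar>z - x\<bar>"
      using poly_bounds_on_interval by metis
    define C where "C = ((L * (2 / dx))\<^sup>2 * dx\<^sup>2 + 2 * M\<^sup>2) * (2 * dx powr (1 - l) / (l * (1 - l)))"
    have C0: "0 \<le> C" unfolding C_def using l by (intro mult_nonneg_nonneg divide_nonneg_pos) auto
    have "(\<integral>\<^sup>+z. ennreal (gagliardo_integrand l (dg_basis dx p i) z) \<partial>(lborel \<Otimes>\<^sub>M lborel)) \<le> ennreal C" for i
    proof -
      have in_ref: "2 * (x - grid_point dx i) / dx - 1 \<in> {-1..1}"
        if "x \<in> {grid_point dx i<..<grid_point dx (i + 1)}" for x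
        using that dx unfolding grid_point_Suc by (auto simp: field_simps)
      have "(\<integral>\<^sup>+z. ennreal (gagliardo_integrand l (dg_basis dx p i) z) \<partial>(lborel \<Otimes>\<^sub>M lborel))
        \<le> ennreal (((L * (2 / dx))\<^sup>2 * (grid_point dx (i + 1) - grid_point dx i)\<^sup>2 + 2 * M\<^sup>2) *
           (2 * (grid_point dx (i + 1) - grid_point dx i) powr (1 - l) / (l * (1 - l))))"
      proof (rule nn_integral_gagliardo_le[OF l grid_point_less])
        show "dg_basis dx p i x = 0" if "x \<notin> {grid_point dx i<..<grid_point dx (i + 1)}" for x
          using that unfolding dg_basis_def cell_def by auto
        show "\<bar>dg_basis dx p i x\<bar> \<le> M" for x
          using *(1) *(2)[OF in_ref, of x] unfolding dg_basis_def cell_def by auto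
        show "\<bar>dg_basis dx p i z - dg_basis dx p i x\<bar> \<le> L * (2 / dx) * \<bar>z - x\<bar>"
          if xz: "x \<in> {grid_point dx i<..<grid_point dx (i + 1)}"
            "z \<in> {grid_point dx i<..<grid_point dx (i + 1)}" for x z
        proof -
          have "(2 * (z - grid_point dx i) / dx - 1) - (2 * (x - grid_point dx i) / dx - 1) = (2 / dx) * (z - x)"
            using dx by (simp add: field_simps)
          then have "\<bar>(2 * (z - grid_point dx i) / dx - 1) - (2 * (x - grid_point dx i) / dx - 1)\<bar>
              = \<bar>2 / dx\<bar> * \<bar>z - x\<bar>" by (simp only: abs_mult)
          moreover have "\<bar>2 / dx\<bar> = 2 / dx" using dx by simp
          ultimately have "\<bar>(2 * (z - grid_point dx i) / dx - 1) - (2 * (x - grid_point dx i) / dx - 1)\<bar>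
              = (2 / dx) * \<bar>z - x\<bar>" by (simp only:)
          then show ?thesis using *(3)[OF in_ref[OF xz(1)] in_ref[OF xz(2)]] xz
            unfolding dg_basis_def cell_def by simp
        qed
      qed (rule borel_measurable_dg_basis)
      then show ?thesis unfolding C_def grid_point_Suc by simp
    qed
    then show ?thesis using C0 by blast
  qed
  then obtain C where C: "\<And>p. 0 \<le> C p" "\<And>p i. (\<integral>\<^sup>+z. ennreal (gagliardo_integrand l (dg_basis dx p i) z)
    \<partial>(lborel \<Otimes>\<^sub>M lborel)) \<le> ennreal (C p)" by metis
  have "C p \<le> (\<Sum>p\<le>k. C p)" if "p \<le> k" for p
    by (rule member_le_sum) (use that C in auto)
  then show ?thesis using C
    by (intro exI[of _ "\<Sum>p\<le>k. C p"]) (auto intro: sum_nonneg, meson order_trans ennreal_leI)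
qed

text \<open>For a fixed pair of points, the at most two cells containing them are the ones that
  contribute. Cauchy-Schwarz over these cells gives the factor 2 and over the degrees the factor k +
  1, uniformly in the number of occupied cells although the kernel couples distant ones.\<close>

lemma gagliardo_dg_function_le:
  fixes c :: "nat \<Rightarrow> int \<Rightarrow> real"
  shows "ennreal (gagliardo_integrand l (dg_function k dx c) y)
    \<le> (\<integral>\<^sup>+i. ennreal (\<Sum>p\<le>k. 2 * (real k + 1) * (c p i)\<^sup>2 * gagliardo_integrand l (dg_basis dx p i) y)
        \<partial>count_space UNIV)"
proof -
  obtain x z where y: "y = (x, z)" by (cases y)
  define A where "A = {i. x \<in> cell dx i} \<union> {i. z \<in> cell dx i}"
  have A: "finite A" unfolding A_def using finite_cells by simp
  have one: "card {i. w \<in> cell dx i} \<le> 1" for w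
    unfolding One_nat_def card_le_Suc0_iff_eq[OF finite_cells] using cell_disjoint by blast
  have cardA: "card A \<le> 2"
    using card_Un_le[of "{i. x \<in> cell dx i}" "{i. z \<in> cell dx i}"] one[of x] one[of z]
    unfolding A_def by linarith
  define d where "d = (\<lambda>i. cell_function k dx c i z - cell_function k dx c i x)"
  have "dg_function k dx c x = (\<Sum>i\<in>A. cell_function k dx c i x)"
    by (rule dg_function_sum[OF A]) (auto simp: A_def)
  moreover have "dg_function k dx c z = (\<Sum>i\<in>A. cell_function k dx c i z)"
    by (rule dg_function_sum[OF A]) (auto simp: A_def)
  ultimately have "dg_function k dx c z - dg_function k dx c x = (\<Sum>i\<in>A. d i)"
    by (simp add: d_def sum_subtractf)
  then have "(dg_function k dx c z - dg_function k dx c x)\<^sup>2 \<le> (\<Sum>i\<in>A. (d i)\<^sup>2) * card A"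
    using sum_squared_le_sum_of_squares[of d A] A by simp
  also have "\<dots> \<le> (\<Sum>i\<in>A. (d i)\<^sup>2) * 2"
    using cardA by (intro mult_left_mono sum_nonneg) auto
  also have "\<dots> \<le> (\<Sum>i\<in>A. (\<Sum>p\<le>k. (c p i)\<^sup>2 * (dg_basis dx p i z - dg_basis dx p i x)\<^sup>2) * (real k + 1)) * 2"
  proof (intro mult_right_mono sum_mono)
    fix i
    have "d i = (\<Sum>p\<le>k. c p i * (dg_basis dx p i z - dg_basis dx p i x))"
      unfolding d_def cell_function_def by (simp add: sum_subtractf right_diff_distrib)
    then show "(d i)\<^sup>2 \<le> (\<Sum>p\<le>k. (c p i)\<^sup>2 * (dg_basis dx p i z - dg_basis dx p i x)\<^sup>2) * (real k + 1)"
      using sum_squared_le_sum_of_squares[of "\<lambda>p. c p i * (dg_basis dx p i z - dg_basis dx p i x)" "{..k}"]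
      by (simp add: power_mult_distrib add.commute)
  qed simp
  finally have "gagliardo_integrand l (dg_function k dx c) y
    \<le> (\<Sum>i\<in>A. (\<Sum>p\<le>k. (c p i)\<^sup>2 * (dg_basis dx p i z - dg_basis dx p i x)\<^sup>2) * (real k + 1)) * 2
        / \<bar>z - x\<bar> powr (1 + l)"
    unfolding y gagliardo_integrand_def prod.case by (rule divide_right_mono) simp
  also have "\<dots> = (\<Sum>i\<in>A. \<Sum>p\<le>k. 2 * (real k + 1) * (c p i)\<^sup>2 * gagliardo_integrand l (dg_basis dx p i) y)"
    unfolding y gagliardo_integrand_def prod.case sum_distrib_right sum_divide_distrib
    by (intro sum.cong refl) (simp add: mult_ac)
  finally have "ennreal (gagliardo_integrand l (dg_function k dx c) y)
    \<le> ennreal (\<Sum>i\<in>A. \<Sum>p\<le>k. 2 * (real k + 1) * (c p i)\<^sup>2 * gagliardo_integrand l (dg_basis dx p i) y)"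
    by (rule ennreal_leI)
  also have "\<dots> = (\<Sum>i\<in>A. ennreal (\<Sum>p\<le>k. 2 * (real k + 1) * (c p i)\<^sup>2 * gagliardo_integrand l (dg_basis dx p i) y))"
    by (rule sum_ennreal[symmetric])
       (auto intro!: sum_nonneg mult_nonneg_nonneg simp: gagliardo_integrand_def y)
  also have "\<dots> = (\<integral>\<^sup>+i. ennreal (\<Sum>p\<le>k. 2 * (real k + 1) * (c p i)\<^sup>2 * gagliardo_integrand l (dg_basis dx p i) y)
        \<partial>count_space UNIV)"
  proof (rule nn_integral_count_space'[symmetric, OF A])
    fix i assume "i \<notin> A"
    then have "dg_basis dx p i x = 0" "dg_basis dx p i z = 0" for p
      unfolding A_def dg_basis_def by auto
    then show "ennreal (\<Sum>p\<le>k. 2 * (real k + 1) * (c p i)\<^sup>2 * gagliardo_integrand l (dg_basis dx p i) y) = 0"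
      unfolding y gagliardo_integrand_def by simp
  qed simp
  finally show ?thesis .
qed

text \<open>Summing the pointwise bound over the cells leaves a multiple of the sum of squared
  coefficients, which Parseval's identity bounds by the squared L^2 norm.\<close>

lemma dg_inverse_estimate:
  assumes l: "0 < l" "l < 1"
  shows "\<exists>C\<ge>0. \<forall>c. square_integrable lborel (dg_function k dx c) \<longrightarrow>
    dg_function k dx c \<in> sobolev_space l \<and>
    sobolev_norm l (dg_function k dx c) \<le> C * l2_norm lborel (dg_function k dx c)"
proof -
  obtain C where C0: "0 \<le> C" and C: "\<And>p i. p \<le> k \<Longrightarrow>
      (\<integral>\<^sup>+z. ennreal (gagliardo_integrand l (dg_basis dx p i) z) \<partial>(lborel \<Otimes>\<^sub>M lborel)) \<le> ennreal C"
    using dg_basis_gagliardo_bound[OF l] by blast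
  \<comment> \<open>2 (k + 1) counts cells and degrees, \<open>C\<close> bounds the basis, and (2 k
    + 1) / dx undoes the weight dx / (2 p + 1) for every p <= k.\<close>
  define D where "D = 2 * (real k + 1) * C * (2 * real k + 1) / dx"
  have D0: "0 \<le> D" unfolding D_def using C0 dx by simp
  have main: "dg_function k dx c \<in> sobolev_space l \<and>
      sobolev_norm l (dg_function k dx c) \<le> sqrt (1 + D) * l2_norm lborel (dg_function k dx c)"
    if u: "square_integrable lborel (dg_function k dx c)" for c
  proof -
    have "(\<integral>\<^sup>+z. ennreal (gagliardo_integrand l (dg_function k dx c) z) \<partial>(lborel \<Otimes>\<^sub>M lborel))
      \<le> (\<integral>\<^sup>+z. \<integral>\<^sup>+i. ennreal (\<Sum>p\<le>k. 2 * (real k + 1) * (c p i)\<^sup>2 * gagliardo_integrand l (dg_basis dx p i) z)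
          \<partial>count_space UNIV \<partial>(lborel \<Otimes>\<^sub>M lborel))"
      by (rule nn_integral_mono) (rule gagliardo_dg_function_le)
    also have "\<dots> = (\<integral>\<^sup>+i. \<integral>\<^sup>+z. ennreal (\<Sum>p\<le>k. 2 * (real k + 1) * (c p i)\<^sup>2 * gagliardo_integrand l (dg_basis dx p i) z)
          \<partial>(lborel \<Otimes>\<^sub>M lborel) \<partial>count_space UNIV)"
      by (rule nn_integral_count_space_nn_integral) auto
    also have "\<dots> \<le> (\<integral>\<^sup>+i. ennreal D * ennreal (\<Sum>p\<le>k. (c p i)\<^sup>2 * dx / (2 * real p + 1)) \<partial>count_space UNIV)"
    proof (rule nn_integral_mono)
      fix i
      have "(\<integral>\<^sup>+z. ennreal (\<Sum>p\<le>k. 2 * (real k + 1) * (c p i)\<^sup>2 * gagliardo_integrand l (dg_basis dx p i) z) \<partial>(lborel \<Otimes>\<^sub>M lborel))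
        = (\<integral>\<^sup>+z. (\<Sum>p\<le>k. ennreal (2 * (real k + 1) * (c p i)\<^sup>2) * ennreal (gagliardo_integrand l (dg_basis dx p i) z)) \<partial>(lborel \<Otimes>\<^sub>M lborel))"
        by (intro nn_integral_cong)
           (auto simp: gagliardo_integrand_def simp flip: ennreal_mult intro!: sum_ennreal[symmetric])
      also have "\<dots> = (\<Sum>p\<le>k. ennreal (2 * (real k + 1) * (c p i)\<^sup>2) *
          (\<integral>\<^sup>+z. ennreal (gagliardo_integrand l (dg_basis dx p i) z) \<partial>(lborel \<Otimes>\<^sub>M lborel)))"
        by (subst nn_integral_sum) (auto intro!: sum.cong nn_integral_cmult)
      also have "\<dots> \<le> (\<Sum>p\<le>k. ennreal (2 * (real k + 1) * (c p i)\<^sup>2) * ennreal C)"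
        by (intro sum_mono mult_left_mono C) auto
      also have "\<dots> = ennreal (\<Sum>p\<le>k. 2 * (real k + 1) * (c p i)\<^sup>2 * C)"
        using C0 by (subst sum_ennreal[symmetric]) (auto simp: ennreal_mult)
      also have "\<dots> \<le> ennreal (D * (\<Sum>p\<le>k. (c p i)\<^sup>2 * dx / (2 * real p + 1)))"
        unfolding sum_distrib_left
      proof (intro ennreal_leI sum_mono)
        fix p assume "p \<in> {..k}"
        then have "1 \<le> (2 * real k + 1) / (2 * real p + 1)" by simp
        then have "(2 * (real k + 1) * (c p i)\<^sup>2 * C) * 1
            \<le> (2 * (real k + 1) * (c p i)\<^sup>2 * C) * ((2 * real k + 1) / (2 * real p + 1))"
          using C0 by (intro mult_left_mono) auto
        also have "\<dots> = D * ((c p i)\<^sup>2 * dx / (2 * real p + 1))"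
          unfolding D_def using dx by simp
        finally show "2 * (real k + 1) * (c p i)\<^sup>2 * C \<le> D * ((c p i)\<^sup>2 * dx / (2 * real p + 1))" by simp
      qed
      also have "\<dots> = ennreal D * ennreal (\<Sum>p\<le>k. (c p i)\<^sup>2 * dx / (2 * real p + 1))"
        using D0 dx by (intro ennreal_mult sum_nonneg) auto
      finally show "(\<integral>\<^sup>+z. ennreal (\<Sum>p\<le>k. 2 * (real k + 1) * (c p i)\<^sup>2 * gagliardo_integrand l (dg_basis dx p i) z) \<partial>(lborel \<Otimes>\<^sub>M lborel))
        \<le> ennreal D * ennreal (\<Sum>p\<le>k. (c p i)\<^sup>2 * dx / (2 * real p + 1))" .
    qed
    also have "\<dots> = ennreal D * ennreal ((l2_norm lborel (dg_function k dx c))\<^sup>2)"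
      by (simp add: nn_integral_cmult flip: nn_integral_dg_function_sq nn_integral_square[OF u])
    also have "\<dots> = ennreal (D * (l2_norm lborel (dg_function k dx c))\<^sup>2)"
      using D0 by (simp add: ennreal_mult)
    finally have g: "(\<integral>\<^sup>+z. ennreal ((diff_quotient l (dg_function k dx c) z)\<^sup>2) \<partial>(lborel \<Otimes>\<^sub>M lborel))
        \<le> ennreal (D * (l2_norm lborel (dg_function k dx c))\<^sup>2)"
      unfolding diff_quotient_sq .
    note * = l2_norm_sq_le[OF borel_measurable_diff_quotient[OF borel_measurable_dg_function] g]
    have "0 \<le> D * (l2_norm lborel (dg_function k dx c))\<^sup>2" using D0 by simp
    note * = *[OF this]
    have "sobolev_norm l (dg_function k dx c)
        \<le> sqrt ((l2_norm lborel (dg_function k dx c))\<^sup>2 + D * (l2_norm lborel (dg_function k dx c))\<^sup>2)"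
      unfolding sobolev_norm_def L2_norm_eq sobolev_seminorm_eq using *(2) by simp
    also have "\<dots> = sqrt ((1 + D) * (l2_norm lborel (dg_function k dx c))\<^sup>2)"
      by (simp add: algebra_simps)
    also have "\<dots> = sqrt (1 + D) * l2_norm lborel (dg_function k dx c)"
      by (simp add: real_sqrt_mult)
    finally show ?thesis using u *(1) by (simp add: sobolev_space_iff)
  qed
  then show ?thesis using D0 by (intro exI[of _ "sqrt (1 + D)"]) auto
qed

end

section \<open>Convergence of truncations\<close>

context
  fixes dx :: real and k :: nat
  assumes dx: "0 < dx"
begin

lemma dg_function_truncate_square_integrable [simp]:
  "square_integrable lborel (dg_function k dx (truncate_coeffs n c))"
  unfolding dg_function_truncate[OF dx, abs_def]
  by (intro square_integrable_sum cell_function_square_integrable[OF dx])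

lemma dg_function_truncate_inner:
  assumes g: "square_integrable lborel g"
  shows "l2_inner lborel g (dg_function k dx (truncate_coeffs n c))
    = (\<Sum>i\<in>{- int n..<int n}. \<Sum>q\<le>k. c q i * l2_inner lborel g (dg_basis dx q i))"
  unfolding dg_function_truncate[OF dx, abs_def] cell_function_def
  using g by (simp add: l2_inner_sum_right square_integrable_sum square_integrable_scale
      dg_basis_square_integrable[OF dx] l2_inner_scale_right)

lemma dg_function_truncate_form:
  assumes l: "0 < l" "l < 1" and g: "g \<in> sobolev_space l"
  shows "gagliardo_form l g (dg_function k dx (truncate_coeffs n c))
    = (\<Sum>i\<in>{- int n..<int n}. \<Sum>q\<le>k. c q i * gagliardo_form l g (dg_basis dx q i))"
  unfolding dg_function_truncate[OF dx, abs_def] cell_function_def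
  using g by (simp add: gagliardo_form_sum_right sobolev_space_sum sobolev_space_scale
      dg_basis_sobolev[OF dx l] gagliardo_form_scale_right)

text \<open>At every point the remainder is either the function itself or 0, so the square of the
  function dominates.\<close>

lemma dg_truncation_l2:
  assumes u: "square_integrable lborel (dg_function k dx c)"
  shows "(\<lambda>n. l2_norm lborel (\<lambda>x. dg_function k dx c x - dg_function k dx (truncate_coeffs n c) x))
    \<longlonglongrightarrow> 0"
proof -
  let ?r = "\<lambda>n x. dg_function k dx c x - dg_function k dx (truncate_coeffs n c) x"
  have m: "dg_function k dx c \<in> borel_measurable borel" for c
    by (rule borel_measurable_dg_function[OF dx])
  have "(\<lambda>n. LINT x|lborel. (?r n x)\<^sup>2) \<longlonglongrightarrow> (LINT x|(lborel :: real measure). (0::real))"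
  proof (rule integral_dominated_convergence[where w = "\<lambda>x. (dg_function k dx c x)\<^sup>2"])
    show "integrable lborel (\<lambda>x. (dg_function k dx c x)\<^sup>2)"
      using u unfolding square_integrable_def by simp
    show "AE x in lborel. (\<lambda>n. (?r n x)\<^sup>2) \<longlonglongrightarrow> 0"
    proof (rule AE_I2)
      fix x
      have "(\<lambda>n. (?r n x)\<^sup>2) \<longlonglongrightarrow> (dg_function k dx c x - dg_function k dx c x)\<^sup>2"
        by (intro tendsto_intros dg_function_truncate_tendsto[OF dx])
      then show "(\<lambda>n. (?r n x)\<^sup>2) \<longlonglongrightarrow> 0" by simp
    qed
    show "AE x in lborel. norm ((?r n x)\<^sup>2) \<le> (dg_function k dx c x)\<^sup>2" for n
    proof (rule AE_I2)
      fix x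
      show "norm ((?r n x)\<^sup>2) \<le> (dg_function k dx c x)\<^sup>2"
      proof (cases "\<exists>i. x \<in> cell dx i")
        case True
        then obtain i where "x \<in> cell dx i" by blast
        from dg_function_truncate_cell[OF dx this] show ?thesis by simp
      next
        case False
        then have "dg_function k dx d x = 0" for d
          by (intro dg_function_outside[OF dx]) auto
        then show ?thesis by simp
      qed
    qed
  qed (use m in \<open>auto intro!: borel_measurable_power borel_measurable_diff\<close>)
  then have "(\<lambda>n. sqrt (LINT x|lborel. (?r n x)\<^sup>2)) \<longlonglongrightarrow> sqrt 0"
    by (intro tendsto_real_sqrt) simp
  then show ?thesis unfolding l2_norm_def l2_inner_def by (simp add: power2_eq_square)
qed

text \<open>The remainder is a \<open>dg_function\<close> with the tail coefficients, so the inverse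
  estimate upgrades the L^2 convergence of the tails.\<close>

lemma dg_truncation_sobolev:
  assumes l: "0 < l" "l < 1" and u: "square_integrable lborel (dg_function k dx c)"
  shows "dg_function k dx c \<in> sobolev_space l"
    and "dg_function k dx (truncate_coeffs n c) \<in> sobolev_space l"
    and "(\<lambda>n. sobolev_norm l (\<lambda>x. dg_function k dx c x - dg_function k dx (truncate_coeffs n c) x))
      \<longlonglongrightarrow> 0"
proof -
  obtain C where C: "\<And>c. square_integrable lborel (dg_function k dx c) \<Longrightarrow>
    dg_function k dx c \<in> sobolev_space l \<and>
    sobolev_norm l (dg_function k dx c) \<le> C * l2_norm lborel (dg_function k dx c)"
    using dg_inverse_estimate[OF dx l, of k] by blast
  show "dg_function k dx c \<in> sobolev_space l"
    and "dg_function k dx (truncate_coeffs n c) \<in> sobolev_space l"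
    using C u by auto
  let ?r = "\<lambda>n x. dg_function k dx c x - dg_function k dx (truncate_coeffs n c) x"
  have r: "?r n = dg_function k dx (\<lambda>p i. c p i - truncate_coeffs n c p i)" for n
    using dg_function_diff_truncate[OF dx] by auto
  have "square_integrable lborel (?r n)" for n
    using u by (intro square_integrable_diff) auto
  then have b: "sobolev_norm l (?r n) \<le> C * l2_norm lborel (?r n)" for n
    using C unfolding r by blast
  have "(\<lambda>n. C * l2_norm lborel (?r n)) \<longlonglongrightarrow> 0"
    using tendsto_mult_left[OF dg_truncation_l2[OF u], of C] by simp
  then show "(\<lambda>n. sobolev_norm l (?r n)) \<longlonglongrightarrow> 0"
    by (rule Lim_null_comparison[rotated]) (use b in auto)
qed

lemma dg_function_determined:
  assumes l: "0 < l" "l < 1" and u: "square_integrable lborel (dg_function k dx c)"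
  shows "dg_function k dx c \<in> determined l"
proof (rule determined_closed[OF dg_truncation_sobolev(1)[OF l u]])
  fix e :: real assume "e > 0"
  then obtain n where n: "sobolev_norm l (\<lambda>x. dg_function k dx c x - dg_function k dx (truncate_coeffs n c) x) < e"
    using order_tendstoD(2)[OF dg_truncation_sobolev(3)[OF l u]] eventually_happens' sequentially_bot by blast
  have "cell_function k dx c i \<in> determined l" for i
    unfolding cell_function_def[abs_def] by (intro determined_sum[OF l] dg_basis_determined[OF dx l])
  then have "(\<lambda>x. \<Sum>i\<in>{- int n..<int n}. 1 * cell_function k dx c i x) \<in> determined l"
    by (intro determined_sum[OF l])
  then have "dg_function k dx (truncate_coeffs n c) \<in> determined l"
    unfolding dg_function_truncate[OF dx, abs_def] by simp
  then show "\<exists>w\<in>determined l. sobolev_norm l (\<lambda>x. dg_function k dx c x - w x) < e"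
    using n by blast
qed

text \<open>A coefficient outside the window is, up to a fixed factor, the moment of the tail
  against its basis function, whose norm is the same on all cells. A general index sequence covers
  both ends of the line and shifts by one cell.\<close>

lemma dg_coeffs_vanish:
  assumes u: "square_integrable lborel (dg_function k dx c)" and p: "p \<le> k"
    and \<sigma>: "\<And>m. \<forall>\<^sub>F n in sequentially. \<sigma> n \<notin> {- int m..<int m}"
  shows "(\<lambda>n. c p (\<sigma> n)) \<longlonglongrightarrow> 0"
proof (rule LIMSEQ_I)
  fix e :: real assume e: "e > 0"
  \<comment> \<open>The L^2 norm of the basis function with index \<open>p\<close> on any
    cell.\<close>
  define b where "b = sqrt (dx / (2 * real p + 1))"
  have bpos: "b > 0" unfolding b_def using dx by simp
  let ?r = "\<lambda>n x. dg_function k dx c x - dg_function k dx (truncate_coeffs n c) x"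
  have "\<forall>\<^sub>F m in sequentially. l2_norm lborel (?r m) < e * b"
    by (rule order_tendstoD(2)[OF dg_truncation_l2[OF u]]) (use e bpos in simp)
  then obtain m where m: "l2_norm lborel (?r m) < e * b"
    using eventually_happens' sequentially_bot by blast
  have "\<bar>c p i\<bar> < e" if i: "i \<notin> {- int m..<int m}" for i
  proof -
    have bas: "square_integrable lborel (dg_basis dx p i)" by (rule dg_basis_square_integrable[OF dx])
    have "l2_inner lborel (?r m) (dg_basis dx p i) = c p i * dx / (2 * real p + 1)"
      by (subst l2_inner_diff_left[OF u _ bas])
         (use i in \<open>auto simp: dg_function_inner[OF dx p] truncate_coeffs_def\<close>)
    also have "\<dots> = c p i * b\<^sup>2" unfolding b_def using dx by simp
    finally have "\<bar>c p i\<bar> * b\<^sup>2 = \<bar>l2_inner lborel (?r m) (dg_basis dx p i)\<bar>"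
      by (simp add: abs_mult)
    also have "\<dots> \<le> l2_norm lborel (?r m) * l2_norm lborel (dg_basis dx p i)"
      by (rule l2_Cauchy_Schwarz) (use u bas in \<open>auto intro: square_integrable_diff\<close>)
    also have "l2_norm lborel (dg_basis dx p i) = b"
      unfolding l2_norm_def b_def dg_basis_inner[OF dx] by simp
    also have "l2_norm lborel (?r m) * b < e * b * b" using m bpos by simp
    finally show ?thesis using bpos by (simp add: power2_eq_square)
  qed
  then have "\<forall>\<^sub>F n in sequentially. norm (c p (\<sigma> n) - 0) < e"
    using \<sigma>[of m] by (auto elim: eventually_mono)
  then show "\<exists>no. \<forall>n\<ge>no. norm (c p (\<sigma> n) - 0) < e"
    unfolding eventually_sequentially .
qed

section \<open>Traces and the flux terms\<close>

definition trace_right :: "(nat \<Rightarrow> int \<Rightarrow> real) \<Rightarrow> int \<Rightarrow> real" where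
  "trace_right c i = (\<Sum>p\<le>k. c p i * (-1) ^ p)"

text \<open>The limit at x_i from the left is taken in cell i - 1, at whose right end every Legendre
  polynomial equals 1; from the right it is taken in cell i, where the values are (-1)^p.\<close>

definition trace_left :: "(nat \<Rightarrow> int \<Rightarrow> real) \<Rightarrow> int \<Rightarrow> real" where
  "trace_left c i = (\<Sum>p\<le>k. c p (i - 1))"

definition local_poly :: "(nat \<Rightarrow> int \<Rightarrow> real) \<Rightarrow> int \<Rightarrow> real poly" where
  "local_poly c i = (\<Sum>p\<le>k. smult (c p i) (cell_poly dx p i))"

lemma dg_function_local_poly:
  "x \<in> cell dx i \<Longrightarrow> dg_function k dx c x = poly (local_poly c i) x"
  unfolding dg_function_cell[OF dx] cell_function_def local_poly_def dg_basis_eq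
  by (auto simp: cell_def poly_sum)

lemma cell_poly_ends:
  "poly (cell_poly dx p i) (grid_point dx i) = (-1) ^ p"
  "poly (cell_poly dx p i) (grid_point dx (i + 1)) = 1"
proof -
  have 1: "poly [:- 2 * grid_point dx i / dx - 1, 2 / dx:] (grid_point dx i) = -1"
    by simp
  have 2: "poly [:- 2 * grid_point dx i / dx - 1, 2 / dx:] (grid_point dx (i + 1)) = 1"
    unfolding grid_point_Suc[OF dx] using dx by (simp add: field_simps)
  show "poly (cell_poly dx p i) (grid_point dx i) = (-1) ^ p"
    unfolding cell_poly_def poly_pcompose 1 by simp
  show "poly (cell_poly dx p i) (grid_point dx (i + 1)) = 1"
    unfolding cell_poly_def poly_pcompose 2 by simp
qed

lemma local_poly_ends:
  "poly (local_poly c i) (grid_point dx i) = trace_right c i"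
  "poly (local_poly c i) (grid_point dx (i + 1)) = trace_left c (i + 1)"
  unfolding local_poly_def trace_right_def trace_left_def
  by (simp_all add: poly_sum cell_poly_ends)

lemma Lim_dg_function:
  "Lim (at_right (grid_point dx i)) (dg_function k dx c) = trace_right c i"
  "Lim (at_left (grid_point dx i)) (dg_function k dx c) = trace_left c i"
proof -
  have "\<forall>\<^sub>F x in at_right (grid_point dx i). x \<in> cell dx i"
    unfolding cell_def by (rule eventually_at_right_real[OF grid_point_less[OF dx]])
  then have "\<forall>\<^sub>F x in at_right (grid_point dx i). dg_function k dx c x = poly (local_poly c i) x"
    by (rule eventually_mono) (rule dg_function_local_poly)
  moreover have "(poly (local_poly c i) \<longlongrightarrow> trace_right c i) (at_right (grid_point dx i))"
    unfolding local_poly_ends(1)[symmetric]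
    by (rule tendsto_poly[OF tendsto_ident_at])
  ultimately show "Lim (at_right (grid_point dx i)) (dg_function k dx c) = trace_right c i"
    by (intro tendsto_Lim) (auto simp: tendsto_cong trivial_limit_at_right_real)
  have "grid_point dx (i - 1) < grid_point dx i"
    using grid_point_less[OF dx, of "i - 1"] by simp
  from eventually_at_left_real[OF this]
  have "\<forall>\<^sub>F x in at_left (grid_point dx i). x \<in> cell dx (i - 1)"
    unfolding cell_def by simp
  then have "\<forall>\<^sub>F x in at_left (grid_point dx i). dg_function k dx c x = poly (local_poly c (i - 1)) x"
    by (rule eventually_mono) (rule dg_function_local_poly)
  moreover have "(poly (local_poly c (i - 1)) \<longlongrightarrow> trace_left c i) (at_left (grid_point dx i))"
    using local_poly_ends(2)[of c "i - 1"]
      tendsto_poly[OF tendsto_ident_at, of "local_poly c (i - 1)" "grid_point dx i" "{..<grid_point dx i}"]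
    by simp
  ultimately show "Lim (at_left (grid_point dx i)) (dg_function k dx c) = trace_left c i"
    by (intro tendsto_Lim) (auto simp: tendsto_cong trivial_limit_at_left_real)
qed

lemma interface_flux_dg_function:
  "interface_flux F dx (dg_function k dx c) i = F (trace_left c i) (trace_right c i)"
  unfolding interface_flux_def Lim_dg_function ..

lemma deriv_dg_basis:
  assumes "x \<in> cell dx i"
  shows "deriv (dg_basis dx q i) x = poly (pderiv (cell_poly dx q i)) x"
proof (rule DERIV_imp_deriv)
  have "(poly (cell_poly dx q i) has_real_derivative poly (pderiv (cell_poly dx q i)) x) (at x)"
    by (rule poly_DERIV)
  then show "(dg_basis dx q i has_real_derivative poly (pderiv (cell_poly dx q i)) x) (at x)"
    by (rule has_field_derivative_transform_within_open[of _ _ _ "cell dx i"])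
       (use assms in \<open>auto simp: dg_basis_eq cell_def\<close>)
qed

text \<open>The combination of the derivatives of the basis functions is the derivative of the
  solution on the cell, so the integrand is f(u) u' = (H(u))', and the fundamental theorem leaves
  the values of \<open>H\<close> at the inner traces.\<close>

lemma cell_flux_integral:
  assumes f: "continuous_on UNIV f" and H: "\<And>x. (H has_real_derivative f x) (at x)"
  shows "(\<Sum>q\<le>k. c q i * (LINT x:cell dx i|lborel. f (dg_function k dx c x) * deriv (dg_basis dx q i) x))
    = H (trace_left c (i + 1)) - H (trace_right c i)"
proof -
  let ?a = "grid_point dx i" and ?b = "grid_point dx (i + 1)"
  define Q where "Q = local_poly c i"
  have ab: "?a \<le> ?b" using grid_point_less[OF dx, of i] by simp
  have fc: "continuous_on A (\<lambda>x. f (poly Q x))" for A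
    by (intro continuous_on_compose2[OF f] continuous_intros) auto
  have si: "set_integrable lborel (cell dx i) (\<lambda>x. f (poly Q x) * poly r x)" for r
  proof (rule set_integrable_subset)
    show "set_integrable lborel {?a..?b} (\<lambda>x. f (poly Q x) * poly r x)"
      by (intro borel_integrable_atLeastAtMost' continuous_intros fc)
  qed (auto simp: cell_def)
  have "(\<Sum>q\<le>k. c q i * (LINT x:cell dx i|lborel. f (dg_function k dx c x) * deriv (dg_basis dx q i) x))
      = (\<Sum>q\<le>k. LINT x:cell dx i|lborel. c q i * (f (poly Q x) * poly (pderiv (cell_poly dx q i)) x))"
  proof (intro sum.cong refl)
    fix q
    have "(LINT x:cell dx i|lborel. f (dg_function k dx c x) * deriv (dg_basis dx q i) x)
        = (LINT x:cell dx i|lborel. f (poly Q x) * poly (pderiv (cell_poly dx q i)) x)"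
      unfolding set_lebesgue_integral_def Q_def
      by (rule Bochner_Integration.integral_cong)
         (auto simp: indicator_def dg_function_local_poly deriv_dg_basis)
    then show "c q i * (LINT x:cell dx i|lborel. f (dg_function k dx c x) * deriv (dg_basis dx q i) x)
      = (LINT x:cell dx i|lborel. c q i * (f (poly Q x) * poly (pderiv (cell_poly dx q i)) x))"
      by simp
  qed
  also have "\<dots> = (LINT x:cell dx i|lborel. (\<Sum>q\<le>k. c q i * (f (poly Q x) * poly (pderiv (cell_poly dx q i)) x)))"
    using si unfolding set_lebesgue_integral_def set_integrable_def
    by (simp add: sum_distrib_left mult.left_commute flip: Bochner_Integration.integral_sum)
  also have "\<dots> = (LINT x:cell dx i|lborel. f (poly Q x) * poly (pderiv Q) x)"
    unfolding Q_def local_poly_def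
    by (simp add: higher_pderiv_sum[of 1, simplified] pderiv_smult poly_sum sum_distrib_left mult.left_commute)
  also have "\<dots> = (LBINT x=?a..?b. f (poly Q x) * poly (pderiv Q) x)"
    by (subst interval_integral_Ioo) (use ab in \<open>simp_all add: cell_def\<close>)
  also have "\<dots> = H (poly Q ?b) - H (poly Q ?a)"
  proof (rule interval_integral_FTC_finite)
    show "continuous_on {min ?a ?b..max ?a ?b} (\<lambda>x. f (poly Q x) * poly (pderiv Q) x)"
      by (intro continuous_intros fc)
    show "((\<lambda>x. H (poly Q x)) has_vector_derivative f (poly Q x) * poly (pderiv Q) x)
        (at x within {min ?a ?b..max ?a ?b})" for x
      unfolding has_real_derivative_iff_has_vector_derivative[symmetric]
      by (rule DERIV_subset[OF DERIV_chain2[OF H poly_DERIV]]) simp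
  qed
  finally show ?thesis unfolding Q_def local_poly_ends .
qed

end

text \<open>By the mean value theorem the claim is (b - a) (f(s) - F a b) >= 0 for some
  \<open>s\<close> between \<open>a\<close> and \<open>b\<close>. For a < b monotonicity gives F a b
  <= F a s <= F s s = f s, and for b < a the reverse chain. This is the E-flux property of monotone
  fluxes.\<close>

lemma numerical_flux_jump:
  assumes F: "numerical_flux f F" and H: "\<And>x. (H has_real_derivative f x) (at x)"
  shows "H a - F a b * a \<le> H b - F a b * b"
proof -
  have Ff: "F s s = f s" and mono: "s \<le> s' \<Longrightarrow> F s y \<le> F s' y" and anti: "y \<le> y' \<Longrightarrow> F s y' \<le> F s y"
    for s s' y y'
    using F unfolding numerical_flux_def mono_def antimono_def by blast+
  consider "a < b" | "a = b" | "b < a" by linarith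
  then show ?thesis
  proof cases
    case 1
    then obtain s where s: "a < s" "s < b" "H b - H a = (b - a) * f s" using MVT2[of a b H f] H by blast
    have "F a b \<le> f s" using anti[of s b a] mono[of a s s] s unfolding Ff by force
    then have "(b - a) * F a b \<le> (b - a) * f s" using 1 by (intro mult_left_mono) auto
    then show ?thesis using s(3) by (simp add: algebra_simps)
  next
    case 3
    then obtain s where s: "b < s" "s < a" "H a - H b = (a - b) * f s" using MVT2[of b a H f] H by blast
    have "f s \<le> F a b" using anti[of b s a] mono[of s a s] s unfolding Ff by force
    then have "(a - b) * f s \<le> (a - b) * F a b" using 3 by (intro mult_left_mono) auto
    then show ?thesis using s(3) by (simp add: algebra_simps)
  qed simp
qed

lemma sum_int_telescope:
  fixes a :: "int \<Rightarrow> real"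
  shows "(\<Sum>i\<in>{- int n..<int n}. a (i + 1) - a i) = a (int n) - a (- int n)"
proof (induction n)
  case (Suc n)
  have e: "int (Suc n) = int n + 1" "- (int n + 1) = - int n - 1" by auto
  have "{- int n - 1..<int n + 1} = insert (- int n - 1) (insert (int n) {- int n..<int n})" by auto
  moreover have "- int n - 1 \<notin> insert (int n) {- int n..<int n}" by auto
  ultimately show ?case unfolding e using Suc by simp
qed simp

definition flux_part :: "(real \<Rightarrow> real) \<Rightarrow> (real \<Rightarrow> real \<Rightarrow> real) \<Rightarrow> real \<Rightarrow> (real \<Rightarrow> real) \<Rightarrow> nat \<Rightarrow> int \<Rightarrow> real" where
  "flux_part f F dx w q i = (LINT x:cell dx i|lborel. f (w x) * deriv (dg_basis dx q i) x)
     + (-1) ^ q * interface_flux F dx w i - interface_flux F dx w (i + 1)"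

text \<open>Summation by parts leaves the entropy dissipation of the jumps, which has a sign, and
  boundary terms that vanish in the limit.\<close>

lemma flux_part_sum_le:
  fixes k :: nat and c :: "nat \<Rightarrow> int \<Rightarrow> real"
  assumes dx: "0 < dx" and F: "numerical_flux f F" and f: "continuous_on UNIV f"
    and H: "\<And>x. (H has_real_derivative f x) (at x)"
  defines "a \<equiv> \<lambda>i. H (trace_left k c i) - F (trace_left k c i) (trace_right k c i) * trace_left k c i"
  shows "(\<Sum>i\<in>{- int n..<int n}. \<Sum>q\<le>k. c q i * flux_part f F dx (dg_function k dx c) q i)
    \<le> a (int n) - a (- int n)"
proof -
  let ?L = "trace_left k c" and ?R = "trace_right k c"
  let ?F = "\<lambda>i. F (?L i) (?R i)"
  have "(\<Sum>q\<le>k. c q i * flux_part f F dx (dg_function k dx c) q i) \<le> a (i + 1) - a i" for i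
  proof -
    have "(\<Sum>q\<le>k. c q i * flux_part f F dx (dg_function k dx c) q i)
      = (\<Sum>q\<le>k. c q i * (LINT x:cell dx i|lborel. f (dg_function k dx c x) * deriv (dg_basis dx q i) x))
        + (\<Sum>q\<le>k. c q i * (-1) ^ q) * ?F i - (\<Sum>q\<le>k. c q i) * ?F (i + 1)"
      unfolding flux_part_def interface_flux_dg_function[OF dx]
      by (simp add: sum.distrib sum_subtractf sum_distrib_right distrib_left right_diff_distrib mult.assoc)
    also have "\<dots> = (H (?L (i + 1)) - H (?R i)) + ?R i * ?F i - ?L (i + 1) * ?F (i + 1)"
      unfolding cell_flux_integral[OF dx f H] by (simp add: trace_left_def[OF dx] trace_right_def[OF dx])
    also have "\<dots> = a (i + 1) - (H (?R i) - ?F i * ?R i)"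
      unfolding a_def by (simp add: mult.commute)
    \<comment> \<open>The jump inequality at the left interface of the cell replaces the right trace
      there by the left one, which makes the cell contributions telescope.\<close>
    also have "\<dots> \<le> a (i + 1) - a i"
      using numerical_flux_jump[OF F H, of "?L i" "?R i"] unfolding a_def by simp
    finally show ?thesis .
  qed
  then have "(\<Sum>i\<in>{- int n..<int n}. \<Sum>q\<le>k. c q i * flux_part f F dx (dg_function k dx c) q i)
      \<le> (\<Sum>i\<in>{- int n..<int n}. a (i + 1) - a i)"
    by (rule sum_mono)
  then show ?thesis unfolding sum_int_telescope .
qed

section \<open>The energy estimate\<close>

lemma dg_truncate_inner_tendsto:
  assumes dx: "0 < dx" and u: "square_integrable lborel (dg_function k dx c)"
    and v: "square_integrable lborel v"
  shows "(\<lambda>n. l2_inner lborel v (dg_function k dx (truncate_coeffs n c)))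
    \<longlonglongrightarrow> l2_inner lborel v (dg_function k dx c)"
proof (rule l2_inner_tendsto)
  let ?u = "dg_function k dx c"
  let ?un = "\<lambda>n. dg_function k dx (truncate_coeffs n c)"
  have "l2_norm lborel (\<lambda>x. ?un n x - ?u x) = l2_norm lborel (\<lambda>x. ?u x - ?un n x)" for n
    unfolding l2_norm_def l2_inner_def by (simp add: algebra_simps)
  then show "(\<lambda>n. l2_norm lborel (\<lambda>x. ?un n x - ?u x)) \<longlonglongrightarrow> 0"
    using dg_truncation_l2[OF dx u] by simp
  show "(\<lambda>n. l2_norm lborel (\<lambda>x. v x - v x)) \<longlonglongrightarrow> 0"
    by (simp add: l2_norm_def l2_inner_def)
qed (use u v dx in auto)

text \<open>The energy inequality at a fixed time, with \<open>v\<close> in the role of the time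
  derivative. The scheme is applied to truncations of the solution, where all sums are finite, and
  each term then passes to the limit separately.\<close>

lemma dg_energy_dissipation:
  assumes l: "0 < l" "l < 1" and dx: "0 < dx"
    and F: "numerical_flux f F" and f: "continuous_on UNIV f"
    and u: "square_integrable lborel (dg_function k dx c)"
    and v: "square_integrable lborel v"
    and eq: "\<And>q i. q \<le> k \<Longrightarrow> l2_inner lborel v (dg_basis dx q i) = dg_rhs l f F dx (dg_function k dx c) q i"
  shows "2 * l2_inner lborel v (dg_function k dx c)
    \<le> - frac_const l * (sobolev_seminorm l (dg_function k dx c))\<^sup>2"
proof -
  let ?u = "dg_function k dx c"
  let ?un = "\<lambda>n. dg_function k dx (truncate_coeffs n c)"
  have us: "?u \<in> sobolev_space l" and uns: "?un n \<in> sobolev_space l" for n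
    using dg_truncation_sobolev[OF dx l u] by auto
  have ud: "?u \<in> determined l" by (rule dg_function_determined[OF dx l u])
  \<comment> \<open>The normalisation \<open>H 0 = 0\<close> lets the boundary terms vanish when the
    traces do.\<close>
  obtain H where H: "\<And>x. (H has_real_derivative f x) (at x)" "H 0 = 0"
    using ex_antiderivative[OF f] by blast
  define a where "a = (\<lambda>i. H (trace_left k c i) - F (trace_left k c i) (trace_right k c i) * trace_left k c i)"
  have rhs: "dg_rhs l f F dx ?u q i = flux_part f F dx ?u q i + gagliardo_form l ?u (dg_basis dx q i)" for q i
    unfolding dg_rhs_def flux_part_def
    using frac_laplacian_pairing_eq[OF l ud dg_basis_sobolev[OF dx l]] by simp
  have bound: "l2_inner lborel v (?un n) \<le> a (int n) - a (- int n) + gagliardo_form l ?u (?un n)" for n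
  proof -
    have "l2_inner lborel v (?un n)
        = (\<Sum>i\<in>{- int n..<int n}. \<Sum>q\<le>k. c q i * (flux_part f F dx ?u q i + gagliardo_form l ?u (dg_basis dx q i)))"
      unfolding dg_function_truncate_inner[OF dx v] by (intro sum.cong refl) (simp add: eq rhs)
    also have "\<dots> = (\<Sum>i\<in>{- int n..<int n}. \<Sum>q\<le>k. c q i * flux_part f F dx ?u q i)
        + gagliardo_form l ?u (?un n)"
      unfolding dg_function_truncate_form[OF dx l us] by (simp add: distrib_left sum.distrib)
    finally show ?thesis
      using flux_part_sum_le[OF dx F f H(1), where k = k and n = n and c = c] unfolding a_def by simp
  qed
  have Hc: "isCont H x" for x using H(1) by (rule DERIV_isCont)
  \<comment> \<open>Both \<open>\<sigma> n\<close> and its predecessor must leave every window,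
    because the left trace at an interface belongs to the preceding cell.\<close>
  have a_lim: "(\<lambda>n. a (\<sigma> n)) \<longlonglongrightarrow> 0"
    if \<sigma>: "\<And>m. \<forall>\<^sub>F n in sequentially. \<sigma> n \<notin> {- int m..<int m} \<and> \<sigma> n - 1 \<notin> {- int m..<int m}" for \<sigma> :: "nat \<Rightarrow> int"
  proof -
    have "\<forall>\<^sub>F n in sequentially. \<sigma> n \<notin> {- int m..<int m}"
      "\<forall>\<^sub>F n in sequentially. \<sigma> n - 1 \<notin> {- int m..<int m}" for m
      by (rule eventually_mono[OF \<sigma>[of m]], simp)+
    then have "(\<lambda>n. c p (\<sigma> n)) \<longlonglongrightarrow> 0" "(\<lambda>n. c p (\<sigma> n - 1)) \<longlonglongrightarrow> 0" if "p \<le> k" for p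
      by (intro dg_coeffs_vanish[OF dx u that]; simp)+
    then have "(\<lambda>n. \<Sum>p\<le>k. c p (\<sigma> n) * (-1) ^ p) \<longlonglongrightarrow> (\<Sum>p\<le>k. 0 * (-1) ^ p)"
      "(\<lambda>n. \<Sum>p\<le>k. c p (\<sigma> n - 1)) \<longlonglongrightarrow> (\<Sum>p\<le>k. 0)"
      by (intro tendsto_sum tendsto_mult tendsto_const; simp)+
    then have R: "(\<lambda>n. trace_right k c (\<sigma> n)) \<longlonglongrightarrow> 0" and L: "(\<lambda>n. trace_left k c (\<sigma> n)) \<longlonglongrightarrow> 0"
      unfolding trace_right_def[OF dx] trace_left_def[OF dx] by simp_all
    obtain K where "K-lipschitz_on UNIV (\<lambda>(a, b). F a b)" using F unfolding numerical_flux_def by blast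
    then have "continuous_on UNIV (\<lambda>(a, b). F a b)" by (rule lipschitz_on_continuous_on)
    then have Fc: "isCont (\<lambda>(a, b). F a b) (0, 0)" by (simp add: continuous_on_eq_continuous_at)
    have "(\<lambda>n. (\<lambda>(a, b). F a b) (trace_left k c (\<sigma> n), trace_right k c (\<sigma> n))) \<longlonglongrightarrow> (\<lambda>(a, b). F a b) (0, 0)"
      by (rule isCont_tendsto_compose[OF Fc tendsto_Pair[OF L R]])
    then have FL: "(\<lambda>n. F (trace_left k c (\<sigma> n)) (trace_right k c (\<sigma> n))) \<longlonglongrightarrow> F 0 0" by simp
    have "(\<lambda>n. a (\<sigma> n)) \<longlonglongrightarrow> H 0 - F 0 0 * 0"
      unfolding a_def by (intro tendsto_diff tendsto_mult FL L isCont_tendsto_compose[OF Hc L])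
    then show ?thesis using H(2) by simp
  qed
  have "(\<lambda>n. a (int n)) \<longlonglongrightarrow> 0"
  proof (rule a_lim)
    show "\<forall>\<^sub>F n in sequentially. int n \<notin> {- int m..<int m} \<and> int n - 1 \<notin> {- int m..<int m}" for m
      by (rule eventually_mono[OF eventually_gt_at_top[of m]]) auto
  qed
  moreover have "(\<lambda>n. a (- int n)) \<longlonglongrightarrow> 0"
  proof (rule a_lim)
    show "\<forall>\<^sub>F n in sequentially. - int n \<notin> {- int m..<int m} \<and> - int n - 1 \<notin> {- int m..<int m}" for m
      by (rule eventually_mono[OF eventually_gt_at_top[of m]]) auto
  qed
  moreover have "(\<lambda>n. gagliardo_form l ?u (?un n)) \<longlonglongrightarrow> gagliardo_form l ?u ?u"
  proof -
    have "(\<lambda>n. gagliardo_form l ?u (?un n) - gagliardo_form l ?u ?u) \<longlonglongrightarrow> 0"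
    proof (rule Lim_null_comparison)
      show "(\<lambda>n. \<bar>frac_const l / 2\<bar> * sobolev_norm l ?u * sobolev_norm l (\<lambda>x. ?u x - ?un n x)) \<longlonglongrightarrow> 0"
        using tendsto_mult_left[OF dg_truncation_sobolev(3)[OF dx l u]] by simp
      show "\<forall>\<^sub>F n in sequentially. norm (gagliardo_form l ?u (?un n) - gagliardo_form l ?u ?u)
          \<le> \<bar>frac_const l / 2\<bar> * sobolev_norm l ?u * sobolev_norm l (\<lambda>x. ?u x - ?un n x)"
      proof (intro always_eventually allI)
        fix n
        have "gagliardo_form l ?u (\<lambda>x. ?u x - ?un n x) = gagliardo_form l ?u ?u - gagliardo_form l ?u (?un n)"
          using gagliardo_form_lincomb_right[OF us uns us, of 1 "-1"] by simp
        then show "norm (gagliardo_form l ?u (?un n) - gagliardo_form l ?u ?u)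
          \<le> \<bar>frac_const l / 2\<bar> * sobolev_norm l ?u * sobolev_norm l (\<lambda>x. ?u x - ?un n x)"
          using gagliardo_form_bound[OF us sobolev_space_diff[OF us uns[of n]]] by (simp add: abs_minus_commute)
      qed
    qed
    then show ?thesis using Lim_null by blast
  qed
  ultimately have "(\<lambda>n. a (int n) - a (- int n) + gagliardo_form l ?u (?un n)) \<longlonglongrightarrow> 0 - 0 + gagliardo_form l ?u ?u"
    by (intro tendsto_intros)
  moreover have "(\<lambda>n. l2_inner lborel v (?un n)) \<longlonglongrightarrow> l2_inner lborel v ?u"
    by (rule dg_truncate_inner_tendsto[OF dx u v])
  ultimately have "l2_inner lborel v ?u \<le> 0 - 0 + gagliardo_form l ?u ?u"
    by (intro LIMSEQ_le[where X = "\<lambda>n. l2_inner lborel v (?un n)"]) (use bound in blast)+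
  then show ?thesis unfolding gagliardo_form_self by simp
qed

text \<open>Equality of all moments makes \<open>g\<close> minus its projection orthogonal to the
  projection, by passage through the truncations; Cauchy-Schwarz then gives |u|^2 = <g, u> <= |g|
  |u|.\<close>

lemma dg_projection_norm_le:
  assumes dx: "0 < dx" and g: "square_integrable lborel g"
    and u: "square_integrable lborel (dg_function k dx c)"
    and proj: "\<And>q i. q \<le> k \<Longrightarrow> c q i = (2 * real q + 1) / dx * l2_inner lborel g (dg_basis dx q i)"
  shows "l2_norm lborel (dg_function k dx c) \<le> l2_norm lborel g"
proof -
  let ?u = "dg_function k dx c"
  let ?un = "\<lambda>n. dg_function k dx (truncate_coeffs n c)"
  have inner: "l2_inner lborel g (dg_basis dx q i) = l2_inner lborel ?u (dg_basis dx q i)" if "q \<le> k" for q i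
    using proj[OF that, of i] dx unfolding dg_function_inner[OF dx that] by (simp add: field_simps)
  have "l2_inner lborel g (?un n) = l2_inner lborel ?u (?un n)" for n
    unfolding dg_function_truncate_inner[OF dx g] dg_function_truncate_inner[OF dx u]
    by (intro sum.cong refl) (simp add: inner)
  then have "l2_inner lborel g ?u = l2_inner lborel ?u ?u"
    using dg_truncate_inner_tendsto[OF dx u g] dg_truncate_inner_tendsto[OF dx u u]
    by (simp add: LIMSEQ_unique)
  then have "(l2_norm lborel ?u)\<^sup>2 \<le> l2_norm lborel g * l2_norm lborel ?u"
    unfolding l2_norm_sq using l2_Cauchy_Schwarz[OF g u] by simp
  then show ?thesis
    by (cases "l2_norm lborel ?u = 0") (auto simp: power2_eq_square less_le)
qed

section \<open>Differentiable curves in L^2\<close>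

lemma eventually_at_within: "\<forall>\<^sub>F s in at t within S. s \<in> S \<and> s \<noteq> t"
  by (simp add: eventually_at_filter)

text \<open>The increment is s - t times the difference quotient, whose norm stays bounded because
  the quotient converges.\<close>

lemma l2_curve_continuous:
  fixes u :: "real \<Rightarrow> 'a \<Rightarrow> real"
  assumes u: "\<And>s. s \<in> S \<Longrightarrow> square_integrable M (u s)" and t: "t \<in> S" and w: "square_integrable M w"
    and d: "((\<lambda>s. l2_norm M (\<lambda>x. (u s x - u t x) / (s - t) - w x)) \<longlongrightarrow> 0) (at t within S)"
  shows "((\<lambda>s. l2_norm M (\<lambda>x. u s x - u t x)) \<longlongrightarrow> 0) (at t within S)"
proof (rule Lim_null_comparison)
  let ?q = "\<lambda>s x. (u s x - u t x) / (s - t)"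
  show "((\<lambda>s. \<bar>s - t\<bar> * (l2_norm M (\<lambda>x. ?q s x - w x) + l2_norm M w)) \<longlongrightarrow> 0) (at t within S)"
    by (rule tendsto_eq_intros d refl | simp)+
  show "\<forall>\<^sub>F s in at t within S. norm (l2_norm M (\<lambda>x. u s x - u t x))
      \<le> \<bar>s - t\<bar> * (l2_norm M (\<lambda>x. ?q s x - w x) + l2_norm M w)"
    using eventually_at_within
  proof eventually_elim
    case (elim s)
    have q: "square_integrable M (?q s)"
      using square_integrable_scale[OF square_integrable_diff[OF u u[OF t]], of s "1 / (s - t)"] elim by simp
    have "l2_norm M (\<lambda>x. u s x - u t x) = l2_norm M (\<lambda>x. (s - t) * ?q s x)" using elim by simp
    also have "\<dots> = \<bar>s - t\<bar> * l2_norm M (?q s)" by (rule l2_norm_scale)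
    also have "\<dots> \<le> \<bar>s - t\<bar> * (l2_norm M (\<lambda>x. ?q s x - w x) + l2_norm M w)"
      using l2_norm_triangle[OF square_integrable_diff[OF q w] w] by (intro mult_left_mono) auto
    finally show ?case by simp
  qed
qed

lemma l2_curve_norm_sq_continuous:
  fixes u :: "real \<Rightarrow> 'a \<Rightarrow> real"
  assumes u: "\<And>s. s \<in> S \<Longrightarrow> square_integrable M (u s)" and t: "t \<in> S"
    and c: "((\<lambda>s. l2_norm M (\<lambda>x. u s x - u t x)) \<longlongrightarrow> 0) (at t within S)"
  shows "((\<lambda>s. (l2_norm M (u s))\<^sup>2) \<longlongrightarrow> (l2_norm M (u t))\<^sup>2) (at t within S)"
  unfolding l2_norm_sq
  by (rule l2_inner_tendsto[OF eventually_mono[OF eventually_at_within] u[OF t] u[OF t] c c])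
     (use u in auto)

text \<open>For the squared norm, symmetry writes the scalar difference quotient as the inner
  product of the quotient of the curve with \<open>u s + u t\<close>, and both factors converge in
  L^2.\<close>

lemma l2_curve_inner_derivative:
  fixes u :: "real \<Rightarrow> 'a \<Rightarrow> real"
  assumes u: "\<And>s. s \<in> S \<Longrightarrow> square_integrable M (u s)" and t: "t \<in> S" and w: "square_integrable M w"
    and d: "((\<lambda>s. l2_norm M (\<lambda>x. (u s x - u t x) / (s - t) - w x)) \<longlongrightarrow> 0) (at t within S)"
  shows "square_integrable M g \<Longrightarrow>
      ((\<lambda>s. l2_inner M (u s) g) has_real_derivative l2_inner M w g) (at t within S)"
    and "((\<lambda>s. (l2_norm M (u s))\<^sup>2) has_real_derivative 2 * l2_inner M w (u t)) (at t within S)"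
proof -
  let ?q = "\<lambda>s x. (u s x - u t x) / (s - t)"
  have q: "square_integrable M (?q s)" if "s \<in> S" for s
    using square_integrable_scale[OF square_integrable_diff[OF u[OF that] u[OF t]], of "1 / (s - t)"] by simp
  have q_inner: "l2_inner M (?q s) h = (l2_inner M (u s) h - l2_inner M (u t) h) / (s - t)"
    if "s \<in> S" "square_integrable M h" for s h
    using l2_inner_scale_left[of M "1 / (s - t)" "\<lambda>x. u s x - u t x" h]
      l2_inner_diff_left[OF u[OF that(1)] u[OF t] that(2)] by simp
  have const: "((\<lambda>s. l2_norm M (\<lambda>x. h x - h x)) \<longlongrightarrow> 0) (at t within S)" for h :: "'a \<Rightarrow> real"
    by (simp add: l2_norm_def l2_inner_def)
  note cont = l2_curve_continuous[OF u t w d]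
  show "((\<lambda>s. l2_inner M (u s) g) has_real_derivative l2_inner M w g) (at t within S)"
    if g: "square_integrable M g"
  proof -
    have "((\<lambda>s. l2_inner M (?q s) g) \<longlongrightarrow> l2_inner M w g) (at t within S)"
      by (rule l2_inner_tendsto[OF eventually_mono[OF eventually_at_within] w g d const]) (use q g in auto)
    moreover have "\<forall>\<^sub>F s in at t within S. l2_inner M (?q s) g = (l2_inner M (u s) g - l2_inner M (u t) g) / (s - t)"
      by (rule eventually_mono[OF eventually_at_within]) (use q_inner g in auto)
    ultimately show ?thesis unfolding has_field_derivative_iff by (simp add: tendsto_cong)
  qed
  have "((\<lambda>s. l2_inner M (?q s) (\<lambda>x. u s x + u t x)) \<longlongrightarrow> l2_inner M w (\<lambda>x. u t x + u t x)) (at t within S)"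
  proof (rule l2_inner_tendsto[OF eventually_mono[OF eventually_at_within] w _ d])
    show "square_integrable M (?q s) \<and> square_integrable M (\<lambda>x. u s x + u t x)" if "s \<in> S \<and> s \<noteq> t" for s
      using that q u t by (auto intro: square_integrable_add)
    show "square_integrable M (\<lambda>x. u t x + u t x)" by (rule square_integrable_add[OF u[OF t] u[OF t]])
  qed (use cont in simp)
  moreover have "l2_inner M w (\<lambda>x. u t x + u t x) = 2 * l2_inner M w (u t)"
    using l2_inner_add_right[OF u[OF t] u[OF t] w] by simp
  moreover have "\<forall>\<^sub>F s in at t within S. l2_inner M (?q s) (\<lambda>x. u s x + u t x)
      = ((l2_norm M (u s))\<^sup>2 - (l2_norm M (u t))\<^sup>2) / (s - t)"
    using eventually_at_within
  proof eventually_elim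
    case (elim s)
    then have s: "square_integrable M (u s)" and ut: "square_integrable M (u t)" using u t by auto
    show ?case
      using elim unfolding q_inner[OF conjunct1[OF elim] square_integrable_add[OF s ut]] l2_norm_sq
      by (simp add: l2_inner_add_right s ut l2_inner_commute[of M "u t" "u s"])
  qed
  ultimately show "((\<lambda>s. (l2_norm M (u s))\<^sup>2) has_real_derivative 2 * l2_inner M w (u t)) (at t within S)"
    unfolding has_field_derivative_iff by (simp add: tendsto_cong)
qed

theorem theorem3p1:
  fixes l T dx :: real
    and k :: nat
    and u0 f :: "real \<Rightarrow> real"
    and F :: "real \<Rightarrow> real \<Rightarrow> real"
    and u :: "real \<Rightarrow> real \<Rightarrow> real"
  assumes "0 < l" and "l < 1"
    and "T > 0"
    and "dx > 0"
    and "u0 \<in> L2_space"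
    and "\<exists>L. L-lipschitz_on UNIV f"
    and "f 0 = 0"
    and "numerical_flux f F"
    and "dg_solution l k T dx f F u0 u"
    and "C1_sobolev l T u"
  shows "(L2_norm (u T))\<^sup>2 + frac_const l * (LINT t:{0..T}|lborel. (sobolev_seminorm l (u t))\<^sup>2)
           \<le> (L2_norm u0)\<^sup>2"
proof -
  note l = assms(1,2) and T = assms(3) and dx = assms(4)
  let ?S = "{0..T}"
  let ?P = "lborel \<Otimes>\<^sub>M lborel :: (real \<times> real) measure"
  have f: "continuous_on UNIV f" using assms(6) lipschitz_on_continuous_on by blast
  obtain U where U: "\<And>t. t \<in> ?S \<Longrightarrow> u t = dg_function k dx (\<lambda>p i. U p i t)"
    and ode: "\<And>q i t. q \<le> k \<Longrightarrow> t \<in> ?S \<Longrightarrow>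
      ((\<lambda>s. dx / (2 * real q + 1) * U q i s) has_real_derivative dg_rhs l f F dx (u t) q i) (at t within ?S)"
    and init: "\<And>q i. q \<le> k \<Longrightarrow>
      U q i 0 = (2 * real q + 1) / dx * (LINT x:cell dx i|lborel. u0 x * dg_basis dx q i x)"
    using assms(9) unfolding dg_solution_def by blast
  obtain v where us: "\<And>t. t \<in> ?S \<Longrightarrow> u t \<in> sobolev_space l"
    and vs: "\<And>t. t \<in> ?S \<Longrightarrow> v t \<in> sobolev_space l"
    and d: "\<And>t. t \<in> ?S \<Longrightarrow>
      ((\<lambda>s. sobolev_norm l (\<lambda>x. (u s x - u t x) / (s - t) - v t x)) \<longlongrightarrow> 0) (at t within ?S)"
    using assms(10) unfolding C1_sobolev_def by blast
  have u2: "square_integrable lborel (u t)" and v2: "square_integrable lborel (v t)"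
    and uD: "square_integrable ?P (diff_quotient l (u t))" and vD: "square_integrable ?P (diff_quotient l (v t))"
    if "t \<in> ?S" for t
    using us[OF that] vs[OF that] unfolding sobolev_space_iff by auto
  have d2: "((\<lambda>s. l2_norm lborel (\<lambda>x. (u s x - u t x) / (s - t) - v t x)) \<longlongrightarrow> 0) (at t within ?S)"
    if "t \<in> ?S" for t
    by (rule Lim_null_comparison[OF _ d[OF that]]) (simp add: l2_norm_le_sobolev_norm)
  \<comment> \<open>The map \<open>diff_quotient l\<close> is linear and its L^2 norm is at most the
    Sobolev norm, so differentiability carries over to the curve of difference quotients on the
    plane.\<close>
  have dD: "((\<lambda>s. l2_norm ?P (\<lambda>p. (diff_quotient l (u s) p - diff_quotient l (u t) p) / (s - t)
      - diff_quotient l (v t) p)) \<longlongrightarrow> 0) (at t within ?S)" if "t \<in> ?S" for t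
  proof (rule Lim_null_comparison[OF _ d[OF that]], rule always_eventually, rule allI)
    fix s
    have "(\<lambda>p. (diff_quotient l (u s) p - diff_quotient l (u t) p) / (s - t) - diff_quotient l (v t) p)
        = diff_quotient l (\<lambda>x. (1 / (s - t)) * (u s x - u t x) - v t x)"
      unfolding diff_quotient_diff diff_quotient_scale by simp
    then show "norm (l2_norm ?P (\<lambda>p. (diff_quotient l (u s) p - diff_quotient l (u t) p) / (s - t)
      - diff_quotient l (v t) p)) \<le> sobolev_norm l (\<lambda>x. (u s x - u t x) / (s - t) - v t x)"
      using sobolev_seminorm_le_sobolev_norm[of l "\<lambda>x. (u s x - u t x) / (s - t) - v t x"]
      unfolding sobolev_seminorm_eq by simp
  qed
  define E where "E = (\<lambda>t. (l2_norm lborel (u t))\<^sup>2)"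
  define N where "N = (\<lambda>t. (sobolev_seminorm l (u t))\<^sup>2)"
  have E': "(E has_real_derivative 2 * l2_inner lborel (v t) (u t)) (at t within ?S)" if "t \<in> ?S" for t
    unfolding E_def by (rule l2_curve_inner_derivative(2)[OF u2 that v2[OF that] d2[OF that]])
  \<comment> \<open>Continuity makes the time integral differentiable in its upper limit and lets
    the gauge integral be exchanged for the Lebesgue one.\<close>
  have N_cont: "continuous_on ?S N"
    unfolding continuous_on_def N_def sobolev_seminorm_eq
  proof
    fix t assume t: "t \<in> ?S"
    show "((\<lambda>s. (l2_norm ?P (diff_quotient l (u s)))\<^sup>2) \<longlongrightarrow> (l2_norm ?P (diff_quotient l (u t)))\<^sup>2) (at t within ?S)"
      by (rule l2_curve_norm_sq_continuous[OF uD t l2_curve_continuous[OF uD t vD[OF t] dD[OF t]]])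
  qed
  \<comment> \<open>The derivative of a moment is computed twice, from the curve in L^2 and from the
    scheme; the results agree because T > 0 leaves no isolated point in [0, T]. This ties the
    Sobolev derivative \<open>v\<close> to the right-hand side of the scheme.\<close>
  have coeff': "l2_inner lborel (v t) (dg_basis dx q i) = dg_rhs l f F dx (u t) q i"
    if t: "t \<in> ?S" and q: "q \<le> k" for t q i
  proof (rule has_field_derivative_unique)
    show "((\<lambda>s. l2_inner lborel (u s) (dg_basis dx q i)) has_real_derivative
        l2_inner lborel (v t) (dg_basis dx q i)) (at t within ?S)"
      by (rule l2_curve_inner_derivative(1)[OF u2 t v2[OF t] d2[OF t] dg_basis_square_integrable[OF dx]])
    show "((\<lambda>s. l2_inner lborel (u s) (dg_basis dx q i)) has_real_derivative dg_rhs l f F dx (u t) q i) (at t within ?S)"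
      by (rule has_field_derivative_transform_within[OF ode[OF q t] zero_less_one t])
         (simp add: U dg_function_inner[OF dx q])
    show "at t within ?S \<noteq> bot" using t T by (simp add: trivial_limit_within islimpt_Icc)
  qed
  have dissip: "2 * l2_inner lborel (v t) (u t) \<le> - frac_const l * N t" if t: "t \<in> ?S" for t
    unfolding N_def U[OF t]
    by (rule dg_energy_dissipation[OF l dx assms(8) f])
       (use u2[OF t] v2[OF t] coeff'[OF t] U[OF t] in auto)
  \<comment> \<open>Energy plus accumulated dissipation, a quantity that does not increase in
    time.\<close>
  define \<Phi> where "\<Phi> = (\<lambda>t. E t + frac_const l * integral {0..t} N)"
  have \<Phi>': "(\<Phi> has_real_derivative 2 * l2_inner lborel (v t) (u t) + frac_const l * N t) (at t within ?S)"
    if t: "t \<in> ?S" for t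
    unfolding \<Phi>_def
    by (intro DERIV_add E' DERIV_cmult integral_has_real_derivative N_cont t)
  have "\<Phi> T \<le> \<Phi> 0"
  proof (rule DERIV_nonpos_imp_decreasing_open[of 0 T \<Phi>])
    show "0 \<le> T" using T by simp
    show "\<exists>y. DERIV \<Phi> t :> y \<and> y \<le> 0" if "0 < t" "t < T" for t
      using \<Phi>'[of t] dissip[of t] that at_within_Icc_at[of 0 t T]
      by (intro exI[of _ "2 * l2_inner lborel (v t) (u t) + frac_const l * N t"]) auto
    show "continuous_on ?S \<Phi>"
      using \<Phi>' by (intro DERIV_continuous_on) auto
  qed
  moreover have "\<Phi> T = E T + frac_const l * (LINT t:?S|lborel. N t)"
    unfolding \<Phi>_def
    by (simp add: set_borel_integral_eq_integral(2)[OF borel_integrable_atLeastAtMost'[OF N_cont]])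
  moreover have "\<Phi> 0 = E 0" unfolding \<Phi>_def by simp
  moreover have "E 0 \<le> (l2_norm lborel u0)\<^sup>2"
  proof -
    have 0: "0 \<in> ?S" using T by simp
    \<comment> \<open>The basis function vanishes off its cell, so the initial data are moments over
      the whole line.\<close>
    have "U q i 0 = (2 * real q + 1) / dx * l2_inner lborel u0 (dg_basis dx q i)" if "q \<le> k" for q i
    proof -
      have "(LINT x:cell dx i|lborel. u0 x * dg_basis dx q i x) = l2_inner lborel u0 (dg_basis dx q i)"
        unfolding set_lebesgue_integral_def l2_inner_def
        by (rule Bochner_Integration.integral_cong) (auto simp: indicator_def dg_basis_def)
      then show ?thesis using init[OF that] by simp
    qed
    then have "l2_norm lborel (u 0) \<le> l2_norm lborel u0"
      unfolding U[OF 0] using u2[OF 0] assms(5)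
      by (intro dg_projection_norm_le[OF dx]) (auto simp: L2_space_iff U[OF 0])
    then show ?thesis unfolding E_def by (simp add: power_mono)
  qed
  ultimately have "E T + frac_const l * (LINT t:?S|lborel. N t) \<le> (l2_norm lborel u0)\<^sup>2" by linarith
  then show ?thesis unfolding E_def N_def L2_norm_eq .
qed

end
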